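(* Let $n\ge 1$, let $1<\mathfrak{p}<+\infty$ be a constant exponent, let $p\in\mathcal{P}^{\log}(\mathbb{R}^n)$ be a variable exponent with $1<p^-\leq p^+<+\infty$, and let $0<s<\min\{n/p^+,n/\mathfrak{p}\}$. Set $\theta=\frac{s\mathfrak{p}}{n}$ and let the function $\sigma(\cdot)$ be given by $$\sigma(\cdot)=\frac{p(\cdot)}{1-\theta}=\frac{n\,p(\cdot)}{n-s\mathfrak{p}}.$$ Then there is a constant $C>0$ (independent of $f$) such that for every $f\in\dot{\mathcal{S}}^{s,p(\cdot)}_{\mathfrak{p}}(\mathbb{R}^n)$, $$\|f\|_{L^{\sigma(\cdot)}(\mathbb{R}^n)}\leq C\,\|f\|_{\dot{\mathcal{S}}^{s,p(\cdot)}_{\mathfrak{p}}(\mathbb{R}^n)}.$$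
   Context: Variable exponents: $\mathcal{P}(\mathbb{R}^n)$ is the set of measurable functions $p:\mathbb{R}^n\to[1,+\infty]$; $p^-=\operatorname{ess\,inf}_{x}p(x)$ and $p^+=\operatorname{ess\,sup}_{x}p(x)$. The class $\mathcal{P}^{\log}(\mathbb{R}^n)$ consists of those $p\in\mathcal{P}(\mathbb{R}^n)$ for which there is a constant $C$ with $$\left|\frac{1}{p(x)}-\frac{1}{p(y)}\right|\leq\frac{C}{\log(e+1/|x-y|)}\ \text{ for all }x,y\in\mathbb{R}^n,\qquad \left|\frac{1}{p(x)}-\frac{1}{p_\infty}\right|\leq\frac{C}{\log(e+|x|)}\ \text{ for all }x\in\mathbb{R}^n,$$ where $\frac{1}{p_\infty}=\lim_{|x|\to+\infty}\frac{1}{p(x)}$. Variable Lebesgue space: for $p\in\mathcal{P}(\mathbb{R}^n)$ with $1<p^-\le p^+<+\infty$, $L^{p(\cdot)}(\mathbb{R}^n)$ is the set of measurable functions $f$ for which the Luxemburg norm $\|f\|_{L^{p(\cdot)}(\mathbb{R}^n)}=\inf\{\lambda>0:\int_{\mathbb{R}^n}|f(x)/\lambda|^{p(x)}dx\leq1\}$ is finite. For a constant exponent this is the usual Lebesgue space. Fractional Laplacian: for $s>0$, $\widehat{(-\Delta)^{\frac s2}(f)}(\xi)=|\xi|^s\widehat{f}(\xi)$, extended to tempered distributions by standard procedures. Sobolev spaces: for $0<s<n/p^+$, $\dot{W}^{s,p(\cdot)}(\mathbb{R}^n)$ is the closure of smooth functions with respect to the functional $\|f\|_{\dot{W}^{s,p(\cdot)}(\mathbb{R}^n)}=\|(-\Delta)^{\frac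 s2}(f)\|_{L^{p(\cdot)}(\mathbb{R}^n)}$; the same definition is used for a constant exponent $\mathfrak{p}$ (with $0<s<n/\mathfrak{p}$), giving $\dot{W}^{s,\mathfrak{p}}(\mathbb{R}^n)$. Mixed Sobolev space: $\dot{\mathcal{S}}^{s,p(\cdot)}_{\mathfrak{p}}(\mathbb{R}^n)=\dot{W}^{s,p(\cdot)}(\mathbb{R}^n)\cap\dot{W}^{s,\mathfrak{p}}(\mathbb{R}^n)$, with $\|f\|_{\dot{\mathcal{S}}^{s,p(\cdot)}_{\mathfrak{p}}(\mathbb{R}^n)}=\max\{\|f\|_{\dot{W}^{s,p(\cdot)}(\mathbb{R}^n)},\|f\|_{\dot{W}^{s,\mathfrak{p}}(\mathbb{R}^n)}\}$. *)

theory Defs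
  imports "HOL-Analysis.Analysis" "HOL-Probability.Essential_Supremum"
begin

section \<open>Variable exponents\<close>

definition exponents :: "(real ^ 'n \<Rightarrow> ereal) set" where
  "exponents = {p. p \<in> borel_measurable lebesgue \<and> (\<forall>x. 1 \<le> p x)}"

definition exponent_sup :: "(real ^ 'n \<Rightarrow> ereal) \<Rightarrow> ereal" where
  "exponent_sup p = esssup lebesgue p"

definition exponent_inf :: "(real ^ 'n \<Rightarrow> ereal) \<Rightarrow> ereal" where
  "exponent_inf p = - esssup lebesgue (\<lambda>x. - p x)"

text \<open>In \<^typ>\<open>ereal\<close>, \<open>1 / \<infinity> = 0\<close>. The limit \<open>1 / p\<^sub>\<infinity>\<close> is the real number \<open>q\<close>.
  At \<open>x = y\<close> the first condition is vacuous (its left-hand side is \<open>0\<close>).\<close>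

definition log_exponents :: "(real ^ 'n \<Rightarrow> ereal) set" where
  "log_exponents = {p \<in> exponents. \<exists>C :: real.
     (\<forall>x y. \<bar>real_of_ereal (1 / p x) - real_of_ereal (1 / p y)\<bar> \<le> C / ln (exp 1 + 1 / norm (x - y))) \<and>
     (\<exists>q :: real. ((\<lambda>x. real_of_ereal (1 / p x)) \<longlongrightarrow> q) at_infinity \<and>
        (\<forall>x. \<bar>real_of_ereal (1 / p x) - q\<bar> \<le> C / ln (exp 1 + norm x)))}"

text \<open>The Luxemburg norm, for exponents that are finite almost everywhere (the value
  \<^term>\<open>real_of_ereal \<infinity> = 0\<close> is only met on a null set when the essential supremum is finite).
  It is \<open>\<infinity>\<close> if no admissible \<open>\<lambda>\<close> exists.\<close>

definition lux_norm :: "(real ^ 'n \<Rightarrow> ereal) \<Rightarrow> (real ^ 'n \<Rightarrow> complex) \<Rightarrow> ennreal" where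
  "lux_norm p f = Inf {ennreal c | c. 0 < c \<and>
     (\<integral>\<^sup>+ x. ennreal (norm (f x / complex_of_real c) powr real_of_ereal (p x)) \<partial>lebesgue) \<le> 1}"


section \<open>Schwartz functions and tempered distributions\<close>

primrec partial_derivs :: "'n::finite list \<Rightarrow> (real ^ 'n \<Rightarrow> complex) \<Rightarrow> real ^ 'n \<Rightarrow> complex" where
  "partial_derivs [] f = f"
| "partial_derivs (i # is) f = (\<lambda>x. frechet_derivative (partial_derivs is f) (at x) (axis i 1))"

definition smooth :: "(real ^ 'n::finite \<Rightarrow> complex) \<Rightarrow> bool" where
  "smooth f \<longleftrightarrow> (\<forall>is x. partial_derivs is f differentiable (at x))"

definition schwartz :: "(real ^ 'n::finite \<Rightarrow> complex) set" where
  "schwartz = {f. smooth f \<and>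
     (\<forall>is k. \<exists>B. \<forall>x. (1 + norm x) ^ k * norm (partial_derivs is f x) \<le> B)}"

definition schwartz_norm :: "nat \<Rightarrow> (real ^ 'n::finite \<Rightarrow> complex) \<Rightarrow> real" where
  "schwartz_norm N f =
     (SUP (x, is) \<in> UNIV \<times> {is. length is \<le> N}. (1 + norm x) ^ N * norm (partial_derivs is f x))"

text \<open>Distributions are functionals whose values outside \<open>schwartz\<close> are irrelevant.\<close>

definition tempered :: "((real ^ 'n::finite \<Rightarrow> complex) \<Rightarrow> complex) set" where
  "tempered = {u.
     (\<forall>\<phi>\<in>schwartz. \<forall>\<psi>\<in>schwartz. u (\<lambda>x. \<phi> x + \<psi> x) = u \<phi> + u \<psi>) \<and>
     (\<forall>c. \<forall>\<phi>\<in>schwartz. u (\<lambda>x. c * \<phi> x) = c * u \<phi>) \<and>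
     (\<exists>C N. \<forall>\<phi>\<in>schwartz. norm (u \<phi>) \<le> C * schwartz_norm N \<phi>)}"

definition regular_dist :: "(real ^ 'n \<Rightarrow> complex) \<Rightarrow> (real ^ 'n \<Rightarrow> complex) \<Rightarrow> complex" where
  "regular_dist f \<phi> = (LINT x|lebesgue. f x * \<phi> x)"

definition represents ::
    "(real ^ 'n::finite \<Rightarrow> complex) \<Rightarrow> ((real ^ 'n \<Rightarrow> complex) \<Rightarrow> complex) \<Rightarrow> bool" where
  "represents f u \<longleftrightarrow> f \<in> borel_measurable lebesgue \<and>
     (\<forall>\<phi>\<in>schwartz. integrable lebesgue (\<lambda>x. f x * \<phi> x) \<and> u \<phi> = regular_dist f \<phi>)"

definition fourier :: "(real ^ 'n \<Rightarrow> complex) \<Rightarrow> real ^ 'n \<Rightarrow> complex" where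
  "fourier f \<xi> = (LINT x|lebesgue. cis (- (x \<bullet> \<xi>)) * f x)"

definition fourier_dist ::
    "((real ^ 'n \<Rightarrow> complex) \<Rightarrow> complex) \<Rightarrow> (real ^ 'n \<Rightarrow> complex) \<Rightarrow> complex" where
  "fourier_dist u \<phi> = u (fourier \<phi>)"

text \<open>The variable Lebesgue norm of a tempered distribution: that of the function representing it
  (which is unique up to null sets), and \<open>\<infinity>\<close> if the distribution is not a function.\<close>

definition Lp_norm ::
    "(real ^ 'n::finite \<Rightarrow> ereal) \<Rightarrow> ((real ^ 'n \<Rightarrow> complex) \<Rightarrow> complex) \<Rightarrow> ennreal" where
  "Lp_norm p u = Inf {lux_norm p f | f. represents f u}"


section \<open>Fractional Laplacian and Sobolev spaces\<close>

text \<open>\<open>frac_laplacian s u v\<close> says that \<open>v\<close> is a version of \<open>(-\<Delta>)\<^bsup>s/2\<^esup> u\<close>, i.e. that the Fourier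
  transform of \<open>v\<close> is \<open>|\<xi>|\<^sup>s\<close> times that of \<open>u\<close>. As \<open>|\<xi>|\<^sup>s\<close> is not smooth at the origin,
  the product is taken on \<open>\<xi> \<noteq> 0\<close>: the test functions vanish near the origin, so that
  \<open>|\<xi>|\<^sup>s \<psi>\<close> is again a Schwartz function. This fixes \<open>v\<close> up to a polynomial, and
  hence fixes it completely if it is to lie in a Lebesgue space with bounded exponent.\<close>

definition frac_laplacian ::
    "real \<Rightarrow> ((real ^ 'n::finite \<Rightarrow> complex) \<Rightarrow> complex) \<Rightarrow> ((real ^ 'n \<Rightarrow> complex) \<Rightarrow> complex) \<Rightarrow> bool" where
  "frac_laplacian s u v \<longleftrightarrow> u \<in> tempered \<and> v \<in> tempered \<and>
     (\<forall>\<psi>\<in>schwartz. (\<exists>r>0. \<forall>\<xi>. norm \<xi> < r \<longrightarrow> \<psi> \<xi> = 0) \<longrightarrow>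
        fourier_dist v \<psi> = fourier_dist u (\<lambda>\<xi>. complex_of_real (norm \<xi> powr s) * \<psi> \<xi>))"

definition W_norm ::
    "real \<Rightarrow> (real ^ 'n::finite \<Rightarrow> ereal) \<Rightarrow> ((real ^ 'n \<Rightarrow> complex) \<Rightarrow> complex) \<Rightarrow> ennreal" where
  "W_norm s p u = Inf {Lp_norm p v | v. frac_laplacian s u v}"

text \<open>\<^const>\<open>W_norm\<close> vanishes on polynomials, so the closure of the Schwartz functions under
  it alone would contain the constants. As usual for \<open>s < n / p\<^sup>+\<close>, the closure is realized in the
  space of tempered distributions: the approximating sequence also converges there.\<close>

definition W_space ::
    "real \<Rightarrow> (real ^ 'n::finite \<Rightarrow> ereal) \<Rightarrow> ((real ^ 'n \<Rightarrow> complex) \<Rightarrow> complex) set" where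
  "W_space s p = {u \<in> tempered. \<exists>\<phi> :: nat \<Rightarrow> real ^ 'n \<Rightarrow> complex.
     (\<forall>k. \<phi> k \<in> schwartz) \<and>
     (\<forall>\<psi>\<in>schwartz. (\<lambda>k. regular_dist (\<phi> k) \<psi>) \<longlonglongrightarrow> u \<psi>) \<and>
     (\<lambda>k. W_norm s p (\<lambda>\<psi>. u \<psi> - regular_dist (\<phi> k) \<psi>)) \<longlonglongrightarrow> 0}"

definition mixed_space ::
    "real \<Rightarrow> (real ^ 'n::finite \<Rightarrow> ereal) \<Rightarrow> real \<Rightarrow> ((real ^ 'n \<Rightarrow> complex) \<Rightarrow> complex) set" where
  "mixed_space s p \<pp> = W_space s p \<inter> W_space s (\<lambda>_. ereal \<pp>)"

definition mixed_norm ::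
    "real \<Rightarrow> (real ^ 'n::finite \<Rightarrow> ereal) \<Rightarrow> real \<Rightarrow> ((real ^ 'n \<Rightarrow> complex) \<Rightarrow> complex) \<Rightarrow> ennreal" where
  "mixed_norm s p \<pp> u = max (W_norm s p u) (W_norm s (\<lambda>_. ereal \<pp>) u)"

end

theory Submission
  imports Defs "HOL-Probability.Probability"
begin

text \<open>
  Let \<open>\<kappa>\<close> be a smooth radial symbol, vanishing near \<open>0\<close>, for which \<open>|\<xi>|\<^sup>s 2\<^sup>-\<^sup>j\<^sup>s \<kappa>(2\<^sup>-\<^sup>j\<xi>)\<close> telescopes
  in \<open>j\<close>. If \<open>g\<close> is a version of \<open>(-\<Delta>)\<^bsup>s/2\<^esup> u\<close>, then \<open>c u = \<Sum>\<^sub>j 2\<^sup>-\<^sup>j\<^sup>s K\<^sub>j * g\<close> with the dilated kernels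
  \<open>K\<^sub>j\<close> of the inverse transform of \<open>\<kappa>\<close>; this replaces the Riesz potential. Since \<open>\<kappa>\<close> vanishes near \<open>0\<close>,
  \<open>K\<^sub>j * g\<close> depends on \<open>u\<close> alone, so the version \<open>g\<^sub>1\<close> in \<open>L\<^bsup>p(\<cdot>)\<^esup>\<close> and the version \<open>g\<^sub>2\<close> in the constant exponent
  space need not be compared: \<open>|K\<^sub>j * g|\<close> is bounded both by \<open>M g\<^sub>1\<close>, with the maximal operator \<open>M\<close>, and by
  \<open>2\<^bsup>jn/\<pp>\<^esup> \<parallel>g\<^sub>2\<parallel>\<close>. Summing the smaller of the two bounds (Hedberg) gives
  \<open>|u| \<le> C (M g\<^sub>1)\<^bsup>1-\<theta>\<^esup> \<parallel>g\<^sub>2\<parallel>\<^bsup>\<theta>\<^esup>\<close>, and the theorem follows from the boundedness of \<open>M\<close> on \<open>L\<^bsup>p(\<cdot>)\<^esup>\<close> for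
  log-Hoelder exponents. The series is identified with \<open>c u\<close> along the approximating Schwartz functions.
\<close>

section \<open>The dyadic maximal operator\<close>

text \<open>Since |xi|^s is not smooth at the origin, \<open>frac_laplacian\<close> tests only
  functions vanishing near 0 and leaves v undetermined up to polynomials, so u cannot be recovered
  from a version of its fractional Laplacian alone. Hence kappa(xi) = |xi|^(-s) (chi(xi) - chi(2
  xi)) with chi = 1 near 0, and u is only applied to differences of low-pass kernels. For a Schwartz
  function these differences telescope to an approximate identity at the fine end and to 0 at the
  coarse end; for a polynomial they would give nothing. This is why the series is identified through
  the approximating sequence, with the remainders u - phi_i controlled in the constant exponent
  space. The constant c is the integral of the transform of chi, found by inversion at the origin to
  be the square of the integral of the Gaussian. The exponent theta is s / d, where d = n / pp is
  the growth rate in j of the second bound. Boundedness of M for variable exponents is reduced to a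
  constant exponent q > 1 below p by a pointwise estimate applied to f^(p/q), in which log-Hoelder
  continuity makes the exponents at x and y interchangeable up to a factor.\<close>

definition ball_mean :: "('a::euclidean_space \<Rightarrow> ennreal) \<Rightarrow> int \<Rightarrow> 'a \<Rightarrow> ennreal" where
  "ball_mean g k x = (\<integral>\<^sup>+y\<in>ball x (2 powi k). g y \<partial>lborel) / emeasure lborel (ball x (2 powi k))"

text \<open>Only the radii 2^k occur: the supremum is then countable, which gives Borel
  measurability at once, and the kernels to be estimated are dyadic anyway.\<close>

definition maximal :: "('a::euclidean_space \<Rightarrow> ennreal) \<Rightarrow> 'a \<Rightarrow> ennreal" where
  "maximal g x = (SUP k. ball_mean g k x)"

section \<open>Averages over dyadic balls and the weak type bound\<close>

lemma emeasure_ball_pos: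
  assumes "0 < r"
  shows "emeasure lborel (ball (x::'a::euclidean_space) r) \<noteq> 0" "emeasure lborel (ball x r) \<noteq> \<top>"
  using assms by (simp_all add: emeasure_ball ennreal_eq_0_iff not_le)

lemma ball_mean_mult:
  "ball_mean g k x * emeasure lborel (ball x (2 powi k)) = (\<integral>\<^sup>+y\<in>ball x (2 powi k). g y \<partial>lborel)"
  unfolding ball_mean_def ennreal_divide_times
  by (subst ennreal_divide_self) (auto simp: emeasure_ball_pos emeasure_lborel_ball_finite[unfolded infinity_ennreal_def])

lemma measurable_ball_mean [measurable]:
  assumes [measurable]: "g \<in> borel_measurable borel"
  shows "ball_mean g k \<in> borel_measurable (borel :: 'a::euclidean_space measure)"
proof -
  have "ball_mean g k = (\<lambda>x. (\<integral>\<^sup>+y. g y * (if dist x y < 2 powi k then 1 else 0) \<partial>lborel)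
      / ennreal (unit_ball_vol (DIM('a)) * (2 powi k) ^ DIM('a)))"
    unfolding ball_mean_def fun_eq_iff
    by (auto simp: emeasure_ball indicator_def intro!: arg_cong2[where f="(/)"] nn_integral_cong)
  also have "\<dots> \<in> borel_measurable borel"
    by measurable
  finally show ?thesis .
qed

lemma measurable_maximal [measurable]:
  assumes [measurable]: "g \<in> borel_measurable borel"
  shows "maximal g \<in> borel_measurable (borel :: 'a::euclidean_space measure)"
  unfolding maximal_def by measurable

lemma ball_mean_le_maximal: "ball_mean g k x \<le> maximal g x"
  unfolding maximal_def by (rule SUP_upper) simp

lemma ball_mean_mono:
  "(\<And>y. dist x y < 2 powi k \<Longrightarrow> f y \<le> g y) \<Longrightarrow> ball_mean f k x \<le> ball_mean g k x"
  unfolding ball_mean_def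
  by (intro divide_right_mono_ennreal nn_integral_mono) (auto simp: indicator_def)

lemma ball_mean_const: "ball_mean (\<lambda>_. c) k x = c"
  unfolding ball_mean_def
  by (simp add: nn_integral_cmult_indicator)
     (metis emeasure_ball_pos ennreal_mult_divide_eq zero_less_power_int zero_less_numeral)

lemma ball_mean_add:
  assumes [measurable]: "f \<in> borel_measurable borel" "g \<in> borel_measurable borel"
  shows "ball_mean (\<lambda>y. f y + g y) k x = ball_mean f k x + ball_mean g k x"
proof -
  have "(\<lambda>y. f y * indicator (ball x (2 powi k)) y) \<in> borel_measurable lborel"
    "(\<lambda>y. g y * indicator (ball x (2 powi k)) y) \<in> borel_measurable lborel"
    using assms by (auto intro!: borel_measurable_times_ennreal borel_measurable_indicator)
  then show ?thesis
    unfolding ball_mean_def distrib_right by (simp add: nn_integral_add add_divide_distrib_ennreal)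
qed

lemma ball_mean_cmult:
  assumes [measurable]: "g \<in> borel_measurable borel"
  shows "ball_mean (\<lambda>y. c * g y) k x = c * ball_mean g k x"
proof -
  have "(\<lambda>y. g y * indicator (ball x (2 powi k)) y) \<in> borel_measurable lborel"
    using assms by (auto intro!: borel_measurable_times_ennreal borel_measurable_indicator)
  then show ?thesis
    unfolding ball_mean_def mult.assoc by (simp add: nn_integral_cmult ennreal_times_divide)
qed

text \<open>Vitali covering: every point of the level set has a ball whose mean exceeds t. Disjoint
  balls among them carry mass at least t times their volume, and their fivefold enlargements cover
  the level set, hence 5^n.\<close>

lemma weak_type_maximal:
  fixes g :: "'a::euclidean_space \<Rightarrow> ennreal"
  assumes [measurable]: "g \<in> borel_measurable borel" and "0 < t"
  shows "ennreal t * emeasure lborel {x. ennreal t < maximal g x} \<le> 5 ^ DIM('a) * (\<integral>\<^sup>+y. g y \<partial>lborel)"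
proof (cases "(\<integral>\<^sup>+y. g y \<partial>lborel) = \<top>")
  case True
  then show ?thesis by (simp add: ennreal_mult_top)
next
  case False
  define V where "V = unit_ball_vol (DIM('a))"
  have V: "V > 0" unfolding V_def by simp
  from False obtain I where I: "(\<integral>\<^sup>+y. g y \<partial>lborel) = ennreal I" "I \<ge> 0"
    by (cases "\<integral>\<^sup>+y. g y \<partial>lborel") auto
  define S where "S = {x. ennreal t < maximal g x}"
  have "\<forall>x\<in>S. \<exists>k. ennreal t < ball_mean g k x"
    unfolding S_def maximal_def by (auto simp: less_SUP_iff)
  then obtain k where k: "\<And>x. x \<in> S \<Longrightarrow> ennreal t < ball_mean g (k x) x" by metis
  define r where "r x = (2::real) powi (k x)" for x
  have r0: "r x > 0" for x unfolding r_def by simp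
  have B: "ennreal t * emeasure lborel (ball x (r x)) \<le> (\<integral>\<^sup>+y\<in>ball x (r x). g y \<partial>lborel)"
    if "x \<in> S" for x
    unfolding r_def ball_mean_mult[symmetric] using k[OF that] by (intro mult_right_mono) auto
  \<comment> \<open>The covering lemma needs uniformly bounded radii. The volume of a selected ball
    is at most I / t, and for r > 1 the inequality r \<le> r^n turns this into a bound on r
    itself.\<close>
  have bd: "r x \<le> max 1 (I / (t * V))" if "x \<in> S" for x
  proof (cases "r x \<le> 1")
    case False
    have "ennreal (t * (V * r x ^ DIM('a))) = ennreal t * emeasure lborel (ball x (r x))"
      using \<open>0 < t\<close> r0[of x] V by (simp add: emeasure_ball V_def ennreal_mult less_imp_le)
    also have "\<dots> \<le> (\<integral>\<^sup>+y\<in>ball x (r x). g y \<partial>lborel)" by (rule B[OF that])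
    also have "\<dots> \<le> (\<integral>\<^sup>+y. g y \<partial>lborel)" by (intro nn_integral_mono) (auto simp: indicator_def)
    finally have "t * (V * r x ^ DIM('a)) \<le> I"
      using I by simp
    then have "r x ^ DIM('a) \<le> I / (t * V)"
      using \<open>0 < t\<close> V by (simp add: field_simps)
    moreover have "r x \<le> r x ^ DIM('a)" using False by (intro self_le_power) auto
    ultimately show ?thesis by simp
  qed simp
  obtain C where C: "countable C" "C \<subseteq> S"
     "pairwise (\<lambda>i j. disjnt (ball i (r i)) (ball j (r j))) C"
     "S \<subseteq> (\<Union>i\<in>C. ball i (5 * r i))"
  proof (rule Vitali_covering_lemma_balls[of S "\<lambda>i. i" r S "max 1 (I / (t * V))"])
    show "S \<subseteq> (\<Union>i\<in>S. ball i (r i))" using r0 by auto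
    show "0 < r i \<and> r i \<le> max 1 (I / (t * V))" if "i \<in> S" for i using r0 bd that by blast
  qed
  \<comment> \<open>The countable family, possibly finite, is re-indexed by naturals with empty sets
    at indices outside \<open>D\<close>, so that countable subadditivity and additivity over
    \<open>nat\<close> apply.\<close>
  define e where "e = inv_into C (to_nat_on C)"
  define D where "D = to_nat_on C ` C"
  have inj: "inj_on (to_nat_on C) C" using C(1) by (rule inj_on_to_nat_on)
  have eC: "e n \<in> C" "to_nat_on C (e n) = n" if "n \<in> D" for n
    using that unfolding e_def D_def by (auto intro: inv_into_into f_inv_into_f)
  have De: "i = e (to_nat_on C i) \<and> to_nat_on C i \<in> D" if "i \<in> C" for i
    using that inj unfolding e_def D_def by auto
  define B1 where "B1 n = (if n \<in> D then ball (e n) (r (e n)) else {})" for n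
  define B5 where "B5 n = (if n \<in> D then ball (e n) (5 * r (e n)) else {})" for n
  have [measurable]: "B1 n \<in> sets lborel" "B5 n \<in> sets lborel" for n
    unfolding B1_def B5_def by auto
  have [simp]: "B1 n \<in> sets borel" "B5 n \<in> sets borel" for n
    unfolding B1_def B5_def by auto
  have disj: "disjoint_family B1"
    unfolding disjoint_family_on_def B1_def
  proof (safe, goal_cases)
    case (1 m n x)
    then have "m \<in> D" "n \<in> D" by (auto split: if_splits)
    with 1 eC have "e m \<noteq> e n" "e m \<in> C" "e n \<in> C" by metis+
    with C(3) have "disjnt (ball (e m) (r (e m))) (ball (e n) (r (e n)))"
      by (auto simp: pairwise_def)
    with 1 \<open>m \<in> D\<close> \<open>n \<in> D\<close> show ?case by (auto simp: disjnt_iff)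
  qed
  have "S \<subseteq> (\<Union>n. B5 n)"
  proof
    fix x assume "x \<in> S"
    then obtain i where "i \<in> C" "x \<in> ball i (5 * r i)" using C(4) by auto
    with De[of i] show "x \<in> (\<Union>n. B5 n)" unfolding B5_def by auto metis
  qed
  moreover have "(\<Union>n. B5 n) \<in> sets lborel" by (rule sets.countable_UN) (auto simp: B5_def)
  ultimately have "emeasure lborel S \<le> emeasure lborel (\<Union>n. B5 n)"
    by (intro emeasure_mono) blast+
  also have "\<dots> \<le> (\<Sum>n. emeasure lborel (B5 n))"
    by (intro emeasure_subadditive_countably) auto
  also have "\<dots> = (\<Sum>n. 5 ^ DIM('a) * emeasure lborel (B1 n))"
  proof (intro suminf_cong)
    fix n
    show "emeasure lborel (B5 n) = 5 ^ DIM('a) * emeasure lborel (B1 n)"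
      using r0[of "e n"] unfolding B5_def B1_def
      by (auto simp: emeasure_ball less_imp_le power_mult_distrib ennreal_mult ennreal_power[symmetric] mult_ac)
  qed
  also have "\<dots> = 5 ^ DIM('a) * (\<Sum>n. emeasure lborel (B1 n))" by simp
  finally have "ennreal t * emeasure lborel S \<le> ennreal t * (5 ^ DIM('a) * (\<Sum>n. emeasure lborel (B1 n)))"
    by (intro mult_left_mono) auto
  also have "\<dots> = 5 ^ DIM('a) * (\<Sum>n. ennreal t * emeasure lborel (B1 n))"
    by (simp add: mult_ac)
  also have "\<dots> \<le> 5 ^ DIM('a) * (\<Sum>n. \<integral>\<^sup>+y\<in>B1 n. g y \<partial>lborel)"
  proof (intro mult_left_mono suminf_le)
    fix n
    show "ennreal t * emeasure lborel (B1 n) \<le> (\<integral>\<^sup>+y\<in>B1 n. g y \<partial>lborel)"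
      using B[of "e n"] eC C(2) unfolding B1_def by auto
  qed auto
  also have "(\<Sum>n. \<integral>\<^sup>+y\<in>B1 n. g y \<partial>lborel) = (\<integral>\<^sup>+y\<in>(\<Union>n. B1 n). g y \<partial>lborel)"
    by (rule nn_integral_disjoint_family[symmetric]) (use disj in auto)
  also have "\<dots> \<le> (\<integral>\<^sup>+y. g y \<partial>lborel)" by (intro nn_integral_mono) (auto simp: indicator_def)
  finally show ?thesis unfolding S_def by (simp add: mult_left_mono)
qed

section \<open>From weak type to strong type\<close>

lemma nn_integral_powr_from_0:
  assumes "0 \<le> c" "-1 < a"
  shows "(\<integral>\<^sup>+ u. ennreal (u powr a) * indicator {0<..<c} u \<partial>lborel) = ennreal (c powr (a + 1) / (a + 1))"
proof -
  have "((\<lambda>u. u powr a) has_integral (c powr (a + 1) / (a + 1))) {0..c}"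
    using has_integral_powr_from_0[OF assms(2,1)] .
  then have "((\<lambda>u. if u \<in> {0..c} then u powr a else 0) has_integral (c powr (a + 1) / (a + 1))) UNIV"
    by (subst has_integral_restrict_UNIV)
  then have "(\<integral>\<^sup>+ u. ennreal (if u \<in> {0..c} then u powr a else 0) \<partial>lborel) = ennreal (c powr (a + 1) / (a + 1))"
    by (intro nn_integral_has_integral_lborel) auto
  also have "(\<integral>\<^sup>+ u. ennreal (if u \<in> {0..c} then u powr a else 0) \<partial>lborel) = (\<integral>\<^sup>+ u. ennreal (u powr a) * indicator {0<..<c} u \<partial>lborel)"
  proof (rule nn_integral_cong_AE)
    have "AE u in lborel. u \<noteq> (0::real) \<and> u \<noteq> c"
      using AE_lborel_singleton[of 0] AE_lborel_singleton[of c] by eventually_elim auto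
    then show "AE u in lborel. ennreal (if u \<in> {0..c} then u powr a else 0) = ennreal (u powr a) * indicator {0<..<c} u"
      by eventually_elim (auto simp: indicator_def)
  qed
  finally show ?thesis .
qed

text \<open>Splitting f at height c costs only the maximal function of a constant, which is that
  constant.\<close>

lemma maximal_add_const_le: "maximal f x \<le> maximal (\<lambda>y. f y * indicator {y. c < f y} y) x + c"
  if [measurable]: "f \<in> borel_measurable borel"
  for f :: "'a::euclidean_space \<Rightarrow> ennreal"
proof -
  have "ball_mean f k x \<le> maximal (\<lambda>y. f y * indicator {y. c < f y} y) x + c" for k
  proof -
    have "ball_mean f k x \<le> ball_mean (\<lambda>y. f y * indicator {y. c < f y} y + c) k x"
      by (intro ball_mean_mono) (auto simp: indicator_def not_less)
    also have "\<dots> = ball_mean (\<lambda>y. f y * indicator {y. c < f y} y) k x + c"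
      by (subst ball_mean_add) (auto simp: ball_mean_const)
    also have "\<dots> \<le> maximal (\<lambda>y. f y * indicator {y. c < f y} y) x + c"
      by (intro add_right_mono ball_mean_le_maximal)
    finally show ?thesis .
  qed
  then show ?thesis unfolding maximal_def by (intro SUP_least) auto
qed

text \<open>The part of f below t/2 adds at most t/2 to the maximal function, so only the part above
  t/2 needs the weak type bound, at height t/2; this is the source of the factor 2. The truncation
  makes the right-hand side integrable against powers of t, as strong type requires.\<close>

lemma weak_type_maximal_truncated:
  fixes f :: "'a::euclidean_space \<Rightarrow> ennreal"
  assumes [measurable]: "f \<in> borel_measurable borel" and t: "0 < t"
  shows "ennreal t * emeasure lborel {x. ennreal t < maximal f x}
    \<le> 2 * 5 ^ DIM('a) * (\<integral>\<^sup>+y. f y * indicator {y. ennreal (t / 2) < f y} y \<partial>lborel)"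
proof -
  let ?g = "\<lambda>y. f y * indicator {y. ennreal (t / 2) < f y} y"
  have sub: "{x. ennreal t < maximal f x} \<subseteq> {x. ennreal (t/2) < maximal ?g x}"
  proof safe
    fix x assume a: "ennreal t < maximal f x"
    show "ennreal (t/2) < maximal ?g x"
    proof (rule ccontr)
      assume "\<not> ennreal (t/2) < maximal ?g x"
      then have "maximal ?g x + ennreal (t/2) \<le> ennreal (t/2) + ennreal (t/2)"
        by (intro add_right_mono) auto
      also have "\<dots> = ennreal t" using t by (simp flip: ennreal_plus)
      finally show False using a maximal_add_const_le[of f x "ennreal (t/2)"] by auto
    qed
  qed
  have "ennreal t * emeasure lborel {x. ennreal t < maximal f x}
      \<le> ennreal t * emeasure lborel {x. ennreal (t/2) < maximal ?g x}"
    by (intro mult_left_mono emeasure_mono sub) auto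
  also have "\<dots> = 2 * (ennreal (t/2) * emeasure lborel {x. ennreal (t/2) < maximal ?g x})"
    using t by (simp add: mult.assoc[symmetric] ennreal_mult'[symmetric] flip: ennreal_numeral)
  also have "\<dots> \<le> 2 * (5 ^ DIM('a) * (\<integral>\<^sup>+y. ?g y \<partial>lborel))"
    using t by (intro mult_left_mono weak_type_maximal) auto
  finally show ?thesis by (simp add: mult.assoc)
qed

text \<open>Where the maximal function is infinite, \<^const>\<open>enn2real\<close> gives \<open>0\<close>; this is a null set by
  \<open>AE_maximal_finite\<close> below.\<close>

lemma maximal_strong_type:
  fixes f :: "'a::euclidean_space \<Rightarrow> real"
  assumes [measurable]: "f \<in> borel_measurable borel" and f0: "\<And>x. 0 \<le> f x" and q: "1 < q"
  shows "(\<integral>\<^sup>+x. ennreal (enn2real (maximal (\<lambda>y. ennreal (f y)) x) powr q) \<partial>lborel)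
    \<le> ennreal (2 * 5 ^ DIM('a) * q * 2 powr (q - 1) / (q - 1)) * (\<integral>\<^sup>+x. ennreal (f x powr q) \<partial>lborel)"
proof -
  define M where "M x = enn2real (maximal (\<lambda>y. ennreal (f y)) x)" for x
  have [measurable]: "M \<in> borel_measurable borel" unfolding M_def by measurable
  have M0: "0 \<le> M x" for x unfolding M_def by simp
  have le: "{x. u < M x} \<subseteq> {x. ennreal u < maximal (\<lambda>y. ennreal (f y)) x}" if "0 < u" for u
  proof safe
    fix x assume "u < M x"
    then show "ennreal u < maximal (\<lambda>y. ennreal (f y)) x"
      using that unfolding M_def
      by (cases "maximal (\<lambda>y. ennreal (f y)) x") (auto simp: ennreal_less_iff)
  qed
  let ?c = "2 * 5 ^ DIM('a) :: real"
  \<comment> \<open>Layer cake: M^q is q times the integral of u^(q-1) over 0 < u < M. Tonelli then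
    gives an integral over the level sets.\<close>
  have "(\<integral>\<^sup>+x. ennreal (M x powr q) \<partial>lborel)
      = (\<integral>\<^sup>+x. ennreal q * (\<integral>\<^sup>+u. ennreal (u powr (q - 1)) * indicator {0<..<M x} u \<partial>lborel) \<partial>lborel)"
    using q M0 by (intro nn_integral_cong) (subst nn_integral_powr_from_0, auto simp: ennreal_mult'[symmetric])
  also have "\<dots> = ennreal q * (\<integral>\<^sup>+x. (\<integral>\<^sup>+u. ennreal (u powr (q - 1)) * indicator {0<..<M x} u \<partial>lborel) \<partial>lborel)"
    by (intro nn_integral_cmult) (simp add: indicator_def)
  also have "(\<integral>\<^sup>+x. (\<integral>\<^sup>+u. ennreal (u powr (q - 1)) * indicator {0<..<M x} u \<partial>lborel) \<partial>lborel)
      = (\<integral>\<^sup>+u. (\<integral>\<^sup>+x. ennreal (u powr (q - 1)) * indicator {0<..<M x} u \<partial>lborel) \<partial>lborel)"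
    by (intro lborel_pair.Fubini') (simp add: indicator_def)
  also have "\<dots> \<le> (\<integral>\<^sup>+u. (\<integral>\<^sup>+y. ennreal ?c * ennreal (f y) * (ennreal (u powr (q - 2)) * indicator {0<..<2 * f y} u) \<partial>lborel) \<partial>lborel)"
  proof (rule nn_integral_mono)
    fix u :: real
    show "(\<integral>\<^sup>+x. ennreal (u powr (q - 1)) * indicator {0<..<M x} u \<partial>lborel)
       \<le> (\<integral>\<^sup>+y. ennreal ?c * ennreal (f y) * (ennreal (u powr (q - 2)) * indicator {0<..<2 * f y} u) \<partial>lborel)"
    proof (cases "0 < u")
      case True
      \<comment> \<open>One factor u is spent on the weak type estimate. The remaining u^(q-2) is
        integrated over 0 < u < 2 f(y) after a second exchange, where q > 1 makes it converge; this
        produces 2^(q-1) / (q-1).\<close>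
      have e: "ennreal (u powr (q - 1)) = ennreal (u powr (q - 2)) * ennreal u"
        using True by (simp add: powr_mult_base ennreal_mult'[symmetric] mult.commute)
      have "(\<integral>\<^sup>+x. ennreal (u powr (q - 1)) * indicator {0<..<M x} u \<partial>lborel)
        = (\<integral>\<^sup>+x. ennreal (u powr (q - 1)) * indicator {x. u < M x} x \<partial>lborel)"
        using True by (intro nn_integral_cong) (auto simp: indicator_def)
      also have "\<dots> = ennreal (u powr (q - 1)) * emeasure lborel {x. u < M x}"
        by (subst nn_integral_cmult_indicator) auto
      also have "\<dots> \<le> ennreal (u powr (q - 1)) * emeasure lborel {x. ennreal u < maximal (\<lambda>y. ennreal (f y)) x}"
        using le[OF True] by (intro mult_left_mono emeasure_mono) auto
      also have "\<dots> = ennreal (u powr (q - 2)) * ennreal u * emeasure lborel {x. ennreal u < maximal (\<lambda>y. ennreal (f y)) x}"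
        unfolding e ..
      also have "\<dots>
        \<le> ennreal (u powr (q - 2)) * (2 * 5 ^ DIM('a) * (\<integral>\<^sup>+y. ennreal (f y) * indicator {y. ennreal (u / 2) < ennreal (f y)} y \<partial>lborel))"
        unfolding mult.assoc using weak_type_maximal_truncated[of "\<lambda>y. ennreal (f y)" u] True
        by (intro mult_left_mono) (auto simp: mult.assoc)
      also have "\<dots> = (\<integral>\<^sup>+y. (ennreal (u powr (q - 2)) * (2 * 5 ^ DIM('a))) * (ennreal (f y) * indicator {y. ennreal (u / 2) < ennreal (f y)} y) \<partial>lborel)"
        by (subst nn_integral_cmult) (auto simp: mult.assoc)
      also have "\<dots> = (\<integral>\<^sup>+y. ennreal ?c * ennreal (f y) * (ennreal (u powr (q - 2)) * indicator {0<..<2 * f y} u) \<partial>lborel)"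
      proof (intro nn_integral_cong)
        fix y
        have "ennreal ?c = 2 * 5 ^ DIM('a)" by (simp add: ennreal_mult' flip: ennreal_power)
        then show "(ennreal (u powr (q - 2)) * (2 * 5 ^ DIM('a))) * (ennreal (f y) * indicator {y. ennreal (u / 2) < ennreal (f y)} y)
          = ennreal ?c * ennreal (f y) * (ennreal (u powr (q - 2)) * indicator {0<..<2 * f y} u)"
          using True by (auto simp: indicator_def ennreal_less_iff mult_ac)
      qed
      finally show ?thesis .
    qed (simp add: indicator_def)
  qed
  also have "\<dots> = (\<integral>\<^sup>+y. (\<integral>\<^sup>+u. ennreal ?c * ennreal (f y) * (ennreal (u powr (q - 2)) * indicator {0<..<2 * f y} u) \<partial>lborel) \<partial>lborel)"
    by (intro lborel_pair.Fubini') (simp add: indicator_def)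
  also have "\<dots> = (\<integral>\<^sup>+y. ennreal (?c * 2 powr (q - 1) / (q - 1)) * ennreal (f y powr q) \<partial>lborel)"
  proof (intro nn_integral_cong)
    fix y
    have "(\<integral>\<^sup>+u. ennreal ?c * ennreal (f y) * (ennreal (u powr (q - 2)) * indicator {0<..<2 * f y} u) \<partial>lborel)
      = ennreal ?c * ennreal (f y) * ennreal ((2 * f y) powr (q - 2 + 1) / (q - 2 + 1))"
      using q f0[of y] by (subst nn_integral_cmult, simp, subst nn_integral_powr_from_0) auto
    also have "\<dots> = ennreal (?c * f y * ((2 * f y) powr (q - 1) / (q - 1)))"
      using q f0[of y]
      by (simp only: ennreal_mult'[symmetric] ennreal_mult[symmetric] mult_nonneg_nonneg zero_le_power zero_le_numeral)
        (simp add: diff_add_eq)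
    also have "?c * f y * ((2 * f y) powr (q - 1) / (q - 1)) = ?c * 2 powr (q - 1) / (q - 1) * f y powr q"
    proof -
      have "f y * f y powr (q - 1) = f y powr q"
        using f0[of y] q by (cases "f y = 0") (auto simp: powr_mult_base)
      moreover have "(2 * f y) powr (q - 1) = 2 powr (q - 1) * f y powr (q - 1)"
        using f0[of y] by (simp add: powr_mult)
      ultimately show ?thesis by (simp add: field_simps)
    qed
    also have "ennreal (?c * 2 powr (q - 1) / (q - 1) * f y powr q) = ennreal (?c * 2 powr (q - 1) / (q - 1)) * ennreal (f y powr q)"
      by (rule ennreal_mult') (use q in simp)
    finally show "(\<integral>\<^sup>+u. ennreal ?c * ennreal (f y) * (ennreal (u powr (q - 2)) * indicator {0<..<2 * f y} u) \<partial>lborel)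
      = ennreal (?c * 2 powr (q - 1) / (q - 1)) * ennreal (f y powr q)" .
  qed
  also have "\<dots> = ennreal (?c * 2 powr (q - 1) / (q - 1)) * (\<integral>\<^sup>+y. ennreal (f y powr q) \<partial>lborel)"
    by (intro nn_integral_cmult) simp
  finally have *: "(\<integral>\<^sup>+x. ennreal (M x powr q) \<partial>lborel)
      \<le> ennreal q * (ennreal (?c * 2 powr (q - 1) / (q - 1)) * (\<integral>\<^sup>+y. ennreal (f y powr q) \<partial>lborel))"
    by (simp add: mult_left_mono)
  have "ennreal q * ennreal (?c * 2 powr (q - 1) / (q - 1)) = ennreal (q * (?c * 2 powr (q - 1) / (q - 1)))"
    using q by (intro ennreal_mult'[symmetric]) auto
  also have "q * (?c * 2 powr (q - 1) / (q - 1)) = 2 * 5 ^ DIM('a) * q * 2 powr (q - 1) / (q - 1)"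
    by (simp add: field_simps)
  finally show ?thesis
    using * unfolding M_def mult.assoc[symmetric] by simp
qed

text \<open>For t \<ge> 2 the values of f above t/2 exceed 1 and hence are at most f^q. The
  truncated weak type bound then makes the measure of the set where the maximal function is infinite
  O(1/t) for all such t.\<close>

lemma AE_maximal_finite:
  fixes f :: "'a::euclidean_space \<Rightarrow> real"
  assumes [measurable]: "f \<in> borel_measurable borel" and q: "1 < q"
    and fin: "(\<integral>\<^sup>+x. ennreal (f x powr q) \<partial>lborel) < \<top>"
  shows "AE x in lborel. maximal (\<lambda>y. ennreal (f y)) x < \<top>"
proof -
  obtain I where I: "(\<integral>\<^sup>+x. ennreal (f x powr q) \<partial>lborel) = ennreal I" "0 \<le> I"
    using fin by (cases "\<integral>\<^sup>+x. ennreal (f x powr q) \<partial>lborel") auto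
  let ?S = "{x. maximal (\<lambda>y. ennreal (f y)) x = \<top>}"
  have [measurable]: "?S \<in> sets borel" by measurable
  have "emeasure lborel ?S \<le> ennreal (2 * 5 ^ DIM('a) * I / t)" if "2 \<le> t" for t
  proof -
    have "ennreal t * emeasure lborel ?S \<le> ennreal t * emeasure lborel {x. ennreal t < maximal (\<lambda>y. ennreal (f y)) x}"
      by (intro mult_left_mono emeasure_mono) auto
    also have "\<dots> \<le> 2 * 5 ^ DIM('a) * (\<integral>\<^sup>+y. ennreal (f y) * indicator {y. ennreal (t / 2) < ennreal (f y)} y \<partial>lborel)"
      using that by (intro weak_type_maximal_truncated) auto
    also have "\<dots> \<le> 2 * 5 ^ DIM('a) * (\<integral>\<^sup>+y. ennreal (f y powr q) \<partial>lborel)"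
    proof (intro mult_left_mono nn_integral_mono)
      fix y
      show "ennreal (f y) * indicator {y. ennreal (t / 2) < ennreal (f y)} y \<le> ennreal (f y powr q)"
      proof (cases "ennreal (t / 2) < ennreal (f y)")
        case True
        then have "1 \<le> f y" using that by (auto simp: ennreal_less_iff)
        then have "f y powr 1 \<le> f y powr q" using q by (intro powr_mono) auto
        with \<open>1 \<le> f y\<close> show ?thesis by (auto simp: indicator_def intro!: ennreal_leI)
      qed auto
    qed auto
    also have "\<dots> = ennreal (2 * 5 ^ DIM('a) * I)"
      using I by (simp add: ennreal_mult' flip: ennreal_power)
    finally have "ennreal t * emeasure lborel ?S \<le> ennreal (2 * 5 ^ DIM('a) * I)" .
    then show ?thesis
      using that I by (cases "emeasure lborel ?S")
        (auto simp: ennreal_mult'[symmetric] field_simps ennreal_mult_top top_unique)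
  qed
  then have *: "emeasure lborel ?S \<le> ennreal (2 * 5 ^ DIM('a) * I / real n)" if "2 \<le> n" for n :: nat
    using that by auto
  have "(\<lambda>n. ennreal (2 * 5 ^ DIM('a) * I / real n)) \<longlonglongrightarrow> ennreal 0"
    by (intro tendsto_ennrealI) real_asymp
  then have "emeasure lborel ?S \<le> ennreal 0"
    by (rule tendsto_lowerbound) (auto intro!: eventually_sequentiallyI[of 2] *)
  then have "emeasure lborel ?S = 0" by simp
  then show ?thesis
    by (intro AE_I[where N="?S"]) (auto simp: not_less top_unique)
qed

section \<open>Decaying kernels against the maximal function\<close>

text \<open>Decay of order n+1 beats the growth of volume: on the i-th dyadic shell about x the
  kernel is O(2^(jn) 2^(-i(n+1))) against a volume O(2^((i-j)n)), leaving 2^(-i) to be summed. The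
  bound is independent of j.\<close>

lemma nn_integral_decay_le_maximal:
  fixes g :: "'a::euclidean_space \<Rightarrow> ennreal" and j :: int
  assumes [measurable]: "g \<in> borel_measurable borel"
  shows "(\<integral>\<^sup>+y. ennreal ((2 powi j) ^ DIM('a) / (1 + 2 powi j * norm (y - x)) ^ (DIM('a) + 1)) * g y \<partial>lborel)
    \<le> ennreal (2 ^ (2 * DIM('a) + 1) * unit_ball_vol (DIM('a)) * 2) * maximal g x"
proof -
  define n where "n = DIM('a)"
  define V where "V = unit_ball_vol (real n)"
  have V: "V > 0" unfolding V_def by simp
  define B where "B i = ball x (2 powi (int i + 1 - j))" for i :: nat
  have [measurable]: "B i \<in> sets borel" for i unfolding B_def by auto
  define c :: "nat \<Rightarrow> real" where "c i = 2 ^ (n + 1) * (2 powi j) ^ n / (2 ^ i) ^ (n + 1)" for i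
  have c0: "c i \<ge> 0" for i unfolding c_def by simp
  have pt: "ennreal ((2 powi j) ^ n / (1 + 2 powi j * norm (y - x)) ^ (n + 1))
      \<le> (\<Sum>i. ennreal (c i) * indicator (B i) y)" for y
  proof -
    define z where "z = 2 powi j * norm (y - x)"
    have z0: "z \<ge> 0" unfolding z_def by simp
    have "\<exists>i::nat. z < 2 ^ i"
      using real_arch_pow[of 2 z] by auto
    \<comment> \<open>Minimality gives 2^i \<le> z unless i = 0, so 2^i \<le> 1 + z in both cases,
      while y lies in the ball of radius 2^(i+1-j).\<close>
    define i where "i = (LEAST i::nat. z < 2 * 2 ^ i)"
    have ex: "\<exists>i::nat. z < 2 * 2 ^ i"
    proof -
      obtain i where "z < 2 ^ i" using \<open>\<exists>i. z < 2 ^ i\<close> by blast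
      moreover have "(2::real) ^ i \<le> 2 * 2 ^ i" by simp
      ultimately show ?thesis by (intro exI[of _ i]) linarith
    qed
    have zi: "z < 2 * 2 ^ i" unfolding i_def using ex by (rule LeastI_ex)
    have lo: "2 ^ i \<le> 1 + z"
    proof (cases i)
      case (Suc m)
      have "\<not> z < 2 * 2 ^ m" using not_less_Least[of m "\<lambda>i. z < 2 * 2 ^ i"] Suc unfolding i_def by auto
      then show ?thesis using Suc by simp
    qed (use z0 in simp)
    have "y \<in> B i"
    proof -
      have "2 powi j * norm (y - x) < 2 powi j * 2 powi (int i + 1 - j)"
        using zi unfolding z_def by (simp add: power_int_add power_int_diff field_simps)
      then show ?thesis unfolding B_def by (simp add: dist_norm norm_minus_commute)
    qed
    have "((2::real) powi j) ^ n / (1 + z) ^ (n + 1) \<le> (2 powi j) ^ n / (2 ^ i) ^ (n + 1)"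
      using lo z0 by (intro divide_left_mono power_mono mult_pos_pos zero_less_power) auto
    also have "((2::real) powi j) ^ n / (2 ^ i) ^ (n + 1) \<le> c i"
    proof -
      have "(2 powi j) ^ n / (2 ^ i) ^ (n + 1) * 1 \<le> (2 powi j) ^ n / (2 ^ i) ^ (n + 1) * (2::real) ^ (n + 1)"
        by (intro mult_left_mono one_le_power) auto
      then show ?thesis unfolding c_def by (simp add: mult.commute)
    qed
    finally have "ennreal ((2 powi j) ^ n / (1 + z) ^ (n + 1)) \<le> ennreal (c i)" by (rule ennreal_leI)
    also have "\<dots> = ennreal (c i) * indicator (B i) y" using \<open>y \<in> B i\<close> by simp
    also have "\<dots> = sum (\<lambda>i. ennreal (c i) * indicator (B i) y) {i}" by (subst sum.insert) auto
    also have "\<dots> \<le> (\<Sum>i. ennreal (c i) * indicator (B i) y)" by (rule sum_le_suminf) auto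
    finally show ?thesis unfolding z_def .
  qed
  have term_le: "ennreal (c i) * (\<integral>\<^sup>+y. indicator (B i) y * g y \<partial>lborel) \<le> ennreal (2 ^ (2 * n + 1) * V * (1/2) ^ i) * maximal g x" for i
  proof -
    have "(\<integral>\<^sup>+y. indicator (B i) y * g y \<partial>lborel) = ball_mean g (int i + 1 - j) x * emeasure lborel (B i)"
      unfolding B_def ball_mean_mult by (simp add: mult.commute)
    also have "emeasure lborel (B i) = ennreal (V * (2 powi (int i + 1 - j)) ^ n)"
      unfolding B_def V_def n_def by (simp add: emeasure_ball)
    finally have "ennreal (c i) * (\<integral>\<^sup>+y. indicator (B i) y * g y \<partial>lborel)
        = ennreal (c i * (V * (2 powi (int i + 1 - j)) ^ n)) * ball_mean g (int i + 1 - j) x"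
      using c0[of i] V by (simp add: ennreal_mult mult_ac)
    also have "c i * (V * (2 powi (int i + 1 - j)) ^ n) = 2 ^ (2 * n + 1) * V * (1/2) ^ i"
    proof -
      have "(2::real) powi (int i + 1 - j) = 2 ^ i * 2 / 2 powi j"
        by (simp add: power_int_add power_int_diff)
      then have e: "((2::real) powi (int i + 1 - j)) ^ n = (2 ^ i) ^ n * 2 ^ n / (2 powi j) ^ n"
        by (simp only: power_divide power_mult_distrib)
      have cancel: "A2 * a / (p * s) * (V * (p * A / a)) = A2 * A * V * (1 / s)"
        if "a \<noteq> 0" "p \<noteq> 0" "s \<noteq> 0" for a p s A A2 :: real
        using that by (simp add: field_simps)
      have "c i * (V * (2 powi (int i + 1 - j)) ^ n) = 2 ^ (n + 1) * 2 ^ n * V * (1 / 2 ^ i)"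
        using cancel[of "(2 powi j) ^ n" "(2 ^ i) ^ n" "2 ^ i" "2 ^ (n + 1)" "2 ^ n"]
        unfolding c_def e by simp
      also have "\<dots> = 2 ^ (2 * n + 1) * V * (1 / 2) ^ i"
        by (simp only: power_one_over mult_2 power_add power_one_right) (simp only: mult_ac)
      finally show ?thesis .
    qed
    finally show ?thesis by (simp add: mult_left_mono ball_mean_le_maximal)
  qed
  have "(\<integral>\<^sup>+y. ennreal ((2 powi j) ^ n / (1 + 2 powi j * norm (y - x)) ^ (n + 1)) * g y \<partial>lborel)
    \<le> (\<integral>\<^sup>+y. (\<Sum>i. ennreal (c i) * indicator (B i) y * g y) \<partial>lborel)"
    unfolding ennreal_suminf_multc by (intro nn_integral_mono mult_right_mono pt) simp
  also have "\<dots> = (\<Sum>i. \<integral>\<^sup>+y. ennreal (c i) * indicator (B i) y * g y \<partial>lborel)"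
    by (intro nn_integral_suminf) measurable
  also have "\<dots> = (\<Sum>i. ennreal (c i) * (\<integral>\<^sup>+y. indicator (B i) y * g y \<partial>lborel))"
    by (intro suminf_cong) (simp add: mult.assoc nn_integral_cmult)
  also have "\<dots> \<le> (\<Sum>i. ennreal (2 ^ (2 * n + 1) * V * (1/2) ^ i) * maximal g x)"
    by (intro suminf_le term_le) auto
  also have "\<dots> = (\<Sum>i. ennreal (2 ^ (2 * n + 1) * V * (1/2) ^ i)) * maximal g x" by simp
  also have "(\<Sum>i. ennreal (2 ^ (2 * n + 1) * V * (1/2) ^ i)) = ennreal (2 ^ (2 * n + 1) * V * 2)"
  proof (rule suminf_ennreal_eq)
    show "(\<lambda>i. 2 ^ (2 * n + 1) * V * (1 / 2) ^ i) sums (2 ^ (2 * n + 1) * V * 2)"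
      using geometric_sums[of "1/2::real"] by (intro sums_mult) auto
  qed (use V in auto)
  finally show ?thesis unfolding n_def V_def .
qed

text \<open>The preceding bound at g = 1 and j = 0: the maximal function of 1 is 1.\<close>

lemma nn_integral_decay_finite:
  "(\<integral>\<^sup>+y. ennreal (1 / (1 + norm (y::'a::euclidean_space)) ^ (DIM('a) + 1)) \<partial>lborel) < \<top>"
proof -
  have "(\<integral>\<^sup>+y. ennreal (1 / (1 + norm (y::'a)) ^ (DIM('a) + 1)) \<partial>lborel)
      \<le> ennreal (2 ^ (2 * DIM('a) + 1) * unit_ball_vol (DIM('a)) * 2) * maximal (\<lambda>_. 1) (0::'a)"
    using nn_integral_decay_le_maximal[of "\<lambda>_::'a. 1" 0 0] by simp
  also have "maximal (\<lambda>_. 1) (0::'a) = 1"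
    unfolding maximal_def ball_mean_const by simp
  finally show ?thesis by (simp add: order_le_less_trans less_top)
qed

lemma integrable_decay: "integrable lborel (\<lambda>y::'a::euclidean_space. 1 / (1 + norm y) ^ (DIM('a) + 1))"
  by (rule integrableI_bounded) (use nn_integral_decay_finite in \<open>auto simp: abs_of_nonneg\<close>)

text \<open>A pointwise substitute for Jensen's inequality with variable exponents: averaging over \<open>y\<close> with
  \<open>a = f y\<close> and with \<open>K\<close> the mean of \<open>f y powr r y + h y\<close> bounds the mean of \<open>f\<close> by a multiple of \<open>A\<close>.\<close>

lemma powr_le_powr_decomposition:
  fixes a A K rx ry hx hy c :: real
  assumes "0 \<le> a" "0 < K" "1 \<le> rx" "1 \<le> ry" "A = K powr (1 / rx)" "1 \<le> c"
    and big: "1 \<le> K \<Longrightarrow> K powr \<bar>rx - ry\<bar> \<le> c"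
    and small: "(0 < hy \<and> hy powr (- \<bar>rx - ry\<bar>) \<le> c) \<or> (0 < hx \<and> hx \<le> K \<and> hx powr (- \<bar>rx - ry\<bar>) \<le> c)"
    and "0 \<le> hy"
  shows "a \<le> A + c * (a powr ry + hy) * A powr (1 - rx)"
proof (cases "a \<le> A")
  case True
  then show ?thesis using assms by (auto intro!: add_increasing2 mult_nonneg_nonneg)
next
  case False
  have A: "0 < A" using assms by simp
  with False have a: "0 < a" by simp
  have "a \<le> c * (a powr ry + hy) * A powr (1 - rx)"
  proof (cases "1 \<le> a")
    case a1: True
    show ?thesis
    proof (cases "A \<le> 1")
      case True
      \<comment> \<open>Here a \<ge> 1 allows raising to the power ry, and A^(1-rx) \<ge> 1 because
        A \<le> 1.\<close>
      have "a powr 1 \<le> a powr ry" using a1 assms by (intro powr_mono) auto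
      then have "a * 1 \<le> (a powr ry + hy) * A powr (1 - rx)"
        using a True A assms ge_one_powr_ge_zero[of "1/A" "rx - 1"]
        by (intro mult_mono) (auto simp: powr_divide powr_diff field_simps)
      also have "\<dots> \<le> c * ((a powr ry + hy) * A powr (1 - rx))"
        using mult_right_mono[OF \<open>1 \<le> c\<close>, of "(a powr ry + hy) * A powr (1 - rx)"] assms by simp
      finally show ?thesis by (simp add: mult.assoc)
    next
      case False
      have K1: "1 \<le> K"
      proof (rule ccontr)
        assume "\<not> 1 \<le> K"
        then have "K powr (1 / rx) \<le> 1 powr (1/rx)" using assms by (intro powr_mono2) auto
        with False assms show False by simp
      qed
      have "A \<le> K powr 1" unfolding \<open>A = _\<close> using K1 assms by (intro powr_mono) auto
      \<comment> \<open>Since a > A, the nonpositive power a^(1-ry) is at most A^(1-ry). Passing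
        from ry to rx costs A^|rx-ry| \<le> K^|rx-ry|, which \<open>big\<close> controls.\<close>
      have "a = a powr ry * a powr (1 - ry)" using a by (simp flip: powr_add)
      also have "\<dots> \<le> a powr ry * A powr (1 - ry)"
        using \<open>\<not> a \<le> A\<close> A assms by (intro mult_left_mono powr_mono2') auto
      also have "\<dots> = a powr ry * (A powr (rx - ry) * A powr (1 - rx))" using A by (simp flip: powr_add)
      also have "\<dots> \<le> a powr ry * (c * A powr (1 - rx))"
      proof (intro mult_left_mono mult_right_mono)
        have "A powr (rx - ry) \<le> A powr \<bar>rx - ry\<bar>" using False by (intro powr_mono) auto
        also have "\<dots> \<le> K powr \<bar>rx - ry\<bar>"
          using \<open>A \<le> K powr 1\<close> A K1 by (intro powr_mono2) auto
        also have "\<dots> \<le> c" by (rule big[OF K1])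
        finally show "A powr (rx - ry) \<le> c" .
      qed auto
      also have "\<dots> = c * a powr ry * A powr (1 - rx)" by (simp add: mult_ac)
      also have "\<dots> \<le> c * (a powr ry + hy) * A powr (1 - rx)"
        using assms by (intro mult_right_mono mult_left_mono) auto
      finally show ?thesis .
    qed
  next
    case a1: False
    \<comment> \<open>For a < 1 the exponents can be exchanged as soon as a is bounded below by some
      h whose power of order -|rx-ry| is at most c; h will be \<open>hy\<close> or
      \<open>hx\<close>.\<close>
    have main: "a powr rx \<le> c * a powr ry" if "0 < h" "h \<le> a" "h powr (- \<bar>rx - ry\<bar>) \<le> c" for h
    proof -
      have "a powr (rx - ry) \<le> a powr (- \<bar>rx - ry\<bar>)" using a a1 by (intro powr_mono') auto
      also have "\<dots> \<le> h powr (- \<bar>rx - ry\<bar>)" using that by (intro powr_mono2') auto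
      also have "\<dots> \<le> c" by fact
      finally have "a powr (rx - ry) * a powr ry \<le> c * a powr ry" by (intro mult_right_mono) auto
      then show ?thesis using a by (simp flip: powr_add)
    qed
    have "a powr rx \<le> c * (a powr ry + hy)"
      using small
    proof (elim disjE conjE)
      assume h: "0 < hy" "hy powr (- \<bar>rx - ry\<bar>) \<le> c"
      show ?thesis
      \<comment> \<open>Either a^rx is absorbed by the summand \<open>hy\<close>, or a itself is at
        least \<open>hy\<close>.\<close>
      proof (cases "a powr rx \<le> hy")
        case True
        also have "hy \<le> c * hy" using assms by (simp add: mult_le_cancel_right1)
        also have "\<dots> \<le> c * (a powr ry + hy)" using assms by (intro mult_left_mono) auto
        finally show ?thesis .
      next
        case False
        have "a powr rx \<le> a powr 1" using a a1 assms by (intro powr_mono') auto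
        with False a have "hy \<le> a" by simp
        from main[OF h(1) this h(2)] show ?thesis
          using assms by (auto simp: distrib_left intro: order_trans)
      qed
    next
      assume h: "0 < hx" "hx \<le> K" "hx powr (- \<bar>rx - ry\<bar>) \<le> c"
      \<comment> \<open>Otherwise A \<ge> 1 > a, against a > A. With K \<le> 1 the root A is at
        least K, so a \<ge> \<open>hx\<close>.\<close>
      have "K \<le> 1"
      proof (rule ccontr)
        assume "\<not> K \<le> 1"
        then have "1 \<le> A" using assms by (auto intro: ge_one_powr_ge_zero)
        with \<open>\<not> a \<le> A\<close> a1 show False by auto
      qed
      have "K powr 1 \<le> K powr (1 / rx)" using \<open>K \<le> 1\<close> assms by (intro powr_mono') auto
      then have "hx \<le> a" using h \<open>\<not> a \<le> A\<close> assms by auto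
      from main[OF h(1) this h(3)] show ?thesis
        using assms by (auto simp: distrib_left intro: order_trans)
    qed
    moreover have "a = a powr rx * a powr (1 - rx)" using a by (simp flip: powr_add)
    moreover have "a powr (1 - rx) \<le> A powr (1 - rx)"
      using \<open>\<not> a \<le> A\<close> A assms by (intro powr_mono2') auto
    moreover have "a powr rx * a powr (1 - rx) \<le> c * (a powr ry + hy) * A powr (1 - rx)"
      using calculation(1,3) assms by (intro mult_mono) auto
    ultimately show ?thesis by linarith
  qed
  then show ?thesis using A by simp
qed

section \<open>Variable exponents\<close>

lemma powr_add_le:
  fixes a b q :: real
  assumes "0 \<le> a" "0 \<le> b" "0 \<le> q"
  shows "(a + b) powr q \<le> 2 powr q * (a powr q + b powr q)"
proof -
  have "(a + b) powr q \<le> (2 * max a b) powr q" using assms by (intro powr_mono2) auto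
  also have "\<dots> = 2 powr q * max a b powr q" using assms by (simp add: powr_mult)
  also have "\<dots> \<le> 2 powr q * (a powr q + b powr q)" by (intro mult_left_mono) (auto simp: max_def)
  finally show ?thesis .
qed

text \<open>This comparison stands in for the inequalities of Hoelder and Young wherever a modular,
  rather than a norm, is at hand.\<close>

lemma powr_le_powr_add_1:
  fixes a s t :: real
  assumes "0 \<le> a" "0 \<le> s" "s \<le> t"
  shows "a powr s \<le> a powr t + 1"
proof (cases "a \<le> 1")
  case True
  then have "a powr s \<le> 1 powr s" using assms by (intro powr_mono2) auto
  then show ?thesis by (simp add: add_increasing)
next
  case False
  then have "a powr s \<le> a powr t" using assms by (intro powr_mono) auto
  then show ?thesis by simp
qed

text \<open>K grows at most like a power of 1/\<rho>, so ln K is at most a constant times ln (e +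
  1/\<rho>), which is exactly what the log-Hoelder bound on d divides out.\<close>

lemma log_hoelder_powr_bound:
  fixes K L V \<rho> d :: real
  assumes "1 \<le> K" "K \<le> 3 + 1 / (V * \<rho> ^ n)" "0 < V" "0 < \<rho>" "0 \<le> L" "0 \<le> d" "d \<le> L / ln (exp 1 + 1 / \<rho>)"
  shows "K powr d \<le> exp (L * (ln (3 + 1 / V) + n))"
proof -
  define l where "l = ln (exp 1 + 1 / \<rho>)"
  have e1: "(1::real) \<le> exp 1 + 1 / \<rho>" using assms by (simp add: add_increasing2)
  have "ln (exp 1) \<le> ln (exp 1 + 1 / \<rho>)"
    using assms by (subst ln_le_cancel_iff) (auto intro!: add_pos_pos)
  then have l: "1 \<le> l" unfolding l_def by simp
  have "3 * 1 \<le> 3 * (exp 1 + 1 / \<rho>) ^ n" using e1 by (intro mult_left_mono one_le_power) auto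
  moreover have "1 / V * (1 / \<rho>) ^ n \<le> 1 / V * (exp 1 + 1 / \<rho>) ^ n"
    using assms by (intro mult_left_mono power_mono) auto
  ultimately have "3 + 1 / (V * \<rho> ^ n) \<le> (3 + 1 / V) * (exp 1 + 1 / \<rho>) ^ n"
    by (simp add: power_one_over power_divide distrib_right)
  then have "ln K \<le> ln ((3 + 1 / V) * (exp 1 + 1 / \<rho>) ^ n)"
    using assms e1 by (subst ln_le_cancel_iff) (auto intro!: mult_pos_pos add_pos_pos zero_less_power)
  also have "\<dots> = ln (3 + 1 / V) + n * l"
    using assms e1 unfolding l_def by (subst ln_mult_pos) (auto intro!: add_pos_pos zero_less_power simp: ln_realpow)
  also have "\<dots> \<le> ln (3 + 1 / V) * l + n * l"
  proof -
    have "0 \<le> ln (3 + 1 / V)" using assms by (intro ln_ge_zero) (auto simp: add_increasing2)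
    then show ?thesis using l by (simp add: mult_le_cancel_left1)
  qed
  finally have "ln K \<le> (ln (3 + 1 / V) + n) * l" by (simp add: distrib_right)
  moreover have "d * l \<le> L" using assms l unfolding l_def by (simp add: field_simps)
  moreover have "0 \<le> ln (3 + 1 / V)" using assms by (intro ln_ge_zero) (auto simp: add_increasing2)
  ultimately have "d * ln K \<le> L * (ln (3 + 1 / V) + n)"
    using assms by (smt (verit) mult_left_mono mult_right_mono mult.assoc mult.commute of_nat_0_le_iff)
  then show ?thesis using assms by (simp add: powr_def)
qed

lemma ennreal_mult_add:
  "0 \<le> a \<Longrightarrow> 0 \<le> b \<Longrightarrow> 0 \<le> c \<Longrightarrow> ennreal c * (ennreal a + ennreal b) = ennreal (c * (a + b))"
  by (simp add: ennreal_mult)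

text \<open>With r = P / q, a pointwise bound of (M f)^r by M (f^r + h) + h, up to constants,
  reduces the claim to the constant exponent q: (f^r)^q = f^P, and M is bounded on L^q. The local
  log-Hoelder condition handles large means, the condition at infinity handles small values, with h
  as admissible error.\<close>

theorem maximal_variable_exponent:
  fixes P :: "'a::euclidean_space \<Rightarrow> real" and q b L Pinf :: real
  assumes [measurable]: "P \<in> borel_measurable borel"
    and q: "1 < q" and P: "\<And>x. q \<le> P x" "\<And>x. P x \<le> b" and L: "0 \<le> L"
    and loc: "\<And>x y. \<bar>P x - P y\<bar> \<le> L / ln (exp 1 + 1 / norm (x - y))"
    and infty: "\<And>x. \<bar>P x - Pinf\<bar> \<le> L / ln (exp 1 + norm x)"
  shows "\<exists>C>0. \<forall>f. f \<in> borel_measurable borel \<longrightarrow> (\<forall>x. 0 \<le> f x) \<longrightarrow>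
    (\<integral>\<^sup>+x. ennreal (f x powr P x) \<partial>lborel) \<le> 1 \<longrightarrow>
    (AE x in lborel. maximal (\<lambda>y. ennreal (f y)) x < \<top>) \<and>
    (\<integral>\<^sup>+x. ennreal (enn2real (maximal (\<lambda>y. ennreal (f y)) x) powr P x) \<partial>lborel) \<le> ennreal C"
proof -
  define n where "n = DIM('a)"
  define V where "V = unit_ball_vol (real n)"
  have V: "V > 0" unfolding V_def by simp
  define r where "r x = P x / q" for x
  have r1: "1 \<le> r x" and rP: "r x \<le> P x" and r0: "0 < r x" for x
    using P(1)[of x] q unfolding r_def by (auto simp: field_simps intro: order_trans[OF _ mult_left_mono[of 1 q "P x"]])
  have rd: "\<bar>r x - r y\<bar> \<le> \<bar>P x - P y\<bar>" for x y
  proof -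
    have "\<bar>r x - r y\<bar> = \<bar>P x - P y\<bar> / q" using q unfolding r_def by (simp flip: diff_divide_distrib)
    also have "\<dots> \<le> \<bar>P x - P y\<bar> / 1" using q by (intro divide_left_mono) auto
    finally show ?thesis by simp
  qed
  \<comment> \<open>Integrable and at most 1, yet only polynomially small: ln (1/h) = (n+1) ln (e +
    |x|), so the condition at infinity bounds the powers of h of order -|r x - r y|.\<close>
  define h :: "'a \<Rightarrow> real" where "h x = 1 / (exp 1 + norm x) ^ (n + 1)" for x
  have e1: "(1::real) \<le> exp 1" by simp
  have epos: "0 < exp 1 + norm x" "1 \<le> exp 1 + norm x" for x :: 'a
    using e1 norm_ge_zero[of x] by (auto intro: add_pos_nonneg simp: add_increasing2)
  have h0: "0 < h x" and h1: "h x \<le> 1" for x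
    unfolding h_def using epos[of x] one_le_power[of "exp 1 + norm x" "n + 1"]
    by (auto intro!: divide_pos_pos zero_less_power simp: divide_le_eq_1 simp del: power_Suc)
  have [measurable]: "h \<in> borel_measurable borel" unfolding h_def by measurable
  have hq: "h x powr q \<le> h x" for x
    using powr_mono'[of 1 q "h x"] q h0[of x] h1[of x] by auto
  have "(\<integral>\<^sup>+x. ennreal (h x) \<partial>lborel) \<le> (\<integral>\<^sup>+x. ennreal (1 / (1 + norm (x::'a)) ^ (n + 1)) \<partial>lborel)"
    unfolding h_def by (intro nn_integral_mono ennreal_leI divide_left_mono power_mono add_right_mono e1)
      (auto intro!: mult_pos_pos zero_less_power add_pos_nonneg)
  also have "\<dots> < \<top>" unfolding n_def by (rule nn_integral_decay_finite)
  finally obtain H where H: "(\<integral>\<^sup>+x. ennreal (h x) \<partial>lborel) = ennreal H" "0 \<le> H"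
    by (cases "\<integral>\<^sup>+x. ennreal (h x) \<partial>lborel") auto
  \<comment> \<open>The first entry is the bound of \<open>log_hoelder_powr_bound\<close>, the
    second that for powers of h, where 2 L accounts for the distances of both P x and P y from
    \<open>Pinf\<close>.\<close>
  define c where "c = max (exp (L * (ln (3 + 1 / V) + n))) (exp (2 * L * (n + 1)))"
  have c: "1 \<le> c" unfolding c_def using L by (intro max.coboundedI2) simp
  \<comment> \<open>Applied with z the one of x and y of smaller norm: both distances to
    \<open>Pinf\<close> are then at most L / ln (e + |z|).\<close>
  have hpow: "h z powr (- \<bar>r x - r y\<bar>) \<le> c"
    if z: "norm z \<le> norm x" "norm z \<le> norm y" for x y z
  proof -
    define l where "l = ln (exp 1 + norm z)"
    have "ln (exp 1) \<le> l" unfolding l_def using epos[of z] by (subst ln_le_cancel_iff) auto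
    then have l: "1 \<le> l" by simp
    have lz: "L / ln (exp 1 + norm w) \<le> L / l" if "norm z \<le> norm w" for w :: 'a
    proof -
      have "l \<le> ln (exp 1 + norm w)" unfolding l_def using epos[of z] epos[of w] that by (subst ln_le_cancel_iff) auto
      then show ?thesis using l L by (intro divide_left_mono mult_pos_pos) auto
    qed
    have "\<bar>r x - r y\<bar> \<le> 2 * (L / l)"
      using rd[of x y] infty[of x] infty[of y] lz[OF z(1)] lz[OF z(2)] by linarith
    then have "\<bar>r x - r y\<bar> * l \<le> 2 * L" using l by (simp add: field_simps)
    then have "\<bar>r x - r y\<bar> * l * (n + 1) \<le> 2 * L * (n + 1)" by (intro mult_right_mono) auto
    moreover have "h z powr (- \<bar>r x - r y\<bar>) = exp (\<bar>r x - r y\<bar> * l * (n + 1))"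
    proof -
      have "ln (h z) = - ((n + 1) * l)"
        unfolding h_def l_def using epos[of z] by (simp add: ln_div ln_realpow del: power_Suc)
      then show ?thesis using h0[of z] by (simp add: powr_def mult_ac)
    qed
    ultimately show ?thesis unfolding c_def by (simp add: max.coboundedI2)
  qed
  define Cq where "Cq = 2 * 5 ^ DIM('a) * q * 2 powr (q - 1) / (q - 1)"
  have Cq: "0 \<le> Cq" unfolding Cq_def using q by simp
  define C where "C = (1 + c) powr b * (2 powr q * (Cq * (2 powr q * (1 + H)) + H)) + 1"
  have Cpos: "0 < C" unfolding C_def using c Cq H by (intro add_nonneg_pos mult_nonneg_nonneg) auto
  show ?thesis
  proof (intro exI[of _ C] conjI allI impI)
    show "0 < C" by (rule Cpos)
    fix f :: "'a \<Rightarrow> real"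
    assume [measurable]: "f \<in> borel_measurable borel" and "\<forall>x. 0 \<le> f x"
      and f1: "(\<integral>\<^sup>+x. ennreal (f x powr P x) \<partial>lborel) \<le> 1"
    then have f0: "0 \<le> f x" for x by blast
    define G where "G y = f y powr r y + h y" for y
    have [measurable]: "r \<in> borel_measurable borel" unfolding r_def by measurable
    have [measurable]: "G \<in> borel_measurable borel" unfolding G_def by measurable
    have G0: "0 < G y" for y unfolding G_def using h0[of y] by (simp add: add_nonneg_pos)
    have "(\<integral>\<^sup>+x. ennreal (G x powr q) \<partial>lborel) \<le> (\<integral>\<^sup>+x. ennreal (2 powr q) * (ennreal (f x powr P x) + ennreal (h x)) \<partial>lborel)"
    proof (intro nn_integral_mono)
      fix x
      have "G x powr q \<le> 2 powr q * ((f x powr r x) powr q + h x powr q)"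
        unfolding G_def using q h0[of x] by (intro powr_add_le) auto
      also have "(f x powr r x) powr q = f x powr P x" unfolding powr_powr r_def using q by simp
      also have "2 powr q * (f x powr P x + h x powr q) \<le> 2 powr q * (f x powr P x + h x)"
        using hq[of x] by (intro mult_left_mono add_left_mono) auto
      finally show "ennreal (G x powr q) \<le> ennreal (2 powr q) * (ennreal (f x powr P x) + ennreal (h x))"
        using h0[of x] by (subst ennreal_mult_add) (auto simp: less_imp_le intro!: ennreal_leI)
    qed
    also have "\<dots> = ennreal (2 powr q) * ((\<integral>\<^sup>+x. ennreal (f x powr P x) \<partial>lborel) + (\<integral>\<^sup>+x. ennreal (h x) \<partial>lborel))"
      by (simp add: nn_integral_cmult nn_integral_add)
    also have "\<dots> \<le> ennreal (2 powr q) * (1 + ennreal H)"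
      unfolding H(1) using f1 by (intro mult_left_mono add_right_mono) auto
    also have "\<dots> = ennreal (2 powr q * (1 + H))"
      using H(2) by (simp add: ennreal_mult' flip: ennreal_1)
    finally have Gq: "(\<integral>\<^sup>+x. ennreal (G x powr q) \<partial>lborel) \<le> ennreal (2 powr q * (1 + H))" .
    define m where "m x = enn2real (maximal (\<lambda>y. ennreal (G y)) x)" for x
    have [measurable]: "m \<in> borel_measurable borel" unfolding m_def by measurable
    have m0: "0 \<le> m x" for x unfolding m_def by simp
    have finG: "AE x in lborel. maximal (\<lambda>y. ennreal (G y)) x < \<top>"
      using Gq by (intro AE_maximal_finite[OF _ q]) (auto simp: order_le_less_trans)
    have mean: "ball_mean (\<lambda>y. ennreal (f y)) k x \<le> ennreal ((1 + c) * (m x + h x) powr (1 / r x))"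
      if fin: "maximal (\<lambda>y. ennreal (G y)) x < \<top>" for x k
    proof -
      define \<rho> where "\<rho> = (2::real) powi k"
      have \<rho>: "0 < \<rho>" unfolding \<rho>_def by simp
      define g where "g = enn2real (ball_mean (\<lambda>y. ennreal (G y)) k x)"
      have "ball_mean (\<lambda>y. ennreal (G y)) k x < \<top>"
        using ball_mean_le_maximal fin by (rule order_le_less_trans)
      then have g: "ball_mean (\<lambda>y. ennreal (G y)) k x = ennreal g" "0 \<le> g" unfolding g_def by auto
      have gm: "g \<le> m x" unfolding g_def m_def using fin by (intro enn2real_mono ball_mean_le_maximal) auto
      define K where "K = g + h x"
      have K: "0 < K" "h x \<le> K" unfolding K_def using g h0[of x] by auto
      \<comment> \<open>A crude a priori bound on the mean of G: f^r \<le> f^P + 1, h \<le> 1, and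
        the modular of f is at most 1. Together with h x \<le> 1 this accounts for the 3 in
        \<open>K3\<close>.\<close>
      have "ennreal g \<le> ball_mean (\<lambda>y. ennreal (f y powr P y) + 2) k x"
        unfolding g(1)[symmetric]
      proof (rule ball_mean_mono)
        fix y
        have "G y \<le> f y powr P y + 2"
          unfolding G_def using powr_le_powr_add_1[OF f0, of "r y" "P y" y] r1[of y] rP[of y] h1[of y] by linarith
        then have "ennreal (G y) \<le> ennreal (f y powr P y + 2)" by (rule ennreal_leI)
        then show "ennreal (G y) \<le> ennreal (f y powr P y) + 2" by simp
      qed
      also have "\<dots> = ball_mean (\<lambda>y. ennreal (f y powr P y)) k x + 2"
        by (subst ball_mean_add) (auto simp: ball_mean_const)
      also have "\<dots> \<le> 1 / ennreal (V * \<rho> ^ n) + 2"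
      proof (intro add_right_mono)
        have "(\<integral>\<^sup>+y\<in>ball x (2 powi k). ennreal (f y powr P y) \<partial>lborel) \<le> (\<integral>\<^sup>+y. ennreal (f y powr P y) \<partial>lborel)"
          by (intro nn_integral_mono) (auto simp: indicator_def)
        also note f1
        finally show "ball_mean (\<lambda>y. ennreal (f y powr P y)) k x \<le> 1 / ennreal (V * \<rho> ^ n)"
          unfolding ball_mean_def V_def n_def \<rho>_def by (auto simp: emeasure_ball intro!: divide_right_mono_ennreal)
      qed
      also have "\<dots> = ennreal (1 / (V * \<rho> ^ n) + 2)"
        using V \<rho> by (simp add: divide_ennreal flip: ennreal_1)
      finally have "g \<le> 1 / (V * \<rho> ^ n) + 2" using V \<rho> by (subst (asm) ennreal_le_iff) auto
      then have K3: "K \<le> 3 + 1 / (V * \<rho> ^ n)" unfolding K_def using h1[of x] by simp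
      \<comment> \<open>Chosen so that A^(1 - r x) K = A; both terms of the pointwise decomposition
        then average to multiples of A.\<close>
      define A where "A = K powr (1 / r x)"
      have A: "0 < A" unfolding A_def using K by simp
      have AK: "A powr (1 - r x) * K = A"
      proof -
        have "K = A powr r x" unfolding A_def powr_powr using r0[of x] K by simp
        then show ?thesis using A by (simp flip: powr_add)
      qed
      have pw: "f y \<le> A + c * (f y powr r y + h y) * A powr (1 - r x)" if y: "dist x y < 2 powi k" for y
      proof (rule powr_le_powr_decomposition[where hx = "h x"])
        show "0 \<le> f y" "0 < K" "1 \<le> r x" "1 \<le> r y" "A = K powr (1 / r x)" "1 \<le> c" "0 \<le> h y"
          using f0 K r1 c h0 by (auto simp: A_def less_imp_le)
        show "K powr \<bar>r x - r y\<bar> \<le> c" if "1 \<le> K"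
        \<comment> \<open>On the diagonal 1 / 0 = 0, and \<open>loc\<close> cannot be compared with
          the scale \<rho>; but there the exponent is 0 and K^0 = 1 \<le> c.\<close>
        proof (cases "x = y")
          case False
          have "\<bar>r x - r y\<bar> \<le> L / ln (exp 1 + 1 / norm (x - y))" using rd[of x y] loc[of x y] by linarith
          also have "\<dots> \<le> L / ln (exp 1 + 1 / \<rho>)"
          proof -
            have a: "1 / \<rho> \<le> 1 / norm (x - y)"
              using y False unfolding \<rho>_def dist_norm by (intro divide_left_mono) auto
            have b: "ln (exp 1) < ln (exp 1 + 1 / \<rho>)"
              using \<rho> by (subst ln_less_cancel_iff) (auto intro!: add_pos_pos)
            moreover have "ln (exp 1 + 1 / \<rho>) \<le> ln (exp 1 + 1 / norm (x - y))"
              using \<rho> a False by (subst ln_le_cancel_iff) (auto intro!: add_pos_pos)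
            ultimately show ?thesis using L by (intro divide_left_mono mult_pos_pos) auto
          qed
          finally have "K powr \<bar>r x - r y\<bar> \<le> exp (L * (ln (3 + 1 / V) + n))"
            using that K3 V \<rho> L by (intro log_hoelder_powr_bound) auto
          then show ?thesis unfolding c_def by simp
        qed (use K c in auto)
        \<comment> \<open>The alternative with \<open>h y\<close> applies when |y| \<le> |x|, the
          one with \<open>h x\<close> otherwise. The latter needs h x \<le> K, which is why
          \<open>h x\<close> was added to the mean in K.\<close>
        show "(0 < h y \<and> h y powr - \<bar>r x - r y\<bar> \<le> c) \<or> (0 < h x \<and> h x \<le> K \<and> h x powr - \<bar>r x - r y\<bar> \<le> c)"
          using hpow[of y x y] hpow[of x x y] K h0 by (cases "norm y \<le> norm x") auto
      qed
      have "ball_mean (\<lambda>y. ennreal (f y)) k x \<le> ball_mean (\<lambda>y. ennreal A + ennreal (c * A powr (1 - r x)) * ennreal (G y)) k x"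
      proof (rule ball_mean_mono)
        fix y assume "dist x y < 2 powi k"
        from ennreal_leI[OF pw[OF this]]
        show "ennreal (f y) \<le> ennreal A + ennreal (c * A powr (1 - r x)) * ennreal (G y)"
          using A c G0[of y] unfolding G_def
          by (subst ennreal_mult[symmetric], simp, simp, subst ennreal_plus[symmetric]) (auto simp: mult_ac)
      qed
      also have "\<dots> = ennreal A + ennreal (c * A powr (1 - r x)) * ennreal g"
        by (subst ball_mean_add, simp, simp, subst ball_mean_cmult) (auto simp: ball_mean_const g)
      also have "\<dots> = ennreal (A + c * A powr (1 - r x) * g)"
        using A c g by (subst ennreal_mult[symmetric], simp, simp, subst ennreal_plus[symmetric]) auto
      also have "\<dots> \<le> ennreal ((1 + c) * A)"
      proof (intro ennreal_leI)
        have "c * A powr (1 - r x) * g \<le> c * A powr (1 - r x) * K"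
          unfolding K_def using c h0[of x] by (intro mult_left_mono) auto
        then show "A + c * A powr (1 - r x) * g \<le> (1 + c) * A" using AK by (simp add: mult.assoc distrib_right)
      qed
      also have "\<dots> \<le> ennreal ((1 + c) * (m x + h x) powr (1 / r x))"
        unfolding A_def K_def using gm c g h0[of x] r0[of x] by (intro ennreal_leI mult_left_mono powr_mono2) auto
      finally show ?thesis .
    qed
    have Mf: "maximal (\<lambda>y. ennreal (f y)) x \<le> ennreal ((1 + c) * (m x + h x) powr (1 / r x))"
      if fin: "maximal (\<lambda>y. ennreal (G y)) x < \<top>" for x
      unfolding maximal_def[of "\<lambda>y. ennreal (f y)"] using mean[OF fin] by (intro SUP_least)
    show "AE x in lborel. maximal (\<lambda>y. ennreal (f y)) x < \<top>"
      using finG by eventually_elim (rule order_le_less_trans[OF Mf], auto)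
    define c' where "c' = (1 + c) powr b * 2 powr q"
    have c': "0 \<le> c'" unfolding c'_def by simp
    have "(\<integral>\<^sup>+x. ennreal (enn2real (maximal (\<lambda>y. ennreal (f y)) x) powr P x) \<partial>lborel)
       \<le> (\<integral>\<^sup>+x. ennreal c' * (ennreal (m x powr q) + ennreal (h x)) \<partial>lborel)"
    proof (rule nn_integral_mono_AE)
      show "AE x in lborel. ennreal (enn2real (maximal (\<lambda>y. ennreal (f y)) x) powr P x)
          \<le> ennreal c' * (ennreal (m x powr q) + ennreal (h x))"
        using finG
      proof eventually_elim
        case (elim x)
        have "enn2real (maximal (\<lambda>y. ennreal (f y)) x) \<le> (1 + c) * (m x + h x) powr (1 / r x)"
          using c by (intro enn2real_leI Mf elim) auto
        then have "enn2real (maximal (\<lambda>y. ennreal (f y)) x) powr P x \<le> ((1 + c) * (m x + h x) powr (1 / r x)) powr P x"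
          using P(1)[of x] q by (intro powr_mono2) auto
        \<comment> \<open>The exponent (1 / r x) P x is the constant q, so the strong type bound on
          L^q can be applied to \<open>m\<close>.\<close>
        also have "\<dots> = (1 + c) powr P x * (m x + h x) powr q"
          using c q P(1)[of x] by (simp add: powr_mult powr_powr r_def)
        also have "\<dots> \<le> (1 + c) powr b * (2 powr q * (m x powr q + h x powr q))"
          using c P(2)[of x] m0[of x] h0[of x] q by (intro mult_mono powr_mono powr_add_le) auto
        also have "\<dots> \<le> c' * (m x powr q + h x)"
          unfolding c'_def mult.assoc using hq[of x] by (intro mult_left_mono add_left_mono) auto
        finally show ?case
          using c' h0[of x] by (subst ennreal_mult_add) (auto simp: less_imp_le intro!: ennreal_leI)
      qed
    qed
    also have "\<dots> = ennreal c' * ((\<integral>\<^sup>+x. ennreal (m x powr q) \<partial>lborel) + (\<integral>\<^sup>+x. ennreal (h x) \<partial>lborel))"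
      by (simp add: nn_integral_cmult nn_integral_add)
    also have "\<dots> \<le> ennreal c' * (ennreal Cq * ennreal (2 powr q * (1 + H)) + ennreal H)"
    proof (intro mult_left_mono add_mono)
      have "(\<integral>\<^sup>+x. ennreal (m x powr q) \<partial>lborel) \<le> ennreal Cq * (\<integral>\<^sup>+x. ennreal (G x powr q) \<partial>lborel)"
        unfolding m_def Cq_def using G0 by (intro maximal_strong_type q) (auto simp: less_imp_le)
      also have "\<dots> \<le> ennreal Cq * ennreal (2 powr q * (1 + H))" by (intro mult_left_mono Gq) auto
      finally show "(\<integral>\<^sup>+x. ennreal (m x powr q) \<partial>lborel) \<le> \<dots>" .
    qed (auto simp: H)
    also have "\<dots> = ennreal (c' * (Cq * (2 powr q * (1 + H)) + H))"
      using c' Cq H by (simp add: ennreal_mult'[symmetric] flip: ennreal_plus)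
    also have "\<dots> \<le> ennreal C"
      unfolding C_def c'_def by (intro ennreal_leI) (simp add: mult.assoc)
    finally show "(\<integral>\<^sup>+x. ennreal (enn2real (maximal (\<lambda>y. ennreal (f y)) x) powr P x) \<partial>lborel) \<le> ennreal C" .
  qed
qed

section \<open>Rapidly decreasing radial profiles\<close>

text \<open>A single term of the exponential series.\<close>

lemma power_le_fact_mult_exp: "x ^ k \<le> fact k * exp x" if "0 \<le> x" for x :: real
proof -
  have s: "(\<lambda>n. x ^ n / fact n) sums exp x"
    using exp_converges[of x] by (simp add: divide_inverse mult.commute)
  have "x ^ k / fact k = sum (\<lambda>n. x ^ n / fact n) {k}" by simp
  also have "\<dots> \<le> (\<Sum>n. x ^ n / fact n)"
    using that by (intro sum_le_suminf) (auto simp: sums_summable[OF s])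
  also have "\<dots> = exp x" using s by (rule sums_unique[symmetric])
  finally show ?thesis by (simp add: field_simps)
qed

text \<open>Only \<open>t \<ge> 0\<close> is controlled, because the profiles are composed with \<open>|\<xi>|\<^sup>2\<close>.\<close>

coinductive rapid :: "(real \<Rightarrow> real) \<Rightarrow> bool" where
  "(\<And>t. (f has_real_derivative f' t) (at t)) \<Longrightarrow>
   (\<And>m::nat. \<exists>C. \<forall>t\<ge>0. (1 + t) ^ m * \<bar>f t\<bar> \<le> C) \<Longrightarrow> rapid f' \<Longrightarrow> rapid f"

lemma rapidE:
  assumes "rapid f"
  obtains f' where "\<And>t. (f has_real_derivative f' t) (at t)" "rapid f'"
  using assms by (rule rapid.cases) blast

lemma rapid_decay: "rapid f \<Longrightarrow> \<exists>C. \<forall>t\<ge>0. (1 + t) ^ m * \<bar>f t\<bar> \<le> C"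
  by (auto elim: rapid.cases)

lemma decay_add:
  fixes f g :: "real \<Rightarrow> real"
  assumes "\<exists>C. \<forall>t\<ge>0. (1 + t) ^ m * \<bar>f t\<bar> \<le> C" "\<exists>C. \<forall>t\<ge>0. (1 + t) ^ m * \<bar>g t\<bar> \<le> C"
  shows "\<exists>C. \<forall>t\<ge>0. (1 + t) ^ m * \<bar>a * f t + g t\<bar> \<le> C"
proof -
  obtain C D where CD: "\<And>t. t \<ge> 0 \<Longrightarrow> (1 + t) ^ m * \<bar>f t\<bar> \<le> C" "\<And>t. t \<ge> 0 \<Longrightarrow> (1 + t) ^ m * \<bar>g t\<bar> \<le> D"
    using assms by blast
  have "(1 + t) ^ m * \<bar>a * f t + g t\<bar> \<le> \<bar>a\<bar> * C + D" if "t \<ge> 0" for t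
  proof -
    have "(1 + t) ^ m * \<bar>a * f t + g t\<bar> \<le> (1 + t) ^ m * (\<bar>a\<bar> * \<bar>f t\<bar> + \<bar>g t\<bar>)"
      using that by (intro mult_left_mono) (auto simp: abs_mult[symmetric])
    also have "\<dots> = \<bar>a\<bar> * ((1 + t) ^ m * \<bar>f t\<bar>) + (1 + t) ^ m * \<bar>g t\<bar>" by (simp add: algebra_simps)
    also have "\<dots> \<le> \<bar>a\<bar> * C + D" using CD[OF that] by (intro add_mono mult_left_mono) auto
    finally show ?thesis .
  qed
  then show ?thesis by blast
qed

text \<open>Coinduction with a set as invariant: closure under differentiation and plain decay of
  each member give the decay of all derivatives, without iterating derivatives explicitly.\<close>

lemma rapidI:
  assumes "\<And>f. f \<in> X \<Longrightarrow> \<exists>f'\<in>X. \<forall>t. (f has_real_derivative f' t) (at t)"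
    and "\<And>f m. f \<in> X \<Longrightarrow> \<exists>C. \<forall>t\<ge>0. (1 + t) ^ m * \<bar>f t\<bar> \<le> C"
    and "f \<in> X"
  shows "rapid f"
  using assms(3)
proof (coinduction arbitrary: f rule: rapid.coinduct)
  case (rapid f)
  then obtain f' where "f' \<in> X" "\<And>t. (f has_real_derivative f' t) (at t)"
    using assms(1) by blast
  moreover have "\<forall>m. \<exists>C. \<forall>t\<ge>0. (1 + t) ^ m * \<bar>f t\<bar> \<le> C" using assms(2)[OF rapid] by blast
  ultimately show ?case by (simp only: simp_thms ex_simps) (intro exI[of _ f'] conjI allI disjI1; simp)
qed

lemma rapid_zero: "rapid (\<lambda>t. 0)"
  by (rule rapidI[where X = "{\<lambda>t. 0}"]) auto

lemma rapid_add_cmult: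
  assumes "rapid f" "rapid g"
  shows "rapid (\<lambda>t. a * f t + g t)"
proof (rule rapidI[where X = "{\<lambda>t. a * f t + g t | f g. rapid f \<and> rapid g}"])
  fix F assume "F \<in> {\<lambda>t. a * f t + g t | f g. rapid f \<and> rapid g}"
  then obtain f g where F: "F = (\<lambda>t. a * f t + g t)" "rapid f" "rapid g" by blast
  obtain f' where f: "\<And>t. (f has_real_derivative f' t) (at t)" "rapid f'"
    using F(2) by (blast elim: rapidE)
  obtain g' where g: "\<And>t. (g has_real_derivative g' t) (at t)" "rapid g'"
    using F(3) by (blast elim: rapidE)
  show "\<exists>F'\<in>{\<lambda>t. a * f t + g t | f g. rapid f \<and> rapid g}. \<forall>t. (F has_real_derivative F' t) (at t)"
  proof (intro bexI allI)
    show "(F has_real_derivative a * f' t + g' t) (at t)" for t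
      unfolding F by (auto intro!: derivative_eq_intros f g)
  qed (use f g in blast)
  show "\<exists>C. \<forall>t\<ge>0. (1 + t) ^ m * \<bar>F t\<bar> \<le> C" for m
    unfolding F by (intro decay_add rapid_decay F)
qed (use assms in blast)

lemma rapid_cmult: "rapid f \<Longrightarrow> rapid (\<lambda>t. a * f t)"
  using rapid_add_cmult[of f "\<lambda>_. 0" a] rapid_zero by simp

lemma rapid_add: "rapid f \<Longrightarrow> rapid g \<Longrightarrow> rapid (\<lambda>t. f t + g t)"
  using rapid_add_cmult[of f g 1] by simp

text \<open>The amplitude a belongs to the invariant family because each differentiation multiplies
  by c.\<close>

lemma rapid_scale:
  assumes "rapid f" and c: "0 < c"
  shows "rapid (\<lambda>t. a * f (c * t))"
proof (rule rapidI[where X = "{\<lambda>t. a * f (c * t) | a f. rapid f}"])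
  fix F assume "F \<in> {\<lambda>t. a * f (c * t) | a f. rapid f}"
  then obtain a f where F: "F = (\<lambda>t. a * f (c * t))" "rapid f" by blast
  obtain f' where f: "\<And>t. (f has_real_derivative f' t) (at t)" "rapid f'"
    using F(2) by (blast elim: rapidE)
  show "\<exists>F'\<in>{\<lambda>t. a * f (c * t) | a f. rapid f}. \<forall>t. (F has_real_derivative F' t) (at t)"
  proof (intro bexI allI)
    show "(F has_real_derivative a * c * f' (c * t)) (at t)" for t
      unfolding F by (auto intro!: derivative_eq_intros DERIV_chain2[OF f(1)])
  qed (use f in blast)
  show "\<exists>C. \<forall>t\<ge>0. (1 + t) ^ m * \<bar>F t\<bar> \<le> C" for m
  proof -
    obtain C where C: "\<And>t. t \<ge> 0 \<Longrightarrow> (1 + t) ^ m * \<bar>f t\<bar> \<le> C"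
      using rapid_decay[OF F(2)] by blast
    have "(1 + t) ^ m * \<bar>F t\<bar> \<le> \<bar>a\<bar> * ((1 + 1 / c) ^ m * C)" if "t \<ge> 0" for t
    proof -
      have "1 + t \<le> (1 + 1 / c) * (1 + c * t)" using that c by (simp add: field_simps)
      then have "(1 + t) ^ m * \<bar>f (c * t)\<bar> \<le> ((1 + 1 / c) * (1 + c * t)) ^ m * \<bar>f (c * t)\<bar>"
        using that by (intro mult_right_mono power_mono) auto
      also have "\<dots> = (1 + 1 / c) ^ m * ((1 + c * t) ^ m * \<bar>f (c * t)\<bar>)"
        by (simp only: power_mult_distrib mult.assoc)
      also have "\<dots> \<le> (1 + 1 / c) ^ m * C" using that c by (intro mult_left_mono C) auto
      finally have "\<bar>a\<bar> * ((1 + t) ^ m * \<bar>f (c * t)\<bar>) \<le> \<bar>a\<bar> * ((1 + 1 / c) ^ m * C)" by (intro mult_left_mono) auto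
      then show ?thesis unfolding F by (simp add: abs_mult mult_ac)
    qed
    then show ?thesis by blast
  qed
qed (use assms in blast)

text \<open>In t = |xi|^2 this is the profile of the Gaussian.\<close>

lemma rapid_exp: "rapid (\<lambda>t. a * exp (- t / 2))"
proof (rule rapidI[where X = "{\<lambda>t. a * exp (- t / 2) | a. True}"])
  fix F assume "F \<in> {\<lambda>t. a * exp (- t / 2) | a::real. True}"
  then obtain a where F: "F = (\<lambda>t. a * exp (- t / 2))" by blast
  show "\<exists>F'\<in>{\<lambda>t. a * exp (- t / 2) | a. True}. \<forall>t. (F has_real_derivative F' t) (at t)"
  proof (intro bexI allI)
    show "(F has_real_derivative (- a / 2) * exp (- t / 2)) (at t)" for t
      unfolding F by (auto intro!: derivative_eq_intros)
  qed blast
  show "\<exists>C. \<forall>t\<ge>0. (1 + t) ^ m * \<bar>F t\<bar> \<le> C" for m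
    unfolding F
  proof (intro exI[of _ "\<bar>a\<bar> * (2 ^ m * fact m * exp (1/2))"] allI impI)
    fix t :: real assume "t \<ge> 0"
    then have "((1 + t) / 2) ^ m \<le> fact m * exp ((1 + t) / 2)" by (intro power_le_fact_mult_exp) auto
    then have "(1 + t) ^ m \<le> 2 ^ m * (fact m * exp ((1 + t) / 2))" by (simp add: power_divide field_simps)
    then have "(1 + t) ^ m * exp (- t / 2) \<le> 2 ^ m * (fact m * exp ((1 + t) / 2)) * exp (- t / 2)"
      by (intro mult_right_mono) auto
    also have "\<dots> = 2 ^ m * fact m * exp (1/2)"
      by (simp add: mult.assoc flip: exp_add) (simp add: add_divide_distrib)
    finally have "\<bar>a\<bar> * ((1 + t) ^ m * exp (- t / 2)) \<le> \<bar>a\<bar> * (2 ^ m * fact m * exp (1/2))"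
      by (intro mult_left_mono) auto
    then show "(1 + t) ^ m * \<bar>a * exp (- t / 2)\<bar> \<le> \<bar>a\<bar> * (2 ^ m * fact m * exp (1/2))"
      by (simp add: abs_mult mult_ac)
  qed
qed blast

section \<open>The cutoff and band profiles\<close>

text \<open>Away from 0 a real power of t is dominated by a natural power, since 4 t \<ge> 1. The
  threshold 1/4 is where \<open>band\<close> starts, and 1/e is the decay rate of
  \<open>cutoff\<close>.\<close>

lemma powr_exp_decay:
  fixes a :: real
  shows "\<exists>C. \<forall>t\<ge>1/4. (1 + t) ^ m * (t powr a * exp (- t / exp 1)) \<le> C"
proof -
  define N where "N = nat \<lceil>\<bar>a\<bar>\<rceil>"
  have N: "a \<le> real N" unfolding N_def by linarith
  define K where "K = m + N"
  have "(1 + t) ^ m * (t powr a * exp (- t / exp 1)) \<le> 4 powr (- a) * 4 ^ N * (exp 1 ^ K * fact K * exp (1 / exp 1))"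
    if t: "1/4 \<le> t" for t
  proof -
    have "t powr a = 4 powr (- a) * (4 * t) powr a"
      using t by (simp add: powr_mult powr_minus field_simps)
    also have "\<dots> \<le> 4 powr (- a) * (4 * t) powr N"
      using t N by (intro mult_left_mono powr_mono) auto
    also have "\<dots> = 4 powr (- a) * (4 ^ N * t ^ N)"
      using t by (simp add: powr_realpow power_mult_distrib)
    also have "\<dots> \<le> 4 powr (- a) * (4 ^ N * (1 + t) ^ N)"
      using t by (intro mult_left_mono power_mono) auto
    finally have 1: "t powr a \<le> 4 powr (- a) * 4 ^ N * (1 + t) ^ N" by simp
    have "((1 + t) / exp 1) ^ K \<le> fact K * exp ((1 + t) / exp 1)"
      using t by (intro power_le_fact_mult_exp) auto
    then have "(1 + t) ^ K \<le> exp 1 ^ K * (fact K * exp ((1 + t) / exp 1))"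
      by (simp add: power_divide field_simps del: exp_of_nat_mult)
    then have "(1 + t) ^ K * exp (- t / exp 1) \<le> exp 1 ^ K * (fact K * exp ((1 + t) / exp 1)) * exp (- t / exp 1)"
      by (intro mult_right_mono) auto
    also have "\<dots> = exp 1 ^ K * fact K * exp (1 / exp 1)"
      by (simp add: mult.assoc flip: exp_add) (simp add: add_divide_distrib)
    finally have 2: "(1 + t) ^ K * exp (- t / exp 1) \<le> exp 1 ^ K * fact K * exp (1 / exp 1)" .
    have "(1 + t) ^ m * (t powr a * exp (- t / exp 1))
        \<le> (1 + t) ^ m * (4 powr (- a) * 4 ^ N * (1 + t) ^ N * exp (- t / exp 1))"
      using t 1 by (intro mult_left_mono mult_right_mono) auto
    also have "\<dots> = 4 powr (- a) * 4 ^ N * ((1 + t) ^ K * exp (- t / exp 1))"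
      unfolding K_def power_add by simp
    also have "\<dots> \<le> 4 powr (- a) * 4 ^ N * (exp 1 ^ K * fact K * exp (1 / exp 1))"
      using 2 by (intro mult_left_mono) auto
    finally show ?thesis .
  qed
  then show ?thesis by blast
qed

text \<open>The cutoff is smooth, equal to 1 on \<open>t \<le> 1\<close>, and decays exponentially; it need not have
  compact support.\<close>

definition cutoff :: "real \<Rightarrow> real" where
  "cutoff t = (if t \<le> 1 then 1 else exp (- t * exp (- 1 / (t - 1))))"

text \<open>The terms that arise from differentiating the cutoff: powers of t and of the pole 1 / (t
  - 1), damped by exp (-l / (t - 1)), which for l \<ge> 1 makes each of them vanish to all orders at
  t = 1. The family is closed under differentiation up to linear combinations.\<close>

definition flat :: "real \<Rightarrow> nat \<Rightarrow> real \<Rightarrow> real \<Rightarrow> real" where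
  "flat a m l t = (if t \<le> 1 then 0 else t powr a * (1 / (t - 1)) ^ m * exp (- l / (t - 1)) * cutoff t)"

text \<open>For t > 2 the inner exponential is at least 1/e, whence the rate; for t \<le> 2 the
  prefactor e suffices, as t / e \<le> 1.\<close>

lemma cutoff_bounds: "0 \<le> cutoff t" "cutoff t \<le> exp 1 * exp (- t / exp 1)" "0 < t \<Longrightarrow> cutoff t \<le> 1"
proof -
  show "0 \<le> cutoff t" unfolding cutoff_def by simp
  show "0 < t \<Longrightarrow> cutoff t \<le> 1" unfolding cutoff_def by simp
  have e2: "2 \<le> exp (1::real)" using exp_ge_add_one_self[of 1] by simp
  show "cutoff t \<le> exp 1 * exp (- t / exp 1)"
  proof (cases "t \<le> 2")
    case True
    have "t / exp 1 \<le> 1" using True e2 by (simp add: field_simps)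
    then have "1 \<le> exp 1 * exp (- t / exp 1)" by (simp flip: exp_add)
    moreover have "cutoff t \<le> 1" unfolding cutoff_def by auto
    ultimately show ?thesis by simp
  next
    case False
    have "exp (- 1) \<le> exp (- 1 / (t - 1))" using False by (simp add: field_simps)
    then have "t * exp (- 1) \<le> t * exp (- 1 / (t - 1))" using False by (intro mult_left_mono) auto
    then have "cutoff t \<le> exp (- t / exp 1)" using False unfolding cutoff_def by (simp add: exp_minus field_simps)
    also have "\<dots> \<le> exp 1 * exp (- t / exp 1)" using e2 by (simp add: mult_le_cancel_right1)
    finally show ?thesis .
  qed
qed

text \<open>With y = 1 / (t - 1) the pole is compensated by y^m e^(-y) \<le> m!, and the growth at
  infinity by the cutoff.\<close>

lemma flat_decay:
  assumes "1 \<le> l"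
  shows "\<exists>C. \<forall>t\<ge>0. (1 + t) ^ k * \<bar>flat a m l t\<bar> \<le> C"
proof -
  obtain C where C: "\<And>t::real. 1/4 \<le> t \<Longrightarrow> (1 + t) ^ k * (t powr a * exp (- t / exp 1)) \<le> C"
    using powr_exp_decay by blast
  have C0: "0 \<le> C" using C[of 1] by (rule order_trans[rotated]) auto
  have "(1 + t) ^ k * \<bar>flat a m l t\<bar> \<le> fact m * exp 1 * C" if "t \<ge> 0" for t
  proof (cases "t \<le> 1")
    case False
    define y where "y = 1 / (t - 1)"
    have y: "0 < y" unfolding y_def using False by simp
    have "y ^ m * exp (- l / (t - 1)) \<le> y ^ m * exp (- y)"
      unfolding y_def using False assms by (intro mult_left_mono) (auto simp: field_simps)
    also have "\<dots> \<le> fact m * exp y * exp (- y)"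
      using y by (intro mult_right_mono power_le_fact_mult_exp) auto
    also have "\<dots> = fact m" by (simp add: mult.assoc flip: exp_add)
    finally have 1: "y ^ m * exp (- l / (t - 1)) \<le> fact m" .
    have "(1 + t) ^ k * \<bar>flat a m l t\<bar> = (1 + t) ^ k * t powr a * ((y ^ m * exp (- l / (t - 1))) * cutoff t)"
      unfolding flat_def y_def using False cutoff_bounds(1)[of t] by (simp add: abs_mult)
    also have "\<dots> \<le> (1 + t) ^ k * t powr a * (fact m * (exp 1 * exp (- t / exp 1)))"
      using 1 cutoff_bounds[of t] that y by (intro mult_left_mono mult_mono) auto
    also have "\<dots> = fact m * exp 1 * ((1 + t) ^ k * (t powr a * exp (- t / exp 1)))" by simp
    also have "\<dots> \<le> fact m * exp 1 * C" using False by (intro mult_left_mono C) auto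
    finally show ?thesis .
  qed (use C0 in \<open>simp add: flat_def\<close>)
  then show ?thesis by blast
qed

lemma has_real_derivative_zero_quadratic:
  fixes f :: "real \<Rightarrow> real"
  assumes "\<And>t. \<bar>t - x\<bar> \<le> 1 \<Longrightarrow> \<bar>f t - f x\<bar> \<le> C * (t - x) ^ 2"
  shows "(f has_real_derivative 0) (at x)"
proof -
  have "((\<lambda>t. (f t - f x) / (t - x)) \<longlongrightarrow> 0) (at x)"
  proof (rule Lim_null_comparison)
    show "\<forall>\<^sub>F t in at x. norm ((f t - f x) / (t - x)) \<le> \<bar>C\<bar> * \<bar>t - x\<bar>"
      unfolding eventually_at
    proof (intro exI[of _ 1] conjI ballI impI)
      fix t assume t: "t \<noteq> x \<and> dist t x < 1"
      then have "\<bar>f t - f x\<bar> \<le> C * (t - x) ^ 2" by (intro assms) (auto simp: dist_real_def)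
      also have "\<dots> \<le> \<bar>C\<bar> * \<bar>t - x\<bar> * \<bar>t - x\<bar>"
        by (simp add: power2_eq_square mult.assoc mult_right_mono)
      finally show "norm ((f t - f x) / (t - x)) \<le> \<bar>C\<bar> * \<bar>t - x\<bar>"
        using t by (simp add: abs_divide field_simps)
    qed auto
    show "((\<lambda>t. \<bar>C\<bar> * \<bar>t - x\<bar>) \<longlongrightarrow> 0) (at x)"
      by (auto intro!: tendsto_eq_intros)
  qed
  then show ?thesis by (simp add: has_field_derivative_iff)
qed

lemma cutoff_has_derivative:
  "(cutoff has_real_derivative (- flat 0 0 1 t - flat 1 2 1 t)) (at t)"
proof -
  consider "t < 1" | "t = 1" | "1 < t" by linarith
  then show ?thesis
  proof cases
    case 1
    have "((\<lambda>_. 1) has_real_derivative 0) (at t)" by simp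
    then have "(cutoff has_real_derivative 0) (at t)"
      by (rule has_field_derivative_transform_within_open[of _ _ _ "{..<1}"]) (use 1 in \<open>auto simp: cutoff_def\<close>)
    then show ?thesis using 1 by (simp add: flat_def)
  next
    case 2
    \<comment> \<open>Uses 1 - e^(-z) \<le> z for z = u exp (-1 / (u - 1)), with u \<le> 2 and
      e^(-y) \<le> 2 / y^2 at y = 1 / (u - 1); the constant 4 is the product of these two factors
      2.\<close>
    have "\<bar>cutoff u - cutoff 1\<bar> \<le> 4 * (u - 1) ^ 2" if "\<bar>u - 1\<bar> \<le> 1" for u
    proof (cases "u \<le> 1")
      case False
      define y where "y = 1 / (u - 1)"
      have y: "0 < y" unfolding y_def using False by simp
      have "y ^ 2 * exp (- y) \<le> 2 * exp y * exp (- y)"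
        using y power_le_fact_mult_exp[of y 2] by (intro mult_right_mono) auto
      then have "y ^ 2 * exp (- y) \<le> 2" by (simp add: mult.assoc flip: exp_add)
      then have h: "exp (- 1 / (u - 1)) \<le> 2 * (u - 1) ^ 2"
        unfolding y_def using False by (simp add: power_divide field_simps)
      have "\<bar>cutoff u - cutoff 1\<bar> = 1 - exp (- (u * exp (- 1 / (u - 1))))"
        using False by (simp add: cutoff_def)
      also have "\<dots> \<le> u * exp (- 1 / (u - 1))"
        using exp_ge_add_one_self[of "- (u * exp (- 1 / (u - 1)))"] by linarith
      also have "\<dots> \<le> 2 * (2 * (u - 1) ^ 2)" using h that False by (intro mult_mono) auto
      finally show ?thesis by simp
    qed (simp add: cutoff_def)
    then have "(cutoff has_real_derivative 0) (at 1)" by (rule has_real_derivative_zero_quadratic)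
    then show ?thesis using 2 by (simp add: flat_def)
  next
    case 3
    have "((\<lambda>t. exp (- t * exp (- 1 / (t - 1)))) has_real_derivative
       exp (- t * exp (- 1 / (t - 1))) * (- exp (- 1 / (t - 1)) - t * (exp (- 1 / (t - 1)) * (1 / (t - 1)^2)))) (at t)"
      using 3 by (auto intro!: derivative_eq_intros simp: power2_eq_square field_simps)
    then have "(cutoff has_real_derivative
       exp (- t * exp (- 1 / (t - 1))) * (- exp (- 1 / (t - 1)) - t * (exp (- 1 / (t - 1)) * (1 / (t - 1)^2)))) (at t)"
      by (rule has_field_derivative_transform_within_open[of _ _ _ "{1<..}"]) (use 3 in \<open>auto simp: cutoff_def\<close>)
    moreover have "exp (- t * exp (- 1 / (t - 1))) * (- exp (- 1 / (t - 1)) - t * (exp (- 1 / (t - 1)) * (1 / (t - 1)^2)))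
      = - flat 0 0 1 t - flat 1 2 1 t"
      using 3 by (simp add: flat_def cutoff_def power_divide algebra_simps)
    ultimately show ?thesis by simp
  qed
qed

text \<open>The product rule with four factors; the last two terms come from the cutoff. At the
  junction t = 1 the function is (t - 1)^2 times the bounded member with m + 2, so its derivative is
  0 there.\<close>

lemma flat_has_derivative:
  assumes l: "1 \<le> l"
  shows "(flat a m l has_real_derivative
    (a * flat (a - 1) m l t - m * flat a (m + 1) l t + l * flat a (m + 2) l t
      - flat a m (l + 1) t - flat (a + 1) (m + 2) (l + 1) t)) (at t)"
proof -
  consider "t < 1" | "t = 1" | "1 < t" by linarith
  then show ?thesis
  proof cases
    case 1
    have "((\<lambda>_. 0) has_real_derivative 0) (at t)" by simp
    then have "(flat a m l has_real_derivative 0) (at t)"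
      by (rule has_field_derivative_transform_within_open[of _ _ _ "{..<1}"]) (use 1 in \<open>auto simp: flat_def\<close>)
    then show ?thesis using 1 by (simp add: flat_def)
  next
    case 2
    obtain C where C: "\<And>t. t \<ge> 0 \<Longrightarrow> (1 + t) ^ 0 * \<bar>flat a (m + 2) l t\<bar> \<le> C"
      using flat_decay[OF l] by blast
    have "\<bar>flat a m l u - flat a m l 1\<bar> \<le> C * (u - 1) ^ 2" if "\<bar>u - 1\<bar> \<le> 1" for u
    proof -
      have "flat a m l u - flat a m l 1 = flat a (m + 2) l u * (u - 1) ^ 2"
      proof (cases "u \<le> 1")
        case False
        then have "(1 / (u - 1)) ^ 2 * (u - 1) ^ 2 = 1" by (simp flip: power_mult_distrib)
        then have "(1 / (u - 1)) ^ (m + 2) * (u - 1) ^ 2 = (1 / (u - 1)) ^ m"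
          unfolding power_add mult.assoc by simp
        then show ?thesis using False unfolding flat_def by (simp add: mult_ac del: power_Suc)
      qed (simp add: flat_def)
      then have "\<bar>flat a m l u - flat a m l 1\<bar> = \<bar>flat a (m + 2) l u\<bar> * (u - 1) ^ 2"
        by (simp only: abs_mult) simp
      also have "\<dots> \<le> C * (u - 1) ^ 2" using C[of u] that by (intro mult_right_mono) auto
      finally show ?thesis .
    qed
    then have "(flat a m l has_real_derivative 0) (at 1)" by (rule has_real_derivative_zero_quadratic)
    then show ?thesis using 2 by (simp add: flat_def)
  next
    case 3
    have p: "((\<lambda>t. (1 / (t - 1)) ^ m) has_real_derivative - (m * (1 / (t - 1)) ^ (m + 1))) (at t)"
    proof -
      have i: "((\<lambda>t. 1 / (t - 1)) has_real_derivative - ((1 / (t - 1)) ^ 2)) (at t)"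
        using 3 by (auto intro!: derivative_eq_intros simp: power2_eq_square field_simps)
      have "m * (1 / (t - 1)) ^ (m - 1) * - ((1 / (t - 1)) ^ 2) = - (m * (1 / (t - 1)) ^ (m + 1))"
        by (cases m) (auto simp: power2_eq_square)
      with DERIV_power[OF i, of m] show ?thesis by (simp add: mult_ac)
    qed
    have e: "((\<lambda>t. exp (- l / (t - 1))) has_real_derivative exp (- l / (t - 1)) * (l * (1 / (t - 1)) ^ 2)) (at t)"
      using 3 by (auto intro!: derivative_eq_intros simp: power2_eq_square field_simps)
    have w: "((\<lambda>t. t powr a) has_real_derivative a * t powr (a - 1)) (at t)"
      using 3 by (intro has_real_derivative_powr) auto
    have "((\<lambda>t. t powr a * (1 / (t - 1)) ^ m * exp (- l / (t - 1)) * cutoff t) has_real_derivative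
      (a * flat (a - 1) m l t - m * flat a (m + 1) l t + l * flat a (m + 2) l t
      - flat a m (l + 1) t - flat (a + 1) (m + 2) (l + 1) t)) (at t)"
    proof (rule DERIV_cong[OF DERIV_mult'[OF DERIV_mult'[OF DERIV_mult'[OF w p] e] cutoff_has_derivative]])
      define y where "y = 1 / (t - 1)"
      have E: "exp (- (l + 1) / (t - 1)) = exp (- l / (t - 1)) * exp (- 1 / (t - 1))"
        by (simp add: diff_divide_distrib flip: exp_add)
      have T: "t powr (a + 1) = t powr a * t" using 3 by (simp add: powr_add)
      show "t powr a * (1 / (t - 1)) ^ m * exp (- l / (t - 1)) * (- flat 0 0 1 t - flat 1 2 1 t) +
        (t powr a * (1 / (t - 1)) ^ m * (exp (- l / (t - 1)) * (l * (1 / (t - 1))\<^sup>2)) +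
        (t powr a * - (real m * (1 / (t - 1)) ^ (m + 1)) + a * t powr (a - 1) * (1 / (t - 1)) ^ m) * exp (- l / (t - 1))) * cutoff t
        = a * flat (a - 1) m l t - real m * flat a (m + 1) l t + l * flat a (m + 2) l t - flat a m (l + 1) t - flat (a + 1) (m + 2) (l + 1) t"
        using 3 unfolding flat_def E T y_def[symmetric]
        by (simp add: algebra_simps power_add power2_eq_square)
    qed
    then show ?thesis
      by (rule has_field_derivative_transform_within_open[of _ _ _ "{1<..}"]) (use 3 in \<open>auto simp: flat_def\<close>)
  qed
qed

inductive_set flat_span :: "(real \<Rightarrow> real) set" where
  flat: "1 \<le> l \<Longrightarrow> flat a m l \<in> flat_span"
| add_cmult: "f \<in> flat_span \<Longrightarrow> g \<in> flat_span \<Longrightarrow> (\<lambda>t. c * f t + g t) \<in> flat_span"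

lemma flat_span_derivative:
  "f \<in> flat_span \<Longrightarrow> \<exists>f'\<in>flat_span. \<forall>t. (f has_real_derivative f' t) (at t)"
proof (induction rule: flat_span.induct)
  case (flat l a m)
  have l1: "1 \<le> l + 1" using flat by simp
  \<comment> \<open>The closure rule builds c f + g, so the nested combination has to end in a
    member of the span; it ends in the zero function, obtained as -f + f.\<close>
  let ?f = "\<lambda>t. a * flat (a - 1) m l t + ((- real m) * flat a (m + 1) l t + (l * flat a (m + 2) l t
    + ((- 1) * flat a m (l + 1) t + ((- 1) * flat (a + 1) (m + 2) (l + 1) t + flat a m l t * 0))))"
  have z: "(\<lambda>t. flat a m l t * 0) \<in> flat_span"
    using flat_span.add_cmult[OF flat_span.flat[OF flat, of a m] flat_span.flat[OF flat, of a m], of "-1"] by simp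
  have "?f \<in> flat_span"
    using flat l1 z by (intro flat_span.intros)
  moreover have "(flat a m l has_real_derivative ?f t) (at t)" for t
    by (rule DERIV_cong[OF flat_has_derivative[OF flat]]) simp
  ultimately show ?case by (intro bexI[of _ ?f] allI)
next
  case (add_cmult f g c)
  then obtain f' g' where "f' \<in> flat_span" "g' \<in> flat_span"
    and d: "\<And>t. (f has_real_derivative f' t) (at t)" "\<And>t. (g has_real_derivative g' t) (at t)" by blast
  then show ?case
    by (intro bexI[of _ "\<lambda>t. c * f' t + g' t"] flat_span.add_cmult)
      (auto intro!: derivative_eq_intros d)
qed

lemma flat_span_decay: "f \<in> flat_span \<Longrightarrow> \<exists>C. \<forall>t\<ge>0. (1 + t) ^ m * \<bar>f t\<bar> \<le> C"
  by (induction rule: flat_span.induct) (auto intro!: flat_decay decay_add)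

lemma flat_span_rapid: "f \<in> flat_span \<Longrightarrow> rapid f"
  by (rule rapidI[OF flat_span_derivative flat_span_decay])

lemma rapid_flat: "1 \<le> l \<Longrightarrow> rapid (flat a m l)"
  by (intro flat_span_rapid flat_span.flat)

text \<open>All members of \<open>flat_span\<close> vanish on t \<le> 1, so \<open>cutoff\<close> is
  not one of them, but its derivative is a combination of them; one unfolding of the coinductive
  definition connects the two.\<close>

lemma rapid_cutoff: "rapid cutoff"
proof (rule rapid.intros)
  show "(cutoff has_real_derivative (- flat 0 0 1 t - flat 1 2 1 t)) (at t)" for t
    by (rule cutoff_has_derivative)
  show "rapid (\<lambda>t. - flat 0 0 1 t - flat 1 2 1 t)"
    using rapid_add_cmult[OF rapid_flat[of 1 0 0] rapid_cmult[OF rapid_flat[of 1 1 2], of "-1"], of "-1"] by simp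
  fix m :: nat
  obtain C where C: "\<And>t::real. 1/4 \<le> t \<Longrightarrow> (1 + t) ^ m * (t powr 0 * exp (- t / exp 1)) \<le> C"
    using powr_exp_decay by blast
  show "\<exists>C. \<forall>t\<ge>0. (1 + t) ^ m * \<bar>cutoff t\<bar> \<le> C"
  proof (intro exI[of _ "max (2 ^ m) (exp 1 * C)"] allI impI)
    fix t :: real assume t: "0 \<le> t"
    show "(1 + t) ^ m * \<bar>cutoff t\<bar> \<le> max (2 ^ m) (exp 1 * C)"
    proof (cases "t \<le> 1")
      case True
      then have "(1 + t) ^ m \<le> 2 ^ m" using t by (intro power_mono) auto
      then show ?thesis using True by (simp add: cutoff_def)
    next
      case False
      have "(1 + t) ^ m * \<bar>cutoff t\<bar> \<le> (1 + t) ^ m * (exp 1 * exp (- t / exp 1))"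
        using cutoff_bounds[of t] t by (intro mult_left_mono) auto
      also have "\<dots> = exp 1 * ((1 + t) ^ m * (t powr 0 * exp (- t / exp 1)))" using False by simp
      also have "\<dots> \<le> exp 1 * C" using C[of t] False by (intro mult_left_mono) auto
      finally show ?thesis by simp
    qed
  qed
qed

text \<open>The bracket vanishes on t \<le> 1/4, so negative powers of t do no harm. In t = |xi|^2
  the factor 4 is a dilation of xi by 2, and a = -s/2 divides by |xi|^s.\<close>

definition band :: "real \<Rightarrow> real \<Rightarrow> real" where
  "band a t = (cutoff t - cutoff (4 * t)) * t powr a"

lemma band_eq_0: "t \<le> 1/4 \<Longrightarrow> band a t = 0"
  by (simp add: band_def cutoff_def)

text \<open>Differentiating t^a leads to the band with a - 1, differentiating the cutoffs leaves
  \<open>flat\<close> terms; hence the invariant family of multiples of a band plus a rapid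
  function.\<close>

lemma rapid_band: "rapid (band a)"
proof -
  let ?X = "{\<lambda>t. c * band a t + g t | c a g. rapid g}"
  show ?thesis
  proof (rule rapidI[where X = ?X])
    fix F assume "F \<in> ?X"
    then obtain c a g where F: "F = (\<lambda>t. c * band a t + g t)" and rapid: "rapid g" by blast
    obtain g' where g: "\<And>t. (g has_real_derivative g' t) (at t)" "rapid g'"
      using rapid by (blast elim: rapidE)
    \<comment> \<open>The part of the derivative in which the cutoffs are differentiated. In the
      terms at 4 t one writes t^a = 4^(-a) (4 t)^a, and the chain rule contributes another
      4.\<close>
    define E where "E t = (- 1) * flat a 0 1 t + ((- 1) * flat (a + 1) 2 1 t
       + ((4 * 4 powr (- a)) * flat a 0 1 (4 * t) + (4 * 4 powr (- a)) * flat (a + 1) 2 1 (4 * t)))" for t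
    have "rapid E"
      unfolding E_def by (intro rapid_add_cmult rapid_add rapid_scale rapid_flat) auto
    have d: "(band a has_real_derivative a * band (a - 1) t + E t) (at t)" for t
    proof (cases "t < 1/4")
      case True
      have "((\<lambda>_. 0) has_real_derivative 0) (at t)" by simp
      then have "(band a has_real_derivative 0) (at t)"
        by (rule has_field_derivative_transform_within_open[of _ _ _ "{..<1/4}"]) (use True in \<open>auto simp: band_eq_0\<close>)
      then show ?thesis using True by (simp add: E_def flat_def band_eq_0)
    next
      case False
      then have t: "0 < t" by simp
      have w: "((\<lambda>t. t powr a) has_real_derivative a * t powr (a - 1)) (at t)"
        using t by (intro has_real_derivative_powr) auto
      have c4: "((\<lambda>t. cutoff (4 * t)) has_real_derivative (- flat 0 0 1 (4 * t) - flat 1 2 1 (4 * t)) * 4) (at t)"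
        by (rule DERIV_chain2[OF cutoff_has_derivative]) (auto intro!: derivative_eq_intros)
      have f1: "flat 0 0 1 u * u powr a = flat a 0 1 u" "flat 1 2 1 u * u powr a = flat (a + 1) 2 1 u" for u
        by (auto simp: flat_def powr_add)
      have p4: "t powr a = 4 powr (- a) * (4 * t) powr a"
        using t by (simp add: powr_mult powr_minus field_simps)
      have "(band a has_real_derivative (cutoff t - cutoff (4 * t)) * (a * t powr (a - 1)) +
         ((- flat 0 0 1 t - flat 1 2 1 t) - (- flat 0 0 1 (4 * t) - flat 1 2 1 (4 * t)) * 4) * t powr a) (at t)"
        unfolding band_def[abs_def] by (intro DERIV_mult' DERIV_diff cutoff_has_derivative c4 w)
      moreover have "((- flat 0 0 1 t - flat 1 2 1 t) - (- flat 0 0 1 (4 * t) - flat 1 2 1 (4 * t)) * 4) * t powr a = E t"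
      proof -
        have "(- flat 0 0 1 t - flat 1 2 1 t) * t powr a = - flat a 0 1 t - flat (a + 1) 2 1 t"
          by (simp only: left_diff_distrib mult_minus_left f1)
        moreover have "(flat 0 0 1 (4 * t) + flat 1 2 1 (4 * t)) * t powr a = 4 powr (- a) * (flat a 0 1 (4 * t) + flat (a + 1) 2 1 (4 * t))"
          unfolding p4 f1[symmetric] by (simp add: algebra_simps)
        ultimately show ?thesis unfolding E_def by (simp add: algebra_simps)
      qed
      ultimately have "(band a has_real_derivative (cutoff t - cutoff (4 * t)) * (a * t powr (a - 1)) + E t) (at t)"
        by (simp only:)
      then show ?thesis by (rule DERIV_cong) (simp add: band_def)
    qed
    have "rapid (\<lambda>t. c * E t + g' t)" by (intro rapid_add_cmult \<open>rapid E\<close> g)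
    then have "(\<lambda>t. (c * a) * band (a - 1) t + (c * E t + g' t)) \<in> ?X"
      by (intro CollectI exI[of _ "c * a"] exI[of _ "a - 1"] exI[of _ "\<lambda>t. c * E t + g' t"] conjI refl)
    moreover have "(F has_real_derivative (c * a) * band (a - 1) t + (c * E t + g' t)) (at t)" for t
      unfolding F by (rule DERIV_cong[OF DERIV_add[OF DERIV_cmult[OF d] g(1)]]) (simp add: algebra_simps)
    ultimately show "\<exists>F'\<in>?X. \<forall>t. (F has_real_derivative F' t) (at t)" by (intro bexI allI)
    show "\<exists>C. \<forall>t\<ge>0. (1 + t) ^ m * \<bar>F t\<bar> \<le> C" for m
      unfolding F
    proof (rule decay_add[OF _ rapid_decay[OF rapid]])
      obtain C where C: "\<And>t::real. 1/4 \<le> t \<Longrightarrow> (1 + t) ^ m * (t powr a * exp (- t / exp 1)) \<le> C"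
        using powr_exp_decay by blast
      have C0: "0 \<le> C" using C[of 1] by (rule order_trans[rotated]) auto
      have "(1 + t) ^ m * \<bar>band a t\<bar> \<le> exp 1 * C" if "0 \<le> t" for t
      proof (cases "t \<le> 1/4")
        case False
        have "cutoff (4 * t) \<le> exp 1 * exp (- t / exp 1)"
        proof -
          have "exp (- (4 * t) / exp 1) \<le> exp (- t / exp (1::real))" using that by (simp add: divide_right_mono)
          then have "exp 1 * exp (- (4 * t) / exp 1) \<le> exp 1 * exp (- t / exp (1::real))" by (intro mult_left_mono) auto
          then show ?thesis using cutoff_bounds(2)[of "4 * t"] by linarith
        qed
        then have "\<bar>cutoff t - cutoff (4 * t)\<bar> \<le> exp 1 * exp (- t / exp 1)"
          using cutoff_bounds[of t] cutoff_bounds[of "4 * t"] by linarith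
        then have "(1 + t) ^ m * \<bar>band a t\<bar> \<le> (1 + t) ^ m * ((exp 1 * exp (- t / exp 1)) * t powr a)"
          unfolding band_def abs_mult using that by (intro mult_left_mono mult_mono) auto
        also have "\<dots> = exp 1 * ((1 + t) ^ m * (t powr a * exp (- t / exp 1)))" by simp
        also have "\<dots> \<le> exp 1 * C" using False by (intro mult_left_mono C) auto
        finally show ?thesis .
      qed (use C0 in \<open>simp add: band_eq_0\<close>)
      then show "\<exists>C. \<forall>t\<ge>0. (1 + t) ^ m * \<bar>band a t\<bar> \<le> C" by blast
    qed
  next
    show "band a \<in> ?X"
      by (intro CollectI exI[of _ 1] exI[of _ a] exI[of _ "\<lambda>t. 0"]) (simp add: rapid_zero)
  qed
qed

section \<open>Fourier transforms of Schwartz functions\<close>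

definition decays :: "('a::real_normed_vector \<Rightarrow> complex) \<Rightarrow> bool" where
  "decays f \<longleftrightarrow> (\<forall>k. \<exists>C. \<forall>x. (1 + norm x) ^ k * norm (f x) \<le> C)"

lemma decaysE:
  assumes "decays f"
  obtains C where "0 \<le> C" "\<And>x. norm (f x) \<le> C * (1 / (1 + norm x) ^ k)"
proof -
  obtain C where C: "\<And>x. (1 + norm x) ^ k * norm (f x) \<le> C"
    using assms unfolding decays_def by blast
  have p: "0 < (1 + norm x) ^ k" for x :: 'a by (intro zero_less_power add_pos_nonneg) auto
  have "0 \<le> C" using C[of 0] by (rule order_trans[rotated]) auto
  moreover have "norm (f x) \<le> C * (1 / (1 + norm x) ^ k)" for x
    using C[of x] p[of x] by (simp add: field_simps)
  ultimately show thesis by (rule that)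
qed

lemma decays_bounded: "decays f \<Longrightarrow> \<exists>C. \<forall>x. norm (f x) \<le> C"
  using decaysE[of f 0] by (metis div_by_1 mult.right_neutral power_0)

lemma decays_add:
  assumes "decays f" "decays g"
  shows "decays (\<lambda>x. f x + g x)"
  unfolding decays_def
proof
  fix k
  obtain C D where CD: "\<And>x. (1 + norm x) ^ k * norm (f x) \<le> C" "\<And>x. (1 + norm x) ^ k * norm (g x) \<le> D"
    using assms unfolding decays_def by metis
  have "(1 + norm x) ^ k * norm (f x + g x) \<le> C + D" for x
  proof -
    have "(1 + norm x) ^ k * norm (f x + g x) \<le> (1 + norm x) ^ k * (norm (f x) + norm (g x))"
      by (intro mult_left_mono norm_triangle_ineq) auto
    also have "\<dots> \<le> C + D" using CD[of x] by (simp add: distrib_left)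
    finally show ?thesis .
  qed
  then show "\<exists>C. \<forall>x. (1 + norm x) ^ k * norm (f x + g x) \<le> C" by blast
qed

text \<open>One order of growth of g is paid for by one order of decay of f; coordinates, characters
  and constants are thus all admissible factors.\<close>

lemma decays_mult:
  assumes "decays f" and g: "\<And>x. norm (g x) \<le> c * (1 + norm x)"
  shows "decays (\<lambda>x. g x * f x)"
  unfolding decays_def
proof
  fix k
  obtain C where C: "\<And>x. (1 + norm x) ^ Suc k * norm (f x) \<le> C"
    using assms unfolding decays_def by metis
  have "norm (g 0) \<le> c" using g[of 0] by simp
  then have c: "0 \<le> c" using norm_ge_zero[of "g 0"] by linarith
  have "(1 + norm x) ^ k * norm (g x * f x) \<le> c * C" for x
  proof -
    have "(1 + norm x) ^ k * norm (g x * f x) \<le> (1 + norm x) ^ k * (c * (1 + norm x) * norm (f x))"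
      unfolding norm_mult using g[of x] by (intro mult_left_mono mult_right_mono) auto
    also have "\<dots> = c * ((1 + norm x) ^ Suc k * norm (f x))" by (simp add: mult_ac)
    also have "\<dots> \<le> c * C" using c C[of x] by (intro mult_left_mono) auto
    finally show ?thesis .
  qed
  then show "\<exists>C. \<forall>x. (1 + norm x) ^ k * norm (g x * f x) \<le> C" by blast
qed

lemma decays_integrable:
  fixes f :: "'a::euclidean_space \<Rightarrow> complex"
  assumes "decays f" and [measurable]: "f \<in> borel_measurable borel"
  shows "integrable lborel f"
proof -
  obtain C where C: "0 \<le> C" "\<And>x. norm (f x) \<le> C * (1 / (1 + norm x) ^ (DIM('a) + 1))"
    using decaysE[OF assms(1)] by blast
  show ?thesis
  proof (rule Bochner_Integration.integrable_bound)
    show "integrable lborel (\<lambda>x::'a. C * (1 / (1 + norm x) ^ (DIM('a) + 1)))"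
      by (intro integrable_mult_right integrable_decay)
    show "AE x in lborel. norm (f x) \<le> norm (C * (1 / (1 + norm x) ^ (DIM('a) + 1)))"
      using C by (intro AE_I2 order_trans[OF C(2)]) (auto simp: abs_mult)
  qed simp
qed

lemma schwartz_decays: "f \<in> schwartz \<Longrightarrow> decays f"
  unfolding schwartz_def decays_def by (auto dest: spec[of _ "[]"])

lemma schwartz_continuous: "f \<in> schwartz \<Longrightarrow> continuous_on UNIV f"
proof -
  assume "f \<in> schwartz"
  then have "\<forall>x. partial_derivs [] f differentiable (at x)" unfolding schwartz_def smooth_def by blast
  then show ?thesis
    by (auto simp: continuous_on_eq_continuous_at intro: differentiable_imp_continuous_within)
qed

lemma schwartz_measurable: "f \<in> schwartz \<Longrightarrow> f \<in> borel_measurable borel"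
  by (intro borel_measurable_continuous_onI schwartz_continuous)

text \<open>A Frechet derivative with its coefficients named. \<open>frechet_derivative\<close> is
  informative only where f is differentiable; here differentiability is part of the statement, and
  the partials are functions that can be located in a given set.\<close>

definition has_partials ::
    "(real ^ 'n \<Rightarrow> complex) \<Rightarrow> ('n::finite \<Rightarrow> real ^ 'n \<Rightarrow> complex) \<Rightarrow> bool" where
  "has_partials f D \<longleftrightarrow>
    (\<forall>x. (f has_derivative (\<lambda>h. \<Sum>i\<in>UNIV. complex_of_real (h $ i) * D i x)) (at x))"

lemma has_partials_continuous: "has_partials f D \<Longrightarrow> continuous_on UNIV f"
  unfolding has_partials_def
  by (auto simp: continuous_on_eq_continuous_at intro: has_derivative_continuous)

text \<open>Every iterated partial derivative stays in \<open>X\<close> by induction on the list of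
  directions, so one level of differentiation and plain decay suffice.\<close>

lemma schwartz_coinduct:
  assumes "f \<in> X"
    and D: "\<And>f. f \<in> X \<Longrightarrow> \<exists>D. has_partials f D \<and> range D \<subseteq> X"
    and "\<And>f. f \<in> X \<Longrightarrow> decays f"
  shows "f \<in> schwartz"
proof -
  have "partial_derivs is f \<in> X" for "is"
  proof (induction "is")
    case (Cons i "is")
    then obtain D where D: "has_partials (partial_derivs is f) D" "range D \<subseteq> X" using assms(2) by blast
    have "frechet_derivative (partial_derivs is f) (at x) (axis i 1) = D i x" for x
    proof -
      have "frechet_derivative (partial_derivs is f) (at x) = (\<lambda>h. \<Sum>i\<in>UNIV. complex_of_real (h $ i) * D i x)"
        using D(1) unfolding has_partials_def by (intro frechet_derivative_at[symmetric]) auto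
      then show ?thesis by (simp add: axis_def if_distrib if_distribR sum.delta cong: if_cong)
    qed
    then have "partial_derivs (i # is) f = D i" by auto
    then show ?case using D(2) by auto
  qed (use assms in simp)
  then have "decays (partial_derivs is f)" "\<exists>D. has_partials (partial_derivs is f) D" for "is"
    using assms by blast+
  then show ?thesis
    unfolding schwartz_def smooth_def decays_def has_partials_def differentiable_def by blast
qed

text \<open>This span is closed under partial derivatives, so it suffices to study Fourier transforms on it
  instead of on all Schwartz functions.\<close>

inductive_set radial_span :: "(real ^ 'n::finite \<Rightarrow> complex) set" where
  radial: "rapid B \<Longrightarrow> (\<lambda>\<xi>. complex_of_real (B ((norm \<xi>)\<^sup>2))) \<in> radial_span"
| coordinate: "f \<in> radial_span \<Longrightarrow> (\<lambda>\<xi>. complex_of_real (\<xi> $ i) * f \<xi>) \<in> radial_span"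
| character: "f \<in> radial_span \<Longrightarrow> (\<lambda>\<xi>. cis (x \<bullet> \<xi>) * f \<xi>) \<in> radial_span"
| cmult: "f \<in> radial_span \<Longrightarrow> (\<lambda>\<xi>. c * f \<xi>) \<in> radial_span"
| add: "f \<in> radial_span \<Longrightarrow> g \<in> radial_span \<Longrightarrow> (\<lambda>\<xi>. f \<xi> + g \<xi>) \<in> radial_span"

text \<open>Profiles are taken in |xi|^2 because |xi| is not smooth at 0; the gradient is 2 xi times
  the differentiated profile, so only coordinate factors appear.\<close>

lemma has_partials_radial:
  assumes "\<And>t. (B has_real_derivative B' t) (at t)"
  shows "has_partials (\<lambda>\<xi>. complex_of_real (B ((norm \<xi>)\<^sup>2)))
    (\<lambda>i \<xi>. 2 * (complex_of_real (\<xi> $ i) * complex_of_real (B' ((norm \<xi>)\<^sup>2))))"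
  unfolding has_partials_def
proof
  fix x :: "real ^ 'n"
  have "((\<lambda>\<xi>. \<xi> \<bullet> \<xi>) has_derivative (\<lambda>h. x \<bullet> h + h \<bullet> x)) (at x)"
    by (auto intro!: derivative_eq_intros)
  moreover have "(B has_derivative (\<lambda>h. h * B' (x \<bullet> x))) (at (x \<bullet> x))"
    using assms[of "x \<bullet> x"] by (simp add: has_field_derivative_def mult_commute_abs)
  ultimately have "((\<lambda>\<xi>. B (\<xi> \<bullet> \<xi>)) has_derivative (\<lambda>h. (x \<bullet> h + h \<bullet> x) * B' (x \<bullet> x))) (at x)"
    by (rule has_derivative_compose)
  then have "((\<lambda>\<xi>. complex_of_real (B (\<xi> \<bullet> \<xi>))) has_derivative (\<lambda>h. complex_of_real ((x \<bullet> h + h \<bullet> x) * B' (x \<bullet> x)))) (at x)"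
    by (rule has_derivative_of_real)
  moreover have "(\<lambda>h. complex_of_real ((x \<bullet> h + h \<bullet> x) * B' (x \<bullet> x)))
    = (\<lambda>h. \<Sum>i\<in>UNIV. complex_of_real (h $ i) * (2 * (complex_of_real (x $ i) * complex_of_real (B' ((norm x)\<^sup>2)))))"
    by (auto simp: inner_vec_def power2_norm_eq_inner sum_distrib_right sum_distrib_left
        sum.distrib[symmetric] algebra_simps intro!: sum.cong)
  ultimately show "((\<lambda>\<xi>. complex_of_real (B ((norm \<xi>)\<^sup>2))) has_derivative
      (\<lambda>h. \<Sum>i\<in>UNIV. complex_of_real (h $ i) * (2 * (complex_of_real (x $ i) * complex_of_real (B' ((norm x)\<^sup>2)))))) (at x)"
    by (simp add: power2_norm_eq_inner)
qed

lemma has_partials_mult: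
  assumes "has_partials f D" "has_partials g E"
  shows "has_partials (\<lambda>x. g x * f x) (\<lambda>i x. g x * D i x + E i x * f x)"
  unfolding has_partials_def
proof
  fix x
  have "((\<lambda>x. g x * f x) has_derivative (\<lambda>h. g x * (\<Sum>i\<in>UNIV. complex_of_real (h $ i) * D i x)
     + (\<Sum>i\<in>UNIV. complex_of_real (h $ i) * E i x) * f x)) (at x)"
    using assms unfolding has_partials_def by (intro has_derivative_mult) auto
  then show "((\<lambda>x. g x * f x) has_derivative (\<lambda>h. \<Sum>i\<in>UNIV. complex_of_real (h $ i) * (g x * D i x + E i x * f x))) (at x)"
    by (simp add: sum_distrib_left sum_distrib_right sum.distrib algebra_simps)
qed

lemma has_partials_coordinate: "has_partials (\<lambda>\<xi>. complex_of_real (\<xi> $ i)) (\<lambda>j \<xi>. if j = i then 1 else 0)"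
  unfolding has_partials_def
proof
  fix x
  have "((\<lambda>\<xi>. complex_of_real (\<xi> $ i)) has_derivative (\<lambda>h. complex_of_real (h $ i))) (at x)"
    by (rule has_derivative_of_real[OF bounded_linear_imp_has_derivative[OF bounded_linear_vec_nth]])
  then show "((\<lambda>\<xi>. complex_of_real (\<xi> $ i)) has_derivative
      (\<lambda>h. \<Sum>j\<in>UNIV. complex_of_real (h $ j) * (if j = i then 1 else 0))) (at x)"
    by (simp add: if_distrib sum.delta cong: if_cong)
qed

lemma has_partials_character:
  fixes x :: "real ^ 'n"
  shows "has_partials (\<lambda>\<xi>. cis (x \<bullet> \<xi>)) (\<lambda>j \<xi>. (\<i> * complex_of_real (x $ j)) * cis (x \<bullet> \<xi>))"
  unfolding has_partials_def cis_conv_exp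
proof
  fix \<xi> :: "real ^ 'n"
  have "((\<lambda>\<xi>. \<i> * complex_of_real (x \<bullet> \<xi>)) has_derivative (\<lambda>h. \<i> * complex_of_real (x \<bullet> h))) (at \<xi>)"
    by (auto intro!: derivative_eq_intros)
  moreover have "(exp has_derivative (\<lambda>h. h * exp (\<i> * complex_of_real (x \<bullet> \<xi>)))) (at (\<i> * complex_of_real (x \<bullet> \<xi>)))"
    using DERIV_exp[of "\<i> * complex_of_real (x \<bullet> \<xi>)"] by (simp add: has_field_derivative_def mult_commute_abs)
  ultimately have "((\<lambda>\<xi>. exp (\<i> * complex_of_real (x \<bullet> \<xi>))) has_derivative (\<lambda>h. (\<i> * complex_of_real (x \<bullet> h)) * exp (\<i> * complex_of_real (x \<bullet> \<xi>)))) (at \<xi>)"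
    by (rule has_derivative_compose)
  then show "((\<lambda>\<xi>. exp (\<i> * complex_of_real (x \<bullet> \<xi>))) has_derivative (\<lambda>h. \<Sum>i\<in>UNIV. complex_of_real (h $ i)
      * (\<i> * complex_of_real (x $ i) * exp (\<i> * complex_of_real (x \<bullet> \<xi>))))) (at \<xi>)"
    by (simp add: inner_vec_def sum_distrib_left sum_distrib_right mult_ac)
qed

lemma radial_span_partials:
  "f \<in> radial_span \<Longrightarrow> \<exists>D. has_partials f D \<and> range D \<subseteq> radial_span"
proof (induction rule: radial_span.induct)
  case (radial B)
  then obtain B' where B': "\<And>t. (B has_real_derivative B' t) (at t)" "rapid B'" by (blast elim: rapidE)
  show ?case using B'(2)
    by (rule_tac exI, rule_tac conjI, rule_tac has_partials_radial[OF B'(1)])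
      (auto intro!: radial_span.cmult radial_span.coordinate radial_span.radial)
next
  case (coordinate f i)
  then obtain D where D: "has_partials f D" "range D \<subseteq> radial_span" by blast
  show ?case using D(2) coordinate(1)
    by (rule_tac exI, rule_tac conjI, rule_tac has_partials_mult[OF D(1) has_partials_coordinate])
      (auto intro!: radial_span.add radial_span.coordinate radial_span.cmult)
next
  case (character f x)
  then obtain D where D: "has_partials f D" "range D \<subseteq> radial_span" by blast
  show ?case using D(2) character(1)
    by (rule_tac exI, rule_tac conjI, rule_tac has_partials_mult[OF D(1) has_partials_character])
      (auto simp: mult.assoc intro!: radial_span.add radial_span.character radial_span.cmult[of _ "\<i>"] radial_span.cmult[of _ "complex_of_real (x $ _)"])
next
  case (cmult f c)
  then obtain D where D: "has_partials f D" "range D \<subseteq> radial_span" by blast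
  have c: "has_partials (\<lambda>_. c) (\<lambda>_ _. 0)" unfolding has_partials_def by simp
  show ?case using D(2) has_partials_mult[OF D(1) c]
    by (intro exI[of _ "\<lambda>i x. c * D i x"]) (auto intro!: radial_span.cmult)
next
  case (add f g)
  then obtain D E where D: "has_partials f D" "range D \<subseteq> radial_span" "has_partials g E" "range E \<subseteq> radial_span" by blast
  have "has_partials (\<lambda>x. f x + g x) (\<lambda>i x. D i x + E i x)"
    using D(1,3) unfolding has_partials_def
    by (auto simp: distrib_left sum.distrib intro!: has_derivative_add)
  then show ?case using D(2,4) by (intro exI[of _ "\<lambda>i x. D i x + E i x"]) (auto intro!: radial_span.add)
qed

lemma radial_span_decays:
  fixes f :: "real ^ 'n \<Rightarrow> complex"
  shows "f \<in> radial_span \<Longrightarrow> decays f"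
proof (induction rule: radial_span.induct)
  case (radial B)
  show ?case unfolding decays_def
  proof
    fix k
    obtain C where C: "\<And>t. t \<ge> 0 \<Longrightarrow> (1 + t) ^ k * \<bar>B t\<bar> \<le> C" using rapid_decay[OF radial] by blast
    have "(1 + norm x) ^ k * norm (complex_of_real (B ((norm x)\<^sup>2))) \<le> 2 ^ k * C" for x :: "real ^ 'n"
    proof -
      have "1 + norm x \<le> 2 * (1 + (norm x)\<^sup>2)"
        using sum_squares_ge_zero[of "norm x - 1" "norm x"] zero_le_power2[of "norm x - 1"] zero_le_power2[of "norm x"] norm_ge_zero[of x]
        by (simp add: power2_eq_square algebra_simps; linarith)
      then have "(1 + norm x) ^ k \<le> (2 * (1 + (norm x)\<^sup>2)) ^ k" by (intro power_mono) auto
      then have "(1 + norm x) ^ k * \<bar>B ((norm x)\<^sup>2)\<bar> \<le> (2 * (1 + (norm x)\<^sup>2)) ^ k * \<bar>B ((norm x)\<^sup>2)\<bar>"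
        by (intro mult_right_mono) auto
      also have "\<dots> = 2 ^ k * ((1 + (norm x)\<^sup>2) ^ k * \<bar>B ((norm x)\<^sup>2)\<bar>)" by (simp only: power_mult_distrib mult.assoc)
      also have "\<dots> \<le> 2 ^ k * C" using C[of "(norm x)\<^sup>2"] by (intro mult_left_mono) auto
      finally show ?thesis by simp
    qed
    then show "\<exists>C. \<forall>x::real ^ 'n. (1 + norm x) ^ k * norm (complex_of_real (B ((norm x)\<^sup>2))) \<le> C" by blast
  qed
next
  case (coordinate f i)
  have "norm (complex_of_real (x $ i)) \<le> 1 * (1 + norm x)" for x :: "real ^ 'n"
    using component_le_norm_cart[of x i] by simp
  then show ?case by (rule decays_mult[OF coordinate.IH])
next
  case (character f x)
  have "norm (cis (x \<bullet> \<xi>)) \<le> 1 * (1 + norm \<xi>)" for \<xi> :: "real ^ 'n" by simp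
  then show ?case by (rule decays_mult[OF character.IH])
next
  case (cmult f c)
  have "norm c \<le> norm c * (1 + norm \<xi>)" for \<xi> :: "real ^ 'n" by (simp add: distrib_left)
  then show ?case by (rule decays_mult[OF cmult.IH])
qed (auto intro: decays_add)

lemma radial_span_continuous: "f \<in> radial_span \<Longrightarrow> continuous_on UNIV f"
  using radial_span_partials has_partials_continuous by blast

lemma radial_span_measurable: "f \<in> radial_span \<Longrightarrow> f \<in> borel_measurable borel"
  by (intro borel_measurable_continuous_onI radial_span_continuous)

lemma radial_span_integrable: "f \<in> radial_span \<Longrightarrow> integrable lborel f"
  by (intro decays_integrable radial_span_decays radial_span_measurable)

lemma radial_span_schwartz: "f \<in> radial_span \<Longrightarrow> f \<in> schwartz"
  by (rule schwartz_coinduct[OF _ radial_span_partials radial_span_decays])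

section \<open>The Fourier transform on the radial span\<close>

lemma measurable_cis [measurable]: "cis \<in> borel_measurable borel"
  unfolding cis_conv_exp[abs_def] by measurable

lemma fourier_lborel:
  fixes f :: "real ^ 'n \<Rightarrow> complex"
  assumes [measurable]: "f \<in> borel_measurable borel"
  shows "fourier f \<xi> = (LINT x|lborel. cis (- (x \<bullet> \<xi>)) * f x)"
  unfolding fourier_def by (rule integral_completion) simp

lemma integrable_character_mult:
  fixes f :: "real ^ 'n \<Rightarrow> complex"
  assumes "integrable lborel f"
  shows "integrable lborel (\<lambda>x. cis (- (x \<bullet> \<xi>)) * f x)"
proof (rule Bochner_Integration.integrable_bound[OF assms])
  have [measurable]: "f \<in> borel_measurable borel" using borel_measurable_integrable[OF assms] by simp
  show "(\<lambda>x. cis (- (x \<bullet> \<xi>)) * f x) \<in> borel_measurable lborel" by simp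
qed (simp add: norm_mult)

lemma norm_fourier_le:
  fixes f :: "real ^ 'n \<Rightarrow> complex"
  assumes "integrable lborel f"
  shows "norm (fourier f \<xi>) \<le> (LINT x|lborel. norm (f x))"
proof -
  have [measurable]: "f \<in> borel_measurable borel" using borel_measurable_integrable[OF assms] by simp
  have "norm (fourier f \<xi>) \<le> (LINT x|lborel. norm (cis (- (x \<bullet> \<xi>)) * f x))"
    unfolding fourier_lborel[OF \<open>f \<in> borel_measurable borel\<close>] by (rule integral_norm_bound)
  then show ?thesis by (simp add: norm_mult)
qed

lemma has_derivative_quadratic:
  fixes f :: "'a::real_normed_vector \<Rightarrow> 'b::real_normed_vector"
  assumes "bounded_linear L" and le: "\<And>h. norm (f (x + h) - f x - L h) \<le> C * (norm h)\<^sup>2"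
  shows "(f has_derivative L) (at x)"
  unfolding has_derivative_at
proof (rule conjI[OF assms(1)], rule Lim_null_comparison)
  show "\<forall>\<^sub>F h in at 0. norm (norm (f (x + h) - f x - L h) / norm h) \<le> C * norm h"
    unfolding eventually_at
  proof (intro exI[of _ 1] conjI ballI impI)
    fix h :: 'a assume "h \<noteq> 0 \<and> dist h 0 < 1"
    then have h: "0 < norm h" by simp
    have "norm (f (x + h) - f x - L h) \<le> C * norm h * norm h"
      using le[of h] unfolding power2_eq_square mult.assoc .
    then show "norm (norm (f (x + h) - f x - L h) / norm h) \<le> C * norm h"
      using h by (simp only: real_norm_def abs_divide abs_norm_cancel pos_divide_le_eq)
  qed simp
  show "((\<lambda>h. C * norm h) \<longlongrightarrow> 0) (at 0)" by (auto intro!: tendsto_eq_intros)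
qed

lemma norm_cis_taylor: "norm (cis t - 1 - \<i> * complex_of_real t) \<le> t\<^sup>2"
proof -
  have "norm (iexp t - (\<Sum>k\<le>Suc 0. (\<i> * complex_of_real t) ^ k / fact k)) \<le> \<bar>t\<bar> ^ Suc (Suc 0) / fact (Suc (Suc 0))"
    by (rule iexp_approx1)
  also have "iexp t - (\<Sum>k\<le>Suc 0. (\<i> * complex_of_real t) ^ k / fact k) = cis t - 1 - \<i> * complex_of_real t"
    by (simp only: cis_conv_exp) simp
  also have "\<bar>t\<bar> ^ Suc (Suc 0) / fact (Suc (Suc 0)) = t\<^sup>2 / 2"
    by (simp add: power2_eq_square)
  finally have "norm (cis t - 1 - \<i> * complex_of_real t) \<le> t\<^sup>2 / 2" .
  then show ?thesis using zero_le_power2[of t] by linarith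
qed

text \<open>The remainder of the character, |e^(it) - 1 - it| \<le> t^2, is integrated against f,
  whose second moment is finite by decay. The transform thus has a remainder O(|h|^2), and no
  exchange of limit and integral is involved.\<close>

lemma fourier_has_partials:
  fixes f :: "real ^ 'n \<Rightarrow> complex"
  assumes f: "f \<in> radial_span"
  shows "has_partials (fourier f) (\<lambda>i. fourier (\<lambda>\<xi>. - \<i> * (complex_of_real (\<xi> $ i) * f \<xi>)))"
  unfolding has_partials_def
proof
  fix x :: "real ^ 'n"
  define w where "w i = (\<lambda>\<xi>. - \<i> * (complex_of_real (\<xi> $ i) * f \<xi>))" for i
  have w: "w i \<in> radial_span" for i unfolding w_def by (intro radial_span.cmult radial_span.coordinate f)
  note [measurable] = radial_span_measurable[OF f] radial_span_measurable[OF w]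
  have "decays (\<lambda>\<xi>. (complex_of_real (norm \<xi>) * (complex_of_real (norm \<xi>) * f \<xi>)))"
    by (rule decays_mult[OF decays_mult[OF radial_span_decays[OF f], where c = 1], where c = 1]) auto
  then have i2: "integrable lborel (\<lambda>\<xi>. (complex_of_real (norm \<xi>) * (complex_of_real (norm \<xi>) * f \<xi>)))"
    by (rule decays_integrable) measurable
  then have i3: "integrable lborel (\<lambda>\<xi>. (norm \<xi>)\<^sup>2 * norm (f \<xi>))"
    by (drule_tac integrable_norm) (simp add: norm_mult power2_eq_square mult.assoc)
  define C where "C = (LINT \<xi>|lborel. (norm \<xi>)\<^sup>2 * norm (f \<xi>))"
  let ?L = "\<lambda>h. \<Sum>i\<in>UNIV. complex_of_real (h $ i) * fourier (w i) x"
  have "(fourier f has_derivative ?L) (at x)"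
  proof (rule has_derivative_quadratic[where C = C])
    show "bounded_linear ?L"
      by (intro bounded_linear_sum bounded_linear_mult_const bounded_linear_compose[OF bounded_linear_of_real] bounded_linear_vec_nth)
    fix h :: "real ^ 'n"
    have I: "integrable lborel (\<lambda>\<xi>. cis (- (\<xi> \<bullet> y)) * f \<xi>)" "integrable lborel (\<lambda>\<xi>. cis (- (\<xi> \<bullet> y)) * w i \<xi>)" for y i
      by (intro integrable_character_mult radial_span_integrable f w)+
    have Iw: "integrable lborel (\<lambda>\<xi>. complex_of_real (h $ i) * (cis (- (\<xi> \<bullet> x)) * w i \<xi>))" for i
      by (intro integrable_mult_right I)
    have "fourier f (x + h) - fourier f x - ?L h
      = (LINT \<xi>|lborel. cis (- (\<xi> \<bullet> (x + h))) * f \<xi> - cis (- (\<xi> \<bullet> x)) * f \<xi>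
           - (\<Sum>i\<in>UNIV. complex_of_real (h $ i) * (cis (- (\<xi> \<bullet> x)) * w i \<xi>)))"
      by (simp add: fourier_lborel I Iw)
    also have "(\<lambda>\<xi>. cis (- (\<xi> \<bullet> (x + h))) * f \<xi> - cis (- (\<xi> \<bullet> x)) * f \<xi>
           - (\<Sum>i\<in>UNIV. complex_of_real (h $ i) * (cis (- (\<xi> \<bullet> x)) * w i \<xi>)))
       = (\<lambda>\<xi>. cis (- (\<xi> \<bullet> x)) * f \<xi> * (cis (- (\<xi> \<bullet> h)) - 1 - \<i> * complex_of_real (- (\<xi> \<bullet> h))))"
    proof
      fix \<xi>
      have "(\<Sum>i\<in>UNIV. complex_of_real (h $ i) * (cis (- (\<xi> \<bullet> x)) * w i \<xi>))
        = cis (- (\<xi> \<bullet> x)) * f \<xi> * (\<i> * complex_of_real (- (\<xi> \<bullet> h)))"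
        unfolding w_def by (simp add: inner_vec_def sum_distrib_left sum_negf mult_ac)
      moreover have "cis (- (\<xi> \<bullet> (x + h))) = cis (- (\<xi> \<bullet> x)) * cis (- (\<xi> \<bullet> h))"
        by (simp add: cis_mult inner_add_right)
      ultimately show "cis (- (\<xi> \<bullet> (x + h))) * f \<xi> - cis (- (\<xi> \<bullet> x)) * f \<xi>
           - (\<Sum>i\<in>UNIV. complex_of_real (h $ i) * (cis (- (\<xi> \<bullet> x)) * w i \<xi>))
         = cis (- (\<xi> \<bullet> x)) * f \<xi> * (cis (- (\<xi> \<bullet> h)) - 1 - \<i> * complex_of_real (- (\<xi> \<bullet> h)))"
        by (simp add: algebra_simps)
    qed
    finally have eq: "fourier f (x + h) - fourier f x - ?L h
       = (LINT \<xi>|lborel. cis (- (\<xi> \<bullet> x)) * f \<xi> * (cis (- (\<xi> \<bullet> h)) - 1 - \<i> * complex_of_real (- (\<xi> \<bullet> h))))" .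
    have "norm (fourier f (x + h) - fourier f x - ?L h) \<le> (LINT \<xi>|lborel. (norm h)\<^sup>2 * ((norm \<xi>)\<^sup>2 * norm (f \<xi>)))"
      unfolding eq
    proof (rule order_trans[OF integral_norm_bound integral_mono[OF integrable_norm integrable_mult_right[OF i3]]])
      have le: "norm (cis (- (\<xi> \<bullet> x)) * f \<xi> * (cis (- (\<xi> \<bullet> h)) - 1 - \<i> * complex_of_real (- (\<xi> \<bullet> h))))
         \<le> (norm h)\<^sup>2 * ((norm \<xi>)\<^sup>2 * norm (f \<xi>))" for \<xi>
      proof -
        have "(\<xi> \<bullet> h)\<^sup>2 \<le> (norm \<xi> * norm h)\<^sup>2"
          using Cauchy_Schwarz_ineq2[of \<xi> h] by (rule abs_le_square_iff[THEN iffD1, OF order_trans]) (simp add: abs_mult)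
        then have "norm (cis (- (\<xi> \<bullet> h)) - 1 - \<i> * complex_of_real (- (\<xi> \<bullet> h))) \<le> (norm \<xi> * norm h)\<^sup>2"
          using norm_cis_taylor[of "- (\<xi> \<bullet> h)"] by simp
        then have "norm (f \<xi>) * norm (cis (- (\<xi> \<bullet> h)) - 1 - \<i> * complex_of_real (- (\<xi> \<bullet> h))) \<le> norm (f \<xi>) * (norm \<xi> * norm h)\<^sup>2"
          by (intro mult_left_mono) auto
        then show ?thesis by (simp add: norm_mult power_mult_distrib mult_ac)
      qed
      show "norm (cis (- (\<xi> \<bullet> x)) * f \<xi> * (cis (- (\<xi> \<bullet> h)) - 1 - \<i> * complex_of_real (- (\<xi> \<bullet> h))))
         \<le> (norm h)\<^sup>2 * ((norm \<xi>)\<^sup>2 * norm (f \<xi>))" for \<xi> by (rule le)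
      show "integrable lborel (\<lambda>\<xi>. cis (- (\<xi> \<bullet> x)) * f \<xi> * (cis (- (\<xi> \<bullet> h)) - 1 - \<i> * complex_of_real (- (\<xi> \<bullet> h))))"
      proof (rule Bochner_Integration.integrable_bound[OF integrable_mult_right[OF i3, of "(norm h)\<^sup>2"]])
        show "AE \<xi> in lborel. norm (cis (- (\<xi> \<bullet> x)) * f \<xi> * (cis (- (\<xi> \<bullet> h)) - 1 - \<i> * complex_of_real (- (\<xi> \<bullet> h))))
            \<le> norm ((norm h)\<^sup>2 * ((norm \<xi>)\<^sup>2 * norm (f \<xi>)))"
          by (rule AE_I2, rule order_trans[OF le]) simp
      qed measurable
    qed
    also have "\<dots> = C * (norm h)\<^sup>2" unfolding C_def by simp
    finally show "norm (fourier f (x + h) - fourier f x - ?L h) \<le> C * (norm h)\<^sup>2" .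
  qed
  then show "(fourier f has_derivative (\<lambda>h. \<Sum>i\<in>UNIV. complex_of_real (h $ i)
      * fourier (\<lambda>\<xi>. - \<i> * (complex_of_real (\<xi> $ i) * f \<xi>)) x)) (at x)"
    unfolding w_def .
qed

text \<open>The difference quotients in direction i have integral 0 by translation invariance, and
  they converge dominatedly to the partial derivative. This is the integration by parts behind
  \<open>fourier_partial\<close>.\<close>

lemma integral_partial_eq_0:
  fixes g :: "real ^ 'n \<Rightarrow> complex"
  assumes g: "g \<in> radial_span" and D: "has_partials g D" and Di: "D i \<in> radial_span"
  shows "(LINT x|lborel. D i x) = 0"
proof -
  let ?e = "axis i 1 :: real ^ 'n"
  let ?n = "DIM(real ^ 'n) + 1"
  note [measurable] = radial_span_measurable[OF g] radial_span_measurable[OF Di]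
  have vd: "((\<lambda>t. g (x + t *\<^sub>R ?e)) has_vector_derivative D i (x + t *\<^sub>R ?e)) (at t)" for x t
  proof -
    have "((\<lambda>t. x + t *\<^sub>R ?e) has_derivative (\<lambda>h. h *\<^sub>R ?e)) (at t)"
      by (auto intro!: derivative_eq_intros)
    from has_derivative_compose[OF this] D
    have "((\<lambda>t. g (x + t *\<^sub>R ?e)) has_derivative (\<lambda>h. \<Sum>j\<in>UNIV. complex_of_real ((h *\<^sub>R ?e) $ j) * D j (x + t *\<^sub>R ?e))) (at t)"
      unfolding has_partials_def by fastforce
    moreover have "(\<Sum>j\<in>UNIV. complex_of_real ((h *\<^sub>R ?e) $ j) * D j (x + t *\<^sub>R ?e)) = h *\<^sub>R D i (x + t *\<^sub>R ?e)" for h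
    proof -
      have e: "(h *\<^sub>R ?e) $ j = (if j = i then h else 0)" for j by (simp add: axis_def)
      show ?thesis unfolding e by (simp add: if_distrib if_distribR sum.delta scaleR_conv_of_real cong: if_cong)
    qed
    ultimately show ?thesis unfolding has_vector_derivative_def by simp
  qed
  obtain B where B: "0 \<le> B" "\<And>x. norm (D i x) \<le> B * (1 / (1 + norm x) ^ ?n)"
    using decaysE[OF radial_span_decays[OF Di]] by blast
  define s where "s m x = of_nat (Suc m) * (g (x + (1 / real (Suc m)) *\<^sub>R ?e) - g x)" for m x
  have lim: "(\<lambda>m. LINT x|lborel. s m x) \<longlonglongrightarrow> (LINT x|lborel. D i x)"
  \<comment> \<open>A shift by at most 1 changes 1 + |x| by at most a factor 2, hence the 2^(n+1) in
    the dominating function.\<close>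
  proof (rule integral_dominated_convergence[where w = "\<lambda>x. B * 2 ^ ?n * (1 / (1 + norm x) ^ ?n)"])
    show "integrable lborel (\<lambda>x::real ^ 'n. B * 2 ^ ?n * (1 / (1 + norm x) ^ ?n))"
      by (intro integrable_mult_right integrable_decay)
    show "AE x in lborel. (\<lambda>m. s m x) \<longlonglongrightarrow> D i x"
    proof (intro AE_I2)
      fix x
      have vd0: "((\<lambda>t. g (x + t *\<^sub>R ?e)) has_vector_derivative D i x) (at 0)" using vd[of x 0] by simp
      have "((\<lambda>t. (g (x + t *\<^sub>R ?e) - g x) /\<^sub>R t - D i x) \<longlongrightarrow> 0) (at 0)"
      proof (rule Lim_null_comparison[rotated])
        show "((\<lambda>t. norm (g (x + (0 + t) *\<^sub>R ?e) - g (x + 0 *\<^sub>R ?e) - t *\<^sub>R D i x) / norm t) \<longlongrightarrow> 0) (at 0)"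
          using vd0 unfolding has_vector_derivative_def has_derivative_at by blast
        show "\<forall>\<^sub>F t in at 0. norm ((g (x + t *\<^sub>R ?e) - g x) /\<^sub>R t - D i x)
            \<le> norm (g (x + (0 + t) *\<^sub>R ?e) - g (x + 0 *\<^sub>R ?e) - t *\<^sub>R D i x) / norm t"
        proof (rule eventually_mono[OF eventually_neq_at_within[of 0]])
          fix t :: real assume "t \<noteq> 0"
          then have "(g (x + t *\<^sub>R ?e) - g x) /\<^sub>R t - D i x = (g (x + t *\<^sub>R ?e) - g x - t *\<^sub>R D i x) /\<^sub>R t"
            by (simp add: scaleR_diff_right)
          then show "norm ((g (x + t *\<^sub>R ?e) - g x) /\<^sub>R t - D i x)
            \<le> norm (g (x + (0 + t) *\<^sub>R ?e) - g (x + 0 *\<^sub>R ?e) - t *\<^sub>R D i x) / norm t"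
            by (simp add: divide_inverse mult.commute)
        qed
      qed
      then have "((\<lambda>t. (g (x + t *\<^sub>R ?e) - g x) /\<^sub>R t) \<longlongrightarrow> D i x) (at 0)"
        by (rule LIM_zero_cancel)
      moreover have "filterlim (\<lambda>m. 1 / real (Suc m)) (at 0) sequentially"
        unfolding filterlim_at using LIMSEQ_inverse_real_of_nat by (auto simp: inverse_eq_divide)
      ultimately have "(\<lambda>m. (g (x + (1 / real (Suc m)) *\<^sub>R ?e) - g x) /\<^sub>R (1 / real (Suc m))) \<longlonglongrightarrow> D i x"
        by (rule filterlim_compose)
      then show "(\<lambda>m. s m x) \<longlonglongrightarrow> D i x"
        by (simp add: s_def scaleR_conv_of_real)
    qed
    fix m
    show "AE x in lborel. norm (s m x) \<le> B * 2 ^ ?n * (1 / (1 + norm x) ^ ?n)"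
    proof (intro AE_I2)
      fix x :: "real ^ 'n"
      define h where "h = 1 / real (Suc m)"
      have h: "0 < h" "h \<le> 1" unfolding h_def by auto
      have le: "norm (D i (x + t *\<^sub>R ?e)) \<le> B * 2 ^ ?n * (1 / (1 + norm x) ^ ?n)" if t: "0 < t" "t < h" for t
      proof -
        have "norm x \<le> norm (x + t *\<^sub>R ?e) + norm (t *\<^sub>R ?e)" using norm_triangle_ineq4[of "x + t *\<^sub>R ?e" "t *\<^sub>R ?e"] by simp
        then have "(1 + norm x) / 2 \<le> 1 + norm (x + t *\<^sub>R ?e)" 
          using t h norm_ge_zero[of "x + t *\<^sub>R ?e"] by (simp, linarith)
        then have "((1 + norm x) / 2) ^ ?n \<le> (1 + norm (x + t *\<^sub>R ?e)) ^ ?n" by (intro power_mono) auto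
        then have "1 / (1 + norm (x + t *\<^sub>R ?e)) ^ ?n \<le> 1 / ((1 + norm x) / 2) ^ ?n"
          by (intro divide_left_mono mult_pos_pos zero_less_power) (auto intro: add_pos_nonneg)
        also have "\<dots> = 2 ^ ?n * (1 / (1 + norm x) ^ ?n)" by (simp add: power_divide del: power_Suc)
        finally have "B * (1 / (1 + norm (x + t *\<^sub>R ?e)) ^ ?n) \<le> B * (2 ^ ?n * (1 / (1 + norm x) ^ ?n))"
          using B(1) by (intro mult_left_mono)
        then show ?thesis using B(2)[of "x + t *\<^sub>R ?e"] by (simp only: mult.assoc)
      qed
      define b where "b = B * 2 ^ ?n * (1 / (1 + norm x) ^ ?n)"
      have "norm (g (x + h *\<^sub>R ?e) - g (x + 0 *\<^sub>R ?e)) \<le> b * h - b * 0"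
        using h(1)
      proof (rule differentiable_bound_general)
        show "continuous_on {0..h} (\<lambda>t. g (x + t *\<^sub>R ?e))"
          using vd by (auto intro!: continuous_at_imp_continuous_on has_vector_derivative_continuous)
        show "((\<lambda>t. b * t) has_vector_derivative b) (at t)" for t
          by (auto intro!: derivative_eq_intros simp: has_real_derivative_iff_has_vector_derivative[symmetric])
        show "((\<lambda>t. g (x + t *\<^sub>R ?e)) has_vector_derivative D i (x + t *\<^sub>R ?e)) (at t)" for t by (rule vd)
      qed (auto intro!: continuous_intros le[folded b_def])
      then have "real (Suc m) * norm (g (x + h *\<^sub>R ?e) - g x) \<le> real (Suc m) * (b * h)"
        by (intro mult_left_mono) auto
      then have "norm (s m x) \<le> b"
        unfolding s_def norm_mult norm_of_nat h_def[symmetric] by (simp add: h_def)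
      then show "norm (s m x) \<le> B * 2 ^ ?n * (1 / (1 + norm x) ^ ?n)" unfolding b_def .
    qed
  qed (auto simp: s_def)
  have "(LINT x|lborel. s m x) = 0" for m
  proof -
    define a where "a = (1 / real (Suc m)) *\<^sub>R ?e"
    have I: "integrable lborel g" by (rule radial_span_integrable[OF g])
    have I': "integrable lborel (\<lambda>x. g (x + a))"
    proof -
      have "integrable (distr lborel borel ((+) a)) g" using I by (simp only: lborel_distr_plus)
      then show ?thesis by (subst (asm) integrable_distr_eq) (auto simp: add.commute)
    qed
    have "(LINT x|lborel. g (x + a)) = (LINT x|distr lborel borel ((+) a). g x)"
      by (subst integral_distr) (auto simp: add.commute)
    also have "\<dots> = (LINT x|lborel. g x)" by (simp only: lborel_distr_plus)
    finally show ?thesis unfolding s_def a_def[symmetric] using I I' by simp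
  qed
  with lim show ?thesis by (simp add: LIMSEQ_const_iff)
qed

text \<open>The vanishing integral is that of the i-th partial of the modulated function e^(-i x.xi)
  f(xi), which has two terms by the product rule.\<close>

lemma fourier_partial:
  assumes f: "f \<in> radial_span" and D: "has_partials f D" and Di: "D i \<in> radial_span"
  shows "fourier (D i) x = \<i> * complex_of_real (x $ i) * fourier f x"
proof -
  note [measurable] = radial_span_measurable[OF f] radial_span_measurable[OF Di]
  let ?D = "\<lambda>i \<xi>. cis (- x \<bullet> \<xi>) * D i \<xi> + (\<i> * complex_of_real ((- x) $ i)) * cis (- x \<bullet> \<xi>) * f \<xi>"
  have "?D i \<in> radial_span"
    unfolding mult.assoc[of "\<i> * complex_of_real ((- x) $ i)"]
    by (intro radial_span.add radial_span.cmult radial_span.character f Di)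
  with f have "(LINT \<xi>|lborel. ?D i \<xi>) = 0"
    by (intro integral_partial_eq_0[of "\<lambda>\<xi>. cis (- x \<bullet> \<xi>) * f \<xi>" ?D] radial_span.character has_partials_mult[OF D has_partials_character])
  moreover have "integrable lborel (\<lambda>\<xi>. cis (- x \<bullet> \<xi>) * D i \<xi>)" "integrable lborel (\<lambda>\<xi>. cis (- x \<bullet> \<xi>) * f \<xi>)"
    by (intro radial_span_integrable radial_span.character f Di)+
  ultimately have "(LINT \<xi>|lborel. cis (- x \<bullet> \<xi>) * D i \<xi>) = \<i> * complex_of_real (x $ i) * (LINT \<xi>|lborel. cis (- x \<bullet> \<xi>) * f \<xi>)"
    by (simp add: mult.assoc)
  then show ?thesis by (simp add: fourier_lborel inner_commute)
qed

text \<open>|x| is at most the sum of the |x_i|, and x_i times the transform of f is, up to a unit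
  factor, the transform of a partial of f, again in the span. Hence the induction on k with f
  arbitrary.\<close>

lemma fourier_decays:
  assumes "f \<in> radial_span"
  shows "decays (fourier f)"
  unfolding decays_def
proof
  fix k
  show "\<exists>C. \<forall>x. (1 + norm x) ^ k * norm (fourier f x) \<le> C"
    using assms
  proof (induction k arbitrary: f)
    case 0
    then show ?case using norm_fourier_le[OF radial_span_integrable[OF 0]] by auto
  next
    case (Suc k)
    obtain D where D: "has_partials f D" "range D \<subseteq> radial_span" using radial_span_partials[OF Suc(2)] by blast
    have Di: "D i \<in> radial_span" for i using D(2) by blast
    obtain C where C: "\<And>x. (1 + norm x) ^ k * norm (fourier f x) \<le> C" using Suc by blast
    obtain E where E: "\<And>i x. (1 + norm x) ^ k * norm (fourier (D i) x) \<le> E i" using Suc(1)[OF Di] by metis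
    have "(1 + norm x) ^ Suc k * norm (fourier f x) \<le> C + (\<Sum>i\<in>UNIV. E i)" for x
    proof -
      have "norm x \<le> (\<Sum>i\<in>UNIV. \<bar>x $ i\<bar>)" by (rule norm_le_l1_cart)
      then have "norm x * norm (fourier f x) \<le> (\<Sum>i\<in>UNIV. \<bar>x $ i\<bar>) * norm (fourier f x)"
        by (intro mult_right_mono) auto
      also have "\<dots> = (\<Sum>i\<in>UNIV. norm (fourier (D i) x))"
        by (simp add: fourier_partial[OF Suc(2) D(1) Di] norm_mult sum_distrib_right)
      finally have "(1 + norm x) ^ k * (norm (fourier f x) + norm x * norm (fourier f x))
          \<le> (1 + norm x) ^ k * (norm (fourier f x) + (\<Sum>i\<in>UNIV. norm (fourier (D i) x)))"
        by (intro mult_left_mono add_left_mono) auto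
      also have "\<dots> \<le> C + (\<Sum>i\<in>UNIV. E i)"
        unfolding distrib_left sum_distrib_left using C E by (intro add_mono sum_mono)
      finally show ?thesis by (simp add: algebra_simps)
    qed
    then show ?case by blast
  qed
qed

text \<open>The set of transforms of span members is closed under partials, because differentiating
  a transform multiplies f by a coordinate.\<close>

lemma fourier_schwartz:
  assumes "f \<in> radial_span"
  shows "fourier f \<in> schwartz"
proof (rule schwartz_coinduct[where X = "fourier ` radial_span"])
  show "fourier f \<in> fourier ` radial_span" using assms by blast
  fix g :: "real ^ 'n \<Rightarrow> complex" assume "g \<in> fourier ` radial_span"
  then obtain f where f: "g = fourier f" "f \<in> radial_span" by blast
  show "decays g" unfolding f by (rule fourier_decays[OF f(2)])
  show "\<exists>D. has_partials g D \<and> range D \<subseteq> fourier ` radial_span"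
    unfolding f
    by (rule exI, rule conjI, rule fourier_has_partials[OF f(2)], rule image_subsetI)
      (intro imageI radial_span.cmult radial_span.coordinate f(2))
qed

section \<open>Dilations and approximate identities\<close>

lemma integral_lborel_affine:
  fixes f :: "'a::euclidean_space \<Rightarrow> complex"
  assumes [measurable]: "f \<in> borel_measurable borel" and c: "c \<noteq> 0"
  shows "(LINT x|lborel. f x) = complex_of_real (\<bar>c\<bar> ^ DIM('a)) * (LINT x|lborel. f (t + c *\<^sub>R x))"
proof -
  have "(LINT x|lborel. f x) = (LINT x|density (distr lborel borel (\<lambda>x. t + c *\<^sub>R x)) (\<lambda>_. \<bar>c\<bar> ^ DIM('a)). f x)"
    using lborel_affine[OF c, of t] by simp
  also have "\<dots> = (LINT x|distr lborel borel (\<lambda>x. t + c *\<^sub>R x). \<bar>c\<bar> ^ DIM('a) *\<^sub>R f x)"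
    by (intro integral_density) auto
  also have "\<dots> = (LINT x|lborel. \<bar>c\<bar> ^ DIM('a) *\<^sub>R f (t + c *\<^sub>R x))"
    by (intro integral_distr) auto
  finally show ?thesis by (simp add: scaleR_conv_of_real)
qed

lemma integrable_lborel_affine:
  fixes f :: "'a::euclidean_space \<Rightarrow> complex"
  assumes f: "integrable lborel f" and c: "c \<noteq> 0"
  shows "integrable lborel (\<lambda>x. f (t + c *\<^sub>R x))"
proof -
  have [measurable]: "f \<in> borel_measurable borel" using borel_measurable_integrable[OF f] by simp
  have "integrable (density (distr lborel borel (\<lambda>x. t + c *\<^sub>R x)) (\<lambda>_. \<bar>c\<bar> ^ DIM('a))) f"
    using f lborel_affine[OF c, of t] by simp
  then have "integrable (distr lborel borel (\<lambda>x. t + c *\<^sub>R x)) (\<lambda>x. \<bar>c\<bar> ^ DIM('a) *\<^sub>R f x)"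
    by (subst (asm) integrable_density) auto
  then have "integrable lborel (\<lambda>x. \<bar>c\<bar> ^ DIM('a) *\<^sub>R f (t + c *\<^sub>R x))"
    by (subst (asm) integrable_distr_eq) auto
  then have "integrable lborel (\<lambda>x. (1 / \<bar>c\<bar> ^ DIM('a)) *\<^sub>R (\<bar>c\<bar> ^ DIM('a) *\<^sub>R f (t + c *\<^sub>R x)))"
    by (rule integrable_scaleR_right)
  moreover have "(1 / \<bar>c\<bar> ^ DIM('a)) *\<^sub>R (\<bar>c\<bar> ^ DIM('a) *\<^sub>R z) = z" for z :: complex
    using c by simp
  ultimately show ?thesis by (simp only:)
qed

lemma fourier_scale:
  fixes f :: "real ^ 'n \<Rightarrow> complex"
  assumes [measurable]: "f \<in> borel_measurable borel" and c: "0 < c"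
  shows "fourier (\<lambda>x. f (c *\<^sub>R x)) z = complex_of_real ((1 / c) ^ CARD('n)) * fourier f ((1 / c) *\<^sub>R z)"
proof -
  have "fourier (\<lambda>x. f (c *\<^sub>R x)) z = (LINT x|lborel. cis (- (x \<bullet> z)) * f (c *\<^sub>R x))"
    by (rule fourier_lborel) measurable
  also have "\<dots> = complex_of_real (\<bar>1 / c\<bar> ^ DIM(real ^ 'n)) * (LINT x|lborel. cis (- ((0 + (1 / c) *\<^sub>R x) \<bullet> z)) * f (c *\<^sub>R (0 + (1 / c) *\<^sub>R x)))"
    using c by (intro integral_lborel_affine[where t = 0]) auto
  also have "\<dots> = complex_of_real ((1 / c) ^ CARD('n)) * (LINT x|lborel. cis (- (x \<bullet> ((1 / c) *\<^sub>R z))) * f x)"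
    using c by simp
  also have "(LINT x|lborel. cis (- (x \<bullet> ((1 / c) *\<^sub>R z))) * f x) = fourier f ((1 / c) *\<^sub>R z)"
    by (rule fourier_lborel[symmetric]) measurable
  finally show ?thesis .
qed

lemma fourier_cmult: "fourier (\<lambda>x. c * f x) z = c * fourier f z"
  unfolding fourier_def by (simp add: mult.left_commute)

section \<open>The Gaussian and inversion at the origin\<close>

definition gauss :: "real ^ 'n \<Rightarrow> complex" where
  "gauss x = complex_of_real (exp (- (norm x)\<^sup>2 / 2))"

lemma gauss_radial_span: "(gauss :: real ^ 'n::finite \<Rightarrow> complex) \<in> radial_span"
  unfolding gauss_def[abs_def] using radial_span.radial[OF rapid_exp[of 1]] by simp

text \<open>The Gaussian and its transform satisfy the same equations: the i-th partial is -x_i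
  times the function. Hence the transform times exp (|x|^2 / 2) has zero gradient and is constant,
  equal to its value at 0.\<close>

lemma fourier_gauss:
  fixes x :: "real ^ 'n::finite"
  shows "fourier gauss x = fourier (gauss :: real ^ 'n \<Rightarrow> complex) 0 * gauss x"
proof -
  define D where "D = (\<lambda>i \<xi>::real ^ 'n. 2 * (complex_of_real (\<xi> $ i) * complex_of_real ((- 1 / 2) * exp (- (norm \<xi>)\<^sup>2 / 2))))"
  have D: "has_partials (gauss :: real ^ 'n \<Rightarrow> complex) D"
    unfolding gauss_def[abs_def] D_def
    by (rule has_partials_radial) (auto intro!: derivative_eq_intros)
  have D2: "D i = (\<lambda>\<xi>. - 1 * (complex_of_real (\<xi> $ i) * gauss \<xi>))" for i
    by (auto simp: gauss_def D_def)
  have Di: "D i \<in> radial_span" for i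
    unfolding D2 by (intro radial_span.cmult radial_span.coordinate gauss_radial_span)
  have e: "(\<lambda>\<xi>. - \<i> * (complex_of_real (\<xi> $ i) * gauss \<xi>)) = (\<lambda>\<xi>. \<i> * D i \<xi>)" for i
    unfolding D2 by auto
  have F: "has_partials (fourier (gauss :: real ^ 'n \<Rightarrow> complex)) (\<lambda>i x. - (complex_of_real (x $ i) * fourier gauss x))"
  proof -
    have fe: "fourier (\<lambda>\<xi>. - \<i> * (complex_of_real (\<xi> $ i) * gauss \<xi>)) x = - (complex_of_real (x $ i) * fourier gauss x)" for i and x :: "real ^ 'n"
      unfolding e unfolding fourier_cmult fourier_partial[OF gauss_radial_span D Di] by (simp add: mult.assoc[symmetric])
    have "(\<lambda>i. fourier (\<lambda>\<xi>. - \<i> * (complex_of_real (\<xi> $ i) * gauss \<xi>)))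
        = (\<lambda>i (x :: real ^ 'n). - (complex_of_real (x $ i) * fourier gauss x))"
      by (rule ext, rule ext, rule fe)
    with fourier_has_partials[OF gauss_radial_span, where 'n = 'n] show ?thesis by argo
  qed
  have E: "has_partials (\<lambda>x::real ^ 'n. complex_of_real (exp ((norm x)\<^sup>2 / 2)))
     (\<lambda>i x. 2 * (complex_of_real (x $ i) * complex_of_real ((1 / 2) * exp ((norm x)\<^sup>2 / 2))))"
    by (rule has_partials_radial) (auto intro!: derivative_eq_intros)
  define u where "u = (\<lambda>x::real ^ 'n. complex_of_real (exp ((norm x)\<^sup>2 / 2)) * fourier gauss x)"
  have "(u has_derivative (\<lambda>h. 0)) (at x)" for x
    using has_partials_mult[OF F E] unfolding has_partials_def u_def by simp
  then obtain c where "\<And>x. u x = c"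
    using has_derivative_zero_constant[of UNIV u] by auto
  then have "u x = u 0" by simp
  also have "u 0 = fourier (gauss :: real ^ 'n \<Rightarrow> complex) 0" unfolding u_def by simp
  finally have ux: "u x = fourier (gauss :: real ^ 'n \<Rightarrow> complex) 0" .
  have "complex_of_real (exp ((norm x)\<^sup>2 / 2)) * gauss x = 1"
    unfolding gauss_def by (simp flip: of_real_mult exp_add)
  moreover have "u x * gauss x = (complex_of_real (exp ((norm x)\<^sup>2 / 2)) * gauss x) * fourier gauss x"
    unfolding u_def by (simp only: mult_ac)
  ultimately have "u x * gauss x = fourier gauss x" by simp
  then show ?thesis unfolding ux by simp
qed

lemma fourier_gauss_0: "fourier (gauss :: real ^ 'n::finite \<Rightarrow> complex) 0 = (LINT x::real ^ 'n|lborel. gauss x)"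
  using fourier_lborel[OF radial_span_measurable[OF gauss_radial_span], of 0] by simp

text \<open>The value at 0 is the integral of a strictly positive function, so it is nonzero without
  being computed.\<close>

lemma fourier_gauss_0_neq: "fourier (gauss :: real ^ 'n::finite \<Rightarrow> complex) 0 \<noteq> 0"
proof
  let ?g = "\<lambda>x::real ^ 'n. exp (- (norm x)\<^sup>2 / 2)"
  have "integrable lborel (gauss :: real ^ 'n \<Rightarrow> complex)"
    by (rule radial_span_integrable[OF gauss_radial_span])
  then have I: "integrable lborel ?g"
    unfolding gauss_def[abs_def] by (drule_tac integrable_norm) simp
  assume z: "fourier (gauss :: real ^ 'n \<Rightarrow> complex) 0 = 0"
  have "fourier (gauss :: real ^ 'n \<Rightarrow> complex) 0 = complex_of_real (LINT x|lborel. ?g x)"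
    unfolding fourier_gauss_0 gauss_def integral_complex_of_real ..
  with z have "complex_of_real (LINT x|lborel. ?g x) = 0" by simp
  then have "(LINT x|lborel. ?g x) = 0" by simp
  then have "AE x in lborel. ?g x = 0"
    using integral_nonneg_eq_0_iff_AE[OF I] by simp
  then have "AE x::real ^ 'n in lborel. False" by eventually_elim simp
  then have "emeasure lborel (UNIV :: (real ^ 'n) set) = 0" by (simp add: eventually_False ae_filter_eq_bot_iff)
  then show False by simp
qed

text \<open>Fourier inversion at the origin, up to a constant of which only \<open>\<noteq> 0\<close> matters.\<close>

lemma integral_fourier:
  fixes f :: "real ^ 'n \<Rightarrow> complex"
  assumes f: "f \<in> radial_span"
  shows "(LINT x|lborel. fourier f x) = (fourier (gauss :: real ^ 'n \<Rightarrow> complex) 0)\<^sup>2 * f 0"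
proof -
  let ?G = "gauss :: real ^ 'n \<Rightarrow> complex"
  let ?g = "fourier ?G 0"
  note [measurable] = radial_span_measurable[OF f] radial_span_measurable[OF gauss_radial_span]
    schwartz_measurable[OF fourier_schwartz[OF f]] schwartz_measurable[OF fourier_schwartz[OF gauss_radial_span]]
  have If: "integrable lborel f" by (rule radial_span_integrable[OF f])
  have IG: "integrable lborel ?G" by (rule radial_span_integrable[OF gauss_radial_span])
  have IF: "integrable lborel (fourier f)"
    by (intro decays_integrable fourier_decays f) measurable
  define \<epsilon> where "\<epsilon> m = 1 / real (Suc m)" for m
  have \<epsilon>: "0 < \<epsilon> m" for m unfolding \<epsilon>_def by simp
  have \<epsilon>0: "\<epsilon> \<longlonglongrightarrow> 0" unfolding \<epsilon>_def using LIMSEQ_inverse_real_of_nat by (simp add: inverse_eq_divide)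
  have scale0: "(\<lambda>m. h (\<epsilon> m *\<^sub>R x)) \<longlonglongrightarrow> h 0" if "continuous_on UNIV h" for h :: "real ^ 'n \<Rightarrow> complex" and x
  proof -
    have "(\<lambda>m. \<epsilon> m *\<^sub>R x) \<longlonglongrightarrow> 0 *\<^sub>R x" by (intro tendsto_intros \<epsilon>0)
    moreover have "isCont h 0" using that by (simp add: continuous_on_eq_continuous_at)
    ultimately show ?thesis by (intro isCont_tendsto_compose[of 0 h]) auto
  qed
  have G1: "norm (?G x) \<le> 1" for x unfolding gauss_def by simp
  obtain M where M: "\<And>x. norm (f x) \<le> M" using decays_bounded[OF radial_span_decays[OF f]] by blast
  \<comment> \<open>The transform of f is paired with a Gaussian that flattens out to 1; by the
    multiplication formula \<open>eq\<close> the same integral evaluates f ever closer to 0, as in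
    \<open>lim2\<close>.\<close>
  have lim1: "(\<lambda>m. LINT x|lborel. fourier f x * ?G (\<epsilon> m *\<^sub>R x)) \<longlonglongrightarrow> (LINT x|lborel. fourier f x * 1)"
  proof (rule integral_dominated_convergence[where w = "\<lambda>x. norm (fourier f x)"])
    show "AE x in lborel. (\<lambda>m. fourier f x * ?G (\<epsilon> m *\<^sub>R x)) \<longlonglongrightarrow> fourier f x * 1"
      using scale0[OF radial_span_continuous[OF gauss_radial_span]]
      by (intro AE_I2 tendsto_mult tendsto_const) (simp add: gauss_def)
    show "AE x in lborel. norm (fourier f x * ?G (\<epsilon> m *\<^sub>R x)) \<le> norm (fourier f x)" for m
      by (intro AE_I2) (simp add: norm_mult mult_left_le G1)
  qed (use IF in \<open>auto intro: integrable_norm\<close>)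
  have lim2: "(\<lambda>m. LINT x|lborel. f (\<epsilon> m *\<^sub>R x) * fourier ?G x) \<longlonglongrightarrow> (LINT x|lborel. f 0 * fourier ?G x)"
  proof (rule integral_dominated_convergence[where w = "\<lambda>x. M * norm (?g * ?G x)"])
    show "integrable lborel (\<lambda>x. M * norm (?g * ?G x))"
      by (intro integrable_mult_right integrable_norm IG)
    show "AE x in lborel. (\<lambda>m. f (\<epsilon> m *\<^sub>R x) * fourier ?G x) \<longlonglongrightarrow> f 0 * fourier ?G x"
      by (intro AE_I2 tendsto_mult tendsto_const scale0 radial_span_continuous f)
    show "AE x in lborel. norm (f (\<epsilon> m *\<^sub>R x) * fourier ?G x) \<le> M * norm (?g * ?G x)" for m
    proof (intro AE_I2)
      fix x
      have "norm (f (\<epsilon> m *\<^sub>R x) * fourier ?G x) = norm (f (\<epsilon> m *\<^sub>R x)) * norm (?g * ?G x)"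
        by (subst fourier_gauss) (rule norm_mult)
      also have "\<dots> \<le> M * norm (?g * ?G x)" by (intro mult_right_mono M) simp
      finally show "norm (f (\<epsilon> m *\<^sub>R x) * fourier ?G x) \<le> M * norm (?g * ?G x)" .
    qed
  qed measurable
  have eq: "(LINT x|lborel. fourier f x * ?G (\<epsilon> m *\<^sub>R x)) = (LINT x|lborel. f (\<epsilon> m *\<^sub>R x) * fourier ?G x)" for m
  proof -
    let ?h = "\<lambda>x. ?G (\<epsilon> m *\<^sub>R x)"
    have Ih: "integrable lborel ?h" using integrable_lborel_affine[OF IG, of "\<epsilon> m" 0] \<epsilon>[of m] by simp
    have prod: "integrable (lborel \<Otimes>\<^sub>M lborel) (\<lambda>(\<xi>, x). cis (- (\<xi> \<bullet> x)) * f \<xi> * ?h x)"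
    proof (rule lborel_pair.Fubini_integrable)
      have "integrable lborel (\<lambda>\<xi>. norm (f \<xi>) * (LINT x|lborel. norm (?h x)))"
        by (intro integrable_mult_left integrable_norm If)
      then show "integrable lborel (\<lambda>\<xi>. LINT x|lborel. norm (case (\<xi>, x) of (\<xi>, x) \<Rightarrow> cis (- (\<xi> \<bullet> x)) * f \<xi> * ?h x))"
        by (simp add: norm_mult)
      show "AE \<xi> in lborel. integrable lborel (\<lambda>x. case (\<xi>, x) of (\<xi>, x) \<Rightarrow> cis (- (\<xi> \<bullet> x)) * f \<xi> * ?h x)"
      proof (intro AE_I2)
        fix \<xi>
        have "integrable lborel (\<lambda>x. f \<xi> * (cis (- (x \<bullet> \<xi>)) * ?h x))"
          by (intro integrable_mult_right integrable_character_mult Ih)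
        then show "integrable lborel (\<lambda>x. case (\<xi>, x) of (\<xi>, x) \<Rightarrow> cis (- (\<xi> \<bullet> x)) * f \<xi> * ?h x)"
          by (simp add: inner_commute mult_ac)
      qed
    qed measurable
    have "(LINT x|lborel. fourier f x * ?h x) = (LINT x|lborel. (LINT \<xi>|lborel. cis (- (\<xi> \<bullet> x)) * f \<xi> * ?h x))"
      by (simp add: fourier_lborel)
    also have "\<dots> = (LINT \<xi>|lborel. (LINT x|lborel. cis (- (\<xi> \<bullet> x)) * f \<xi> * ?h x))"
      using lborel_pair.Fubini_integral[OF prod] by simp
    also have "\<dots> = (LINT \<xi>|lborel. f \<xi> * fourier ?h \<xi>)"
    proof (intro Bochner_Integration.integral_cong refl)
      fix \<xi>
      have "fourier ?h \<xi> = (LINT x|lborel. cis (- (x \<bullet> \<xi>)) * ?h x)" by (rule fourier_lborel) measurable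
      then show "(LINT x|lborel. cis (- (\<xi> \<bullet> x)) * f \<xi> * ?h x) = f \<xi> * fourier ?h \<xi>"
        by (simp add: inner_commute mult.assoc mult.left_commute)
    qed
    also have "\<dots> = (LINT \<xi>|lborel. f \<xi> * (complex_of_real ((1 / \<epsilon> m) ^ CARD('n)) * fourier ?G ((1 / \<epsilon> m) *\<^sub>R \<xi>)))"
      by (subst fourier_scale) (auto simp: \<epsilon>)
    also have "\<dots> = complex_of_real (\<bar>\<epsilon> m\<bar> ^ DIM(real ^ 'n)) * (LINT \<xi>|lborel. f (0 + \<epsilon> m *\<^sub>R \<xi>) * (complex_of_real ((1 / \<epsilon> m) ^ CARD('n)) * fourier ?G ((1 / \<epsilon> m) *\<^sub>R (0 + \<epsilon> m *\<^sub>R \<xi>))))"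
      by (rule integral_lborel_affine[where t = 0]) (measurable, use \<epsilon>[of m] in simp)
    also have "\<dots> = complex_of_real (\<epsilon> m ^ CARD('n)) * (complex_of_real ((1 / \<epsilon> m) ^ CARD('n)) * (LINT \<xi>|lborel. f (\<epsilon> m *\<^sub>R \<xi>) * fourier ?G \<xi>))"
      using \<epsilon>[of m] by (simp add: mult.left_commute[of _ "complex_of_real ((1 / \<epsilon> m) ^ CARD('n))"] del: of_real_power)
    also have "\<dots> = (LINT \<xi>|lborel. f (\<epsilon> m *\<^sub>R \<xi>) * fourier ?G \<xi>)"
      using \<epsilon>[of m] by (simp add: power_one_over)
    finally show ?thesis .
  qed
  have "(LINT x|lborel. fourier f x) = (LINT x|lborel. f 0 * fourier ?G x)"
    using LIMSEQ_unique[OF lim1 lim2[folded eq]] by simp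
  also have "\<dots> = f 0 * (LINT x|lborel. fourier ?G x)" by simp
  \<comment> \<open>One factor of the square comes from the transform of the Gaussian being a
    multiple of the Gaussian, the other from its integral.\<close>
  also have "(LINT x|lborel. fourier ?G x) = (LINT x|lborel. ?g * ?G x)"
    by (intro Bochner_Integration.integral_cong refl fourier_gauss)
  also have "(LINT x|lborel. ?g * ?G x) = ?g * (LINT x|lborel. ?G x)" by simp
  finally show ?thesis unfolding fourier_gauss_0[symmetric] by (simp add: power2_eq_square)
qed

text \<open>Normalised so that the integral of k is preserved; this is the form taken by the
  transform of xi -> f(2^(-j) xi).\<close>

definition dilate :: "(real ^ 'n \<Rightarrow> complex) \<Rightarrow> int \<Rightarrow> real ^ 'n \<Rightarrow> complex" where
  "dilate k j z = complex_of_real ((2 powi j) ^ CARD('n)) * k (2 powi j *\<^sub>R z)"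

lemma measurable_dilate [measurable]:
  assumes [measurable]: "k \<in> borel_measurable borel"
  shows "dilate k j \<in> borel_measurable borel"
  unfolding dilate_def[abs_def] by measurable

lemma fourier_dilate:
  fixes f :: "real ^ 'n \<Rightarrow> complex"
  assumes "f \<in> borel_measurable borel"
  shows "fourier (\<lambda>\<xi>. f (2 powi (- j) *\<^sub>R \<xi>)) = dilate (fourier f) j"
  unfolding dilate_def using fourier_scale[OF assms, of "2 powi (- j)"]
  by (auto simp: power_int_minus fun_eq_iff divide_inverse)

text \<open>The substitution y = x + 2^(-N) z freezes the kernel and moves the scale into the
  continuous function, where dominated convergence applies.\<close>

lemma dilate_tendsto:
  fixes \<phi> k :: "real ^ 'n \<Rightarrow> complex"
  assumes \<phi>: "continuous_on UNIV \<phi>" "\<And>x. norm (\<phi> x) \<le> M" and k: "integrable lborel k"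
  shows "(\<lambda>N. LINT y|lborel. \<phi> y * dilate k (int N) (y - x)) \<longlonglongrightarrow> (LINT z|lborel. k z) * \<phi> x"
proof -
  have [measurable]: "k \<in> borel_measurable borel" using borel_measurable_integrable[OF k] by simp
  have [measurable]: "\<phi> \<in> borel_measurable borel" using \<phi>(1) by (rule borel_measurable_continuous_onI)
  define \<epsilon> :: "nat \<Rightarrow> real" where "\<epsilon> N = (1 / 2) ^ N" for N
  have \<epsilon>: "0 < \<epsilon> N" "2 powi int N = 1 / \<epsilon> N" for N unfolding \<epsilon>_def by (auto simp: power_one_over)
  have eq: "(LINT y|lborel. \<phi> y * dilate k (int N) (y - x)) = (LINT z|lborel. \<phi> (x + \<epsilon> N *\<^sub>R z) * k z)" for N
  proof -
    have "(LINT y|lborel. \<phi> y * dilate k (int N) (y - x)) = complex_of_real (\<bar>\<epsilon> N\<bar> ^ DIM(real ^ 'n)) * (LINT z|lborel. \<phi> (x + \<epsilon> N *\<^sub>R z) * dilate k (int N) (x + \<epsilon> N *\<^sub>R z - x))"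
      using \<epsilon>(1)[of N] by (intro integral_lborel_affine) auto
    also have "\<dots> = complex_of_real (\<epsilon> N ^ CARD('n)) * (complex_of_real ((1 / \<epsilon> N) ^ CARD('n)) * (LINT z|lborel. \<phi> (x + \<epsilon> N *\<^sub>R z) * k z))"
      using \<epsilon>(1)[of N] unfolding dilate_def \<epsilon>(2)
      by (simp add: mult.left_commute[of _ "complex_of_real ((1 / \<epsilon> N) ^ CARD('n))"] del: of_real_power)
    also have "\<dots> = (LINT z|lborel. \<phi> (x + \<epsilon> N *\<^sub>R z) * k z)"
      using \<epsilon>(1)[of N] by (simp add: power_one_over)
    finally show ?thesis .
  qed
  have "(\<lambda>N. LINT z|lborel. \<phi> (x + \<epsilon> N *\<^sub>R z) * k z) \<longlonglongrightarrow> (LINT z|lborel. \<phi> x * k z)"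
  proof (rule integral_dominated_convergence[where w = "\<lambda>z. M * norm (k z)"])
    show "integrable lborel (\<lambda>z. M * norm (k z))" by (intro integrable_mult_right integrable_norm k)
    show "AE z in lborel. norm (\<phi> (x + \<epsilon> N *\<^sub>R z) * k z) \<le> M * norm (k z)" for N
      by (intro AE_I2) (simp add: norm_mult mult_right_mono \<phi>(2))
    show "AE z in lborel. (\<lambda>N. \<phi> (x + \<epsilon> N *\<^sub>R z) * k z) \<longlonglongrightarrow> \<phi> x * k z"
    proof (intro AE_I2 tendsto_mult tendsto_const)
      fix z
      have "\<epsilon> \<longlonglongrightarrow> 0" unfolding \<epsilon>_def[abs_def] by (intro LIMSEQ_power_zero) simp
      then have "(\<lambda>N. x + \<epsilon> N *\<^sub>R z) \<longlonglongrightarrow> x + 0 *\<^sub>R z" by (intro tendsto_intros)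
      moreover have "isCont \<phi> x" using \<phi>(1) by (simp add: continuous_on_eq_continuous_at)
      ultimately show "(\<lambda>N. \<phi> (x + \<epsilon> N *\<^sub>R z)) \<longlonglongrightarrow> \<phi> x" by (intro isCont_tendsto_compose[of x \<phi>]) auto
    qed
  qed auto
  then show ?thesis unfolding eq by (simp add: mult.commute)
qed

text \<open>At coarse scales the kernel is at most 2^(jn) B, which tends to 0, while the integral of
  |\<phi>| is fixed. The index -N-1 is the lower end left by telescoping from -N.\<close>

lemma dilate_vanish:
  fixes \<phi> k :: "real ^ 'n::finite \<Rightarrow> complex"
  assumes \<phi>: "integrable lborel \<phi>" and [measurable]: "k \<in> borel_measurable borel" and k: "\<And>z. norm (k z) \<le> B"
  shows "(\<lambda>N. LINT y|lborel. \<phi> y * dilate k (- int N - 1) (y - x)) \<longlonglongrightarrow> 0"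
proof (rule Lim_null_comparison)
  have [measurable]: "\<phi> \<in> borel_measurable borel" using borel_measurable_integrable[OF \<phi>] by simp
  have B: "0 \<le> B" using k[of 0] norm_ge_zero[of "k 0"] by linarith
  show "\<forall>\<^sub>F N in sequentially. norm (LINT y|lborel. \<phi> y * dilate k (- int N - 1) (y - x))
      \<le> (1 / 2) ^ N * (B * (LINT y|lborel. norm (\<phi> y)))"
  proof (intro always_eventually allI)
    fix N
    have p: "(2 powi (- int N - 1)) ^ CARD('n) \<le> (1 / 2 :: real) ^ N"
    proof -
      have "(2 powi (- int N - 1) :: real) = (1 / 2) ^ Suc N"
        by (simp add: power_int_diff power_int_minus power_one_over inverse_eq_divide)
      then have "(2 powi (- int N - 1) :: real) ^ CARD('n) = (1 / 2) ^ (Suc N * CARD('n))" by (simp only: power_mult)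
      also have "\<dots> \<le> (1 / 2) ^ N"
        using mult_le_mono[of N "Suc N" 1 "CARD('n)"] by (intro power_decreasing) (auto simp: Suc_leI)
      finally show ?thesis .
    qed
    have le: "norm (\<phi> y * dilate k (- int N - 1) (y - x)) \<le> (1 / 2) ^ N * (B * norm (\<phi> y))" for y
    proof -
      have "norm (dilate k (- int N - 1) (y - x)) \<le> (1 / 2) ^ N * B"
        unfolding dilate_def norm_mult norm_of_real using p B by (intro mult_mono k) auto
      then have "norm (\<phi> y) * norm (dilate k (- int N - 1) (y - x)) \<le> norm (\<phi> y) * ((1 / 2) ^ N * B)"
        by (intro mult_left_mono) auto
      then show ?thesis by (simp add: norm_mult mult_ac)
    qed
    have "norm (LINT y|lborel. \<phi> y * dilate k (- int N - 1) (y - x)) \<le> (LINT y|lborel. norm (\<phi> y * dilate k (- int N - 1) (y - x)))"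
      by (rule integral_norm_bound)
    also have "\<dots> \<le> (LINT y|lborel. (1 / 2) ^ N * (B * norm (\<phi> y)))"
    proof (rule integral_mono[OF integrable_norm _ le])
      show I: "integrable lborel (\<lambda>y. (1 / 2) ^ N * (B * norm (\<phi> y)))"
        by (intro integrable_mult_right integrable_norm \<phi>)
      show "integrable lborel (\<lambda>y. \<phi> y * dilate k (- int N - 1) (y - x))"
      proof (rule Bochner_Integration.integrable_bound[OF I])
        show "AE y in lborel. norm (\<phi> y * dilate k (- int N - 1) (y - x)) \<le> norm ((1 / 2) ^ N * (B * norm (\<phi> y)))"
          by (intro AE_I2 order_trans[OF le]) simp
      qed measurable
    qed
    finally show "norm (LINT y|lborel. \<phi> y * dilate k (- int N - 1) (y - x))
      \<le> (1 / 2) ^ N * (B * (LINT y|lborel. norm (\<phi> y)))" by simp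
  qed
  have "(\<lambda>N. (1 / 2 :: real) ^ N) \<longlonglongrightarrow> 0" by (intro LIMSEQ_power_zero) simp
  then show "(\<lambda>N. (1 / 2) ^ N * (B * (LINT y|lborel. norm (\<phi> y)))) \<longlonglongrightarrow> 0" by (rule tendsto_mult_left_zero)
qed

section \<open>Hedberg's estimate\<close>

text \<open>The kernel is taken at y - x, the form produced by transforming a modulated symbol. If
  the product is not integrable the value is 0, so the norm bounds need no integrability
  hypothesis.\<close>

definition conv :: "(real ^ 'n \<Rightarrow> complex) \<Rightarrow> int \<Rightarrow> (real ^ 'n \<Rightarrow> complex) \<Rightarrow> real ^ 'n \<Rightarrow> complex" where
  "conv k j v x = (LINT y|lborel. v y * dilate k j (y - x))"

lemma measurable_conv [measurable]:
  assumes [measurable]: "k \<in> borel_measurable borel" "v \<in> borel_measurable borel"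
  shows "conv k j v \<in> borel_measurable borel"
  unfolding conv_def[abs_def] by measurable

lemma conv_cmult: "conv k j (\<lambda>y. c * v y) x = c * conv k j v x"
  unfolding conv_def by (simp add: mult.assoc)

lemma dilate_bound:
  fixes k :: "real ^ 'n \<Rightarrow> complex"
  assumes "decays k"
  obtains B where "0 \<le> B"
    "\<And>j z. norm (dilate k j z) \<le> B * ((2 powi j) ^ CARD('n) / (1 + 2 powi j * norm z) ^ (CARD('n) + 1))"
proof -
  obtain B where B: "0 \<le> B" "\<And>z. norm (k z) \<le> B * (1 / (1 + norm z) ^ (CARD('n) + 1))"
    using decaysE[OF assms] by blast
  have "norm (dilate k j z) \<le> B * ((2 powi j) ^ CARD('n) / (1 + 2 powi j * norm z) ^ (CARD('n) + 1))" for j z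
  proof -
    have "norm (dilate k j z) = (2 powi j) ^ CARD('n) * norm (k (2 powi j *\<^sub>R z))"
      unfolding dilate_def norm_mult norm_of_real by simp
    also have "\<dots> \<le> (2 powi j) ^ CARD('n) * (B * (1 / (1 + norm (2 powi j *\<^sub>R z)) ^ (CARD('n) + 1)))"
      by (intro mult_left_mono B) auto
    finally show ?thesis by (simp add: mult_ac)
  qed
  with B(1) show thesis by (rule that)
qed

lemma norm_conv_le:
  fixes k v :: "real ^ 'n \<Rightarrow> complex"
  assumes [measurable]: "k \<in> borel_measurable borel" "v \<in> borel_measurable borel"
    and B: "0 \<le> B" "\<And>z. norm (dilate k j z) \<le> B * ((2 powi j) ^ CARD('n) / (1 + 2 powi j * norm z) ^ (CARD('n) + 1))"
  shows "ennreal (norm (conv k j v x)) \<le> ennreal B *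
    (\<integral>\<^sup>+y. ennreal ((2 powi j) ^ CARD('n) / (1 + 2 powi j * norm (y - x)) ^ (CARD('n) + 1)) * ennreal (norm (v y)) \<partial>lborel)"
proof (cases "integrable lborel (\<lambda>y. v y * dilate k j (y - x))")
  case True
  have "ennreal (norm (conv k j v x)) \<le> (\<integral>\<^sup>+y. ennreal (norm (v y * dilate k j (y - x))) \<partial>lborel)"
    unfolding conv_def by (rule integral_norm_bound_ennreal[OF True])
  also have "\<dots> \<le> (\<integral>\<^sup>+y. ennreal B * (ennreal ((2 powi j) ^ CARD('n) / (1 + 2 powi j * norm (y - x)) ^ (CARD('n) + 1)) * ennreal (norm (v y))) \<partial>lborel)"
  proof (rule nn_integral_mono)
    fix y
    have "norm (v y * dilate k j (y - x)) \<le> (B * ((2 powi j) ^ CARD('n) / (1 + 2 powi j * norm (y - x)) ^ (CARD('n) + 1))) * norm (v y)"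
      unfolding norm_mult mult.commute[of "norm (v y)"] by (intro mult_right_mono B) auto
    then show "ennreal (norm (v y * dilate k j (y - x))) \<le> ennreal B * (ennreal ((2 powi j) ^ CARD('n) / (1 + 2 powi j * norm (y - x)) ^ (CARD('n) + 1)) * ennreal (norm (v y)))"
      using B(1) by (simp only: ennreal_mult'[symmetric] ennreal_mult''[symmetric] norm_ge_zero mult.assoc ennreal_leI)
  qed
  also have "\<dots> = ennreal B * (\<integral>\<^sup>+y. ennreal ((2 powi j) ^ CARD('n) / (1 + 2 powi j * norm (y - x)) ^ (CARD('n) + 1)) * ennreal (norm (v y)) \<partial>lborel)"
    by (intro nn_integral_cmult) measurable
  finally show ?thesis .
next
  case False
  then show ?thesis by (simp add: conv_def not_integrable_integral_eq)
qed

lemma conv_le_maximal: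
  fixes k :: "real ^ 'n \<Rightarrow> complex"
  assumes "decays k" and [measurable]: "k \<in> borel_measurable borel"
  obtains C where "1 \<le> C" "\<And>v j x. v \<in> borel_measurable borel \<Longrightarrow>
    ennreal (norm (conv k j v x)) \<le> ennreal C * maximal (\<lambda>y. ennreal (norm (v y))) x"
proof -
  obtain B where B: "0 \<le> B"
    "\<And>j z. norm (dilate k j z) \<le> B * ((2 powi j) ^ CARD('n) / (1 + 2 powi j * norm z) ^ (CARD('n) + 1))"
    using dilate_bound[OF assms(1)] by blast
  define A where "A = 2 ^ (2 * DIM(real ^ 'n) + 1) * unit_ball_vol (DIM(real ^ 'n)) * 2"
  have A: "0 \<le> A" unfolding A_def by simp
  have "ennreal (norm (conv k j v x)) \<le> ennreal (max 1 (B * A)) * maximal (\<lambda>y. ennreal (norm (v y))) x"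
    if [measurable]: "v \<in> borel_measurable borel" for v j x
  proof -
    have "ennreal (norm (conv k j v x)) \<le> ennreal B *
      (\<integral>\<^sup>+y. ennreal ((2 powi j) ^ CARD('n) / (1 + 2 powi j * norm (y - x)) ^ (CARD('n) + 1)) * ennreal (norm (v y)) \<partial>lborel)"
      by (rule norm_conv_le[OF _ _ B]) measurable
    also have "\<dots> \<le> ennreal B * (ennreal A * maximal (\<lambda>y. ennreal (norm (v y))) x)"
    proof (rule mult_left_mono)
      have "(\<lambda>y. ennreal (norm (v y))) \<in> borel_measurable borel" by measurable
      from nn_integral_decay_le_maximal[OF this, of j x]
      show "(\<integral>\<^sup>+y. ennreal ((2 powi j) ^ CARD('n) / (1 + 2 powi j * norm (y - x)) ^ (CARD('n) + 1)) * ennreal (norm (v y)) \<partial>lborel)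
          \<le> ennreal A * maximal (\<lambda>y. ennreal (norm (v y))) x"
        unfolding A_def by simp
    qed simp
    also have "\<dots> = ennreal (B * A) * maximal (\<lambda>y. ennreal (norm (v y))) x"
      using A B by (simp add: ennreal_mult mult.assoc)
    also have "\<dots> \<le> ennreal (max 1 (B * A)) * maximal (\<lambda>y. ennreal (norm (v y))) x"
      by (intro mult_right_mono ennreal_leI) auto
    finally show ?thesis .
  qed
  then show thesis using that[of "max 1 (B * A)"] by auto
qed

text \<open>In place of Hoelder's inequality, |v| \<le> D ((|v| / D)^q + 1) is integrated against
  the weight w, which is at most 2^(jn) and has an integral bounded independently of j.\<close>

lemma conv_le_Lp:
  fixes k :: "real ^ 'n \<Rightarrow> complex" and q :: real
  assumes "decays k" and [measurable]: "k \<in> borel_measurable borel" and q: "1 < q"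
  obtains C where "1 \<le> C" "\<And>v j x. v \<in> borel_measurable borel \<Longrightarrow>
    (\<integral>\<^sup>+y. ennreal (norm (v y) powr q) \<partial>lborel) \<le> 1 \<Longrightarrow>
    norm (conv k j v x) \<le> C * 2 powr (real_of_int j * (CARD('n) / q))"
proof -
  obtain B where B: "0 \<le> B"
    "\<And>j z. norm (dilate k j z) \<le> B * ((2 powi j) ^ CARD('n) / (1 + 2 powi j * norm z) ^ (CARD('n) + 1))"
    using dilate_bound[OF assms(1)] by blast
  define A where "A = 2 ^ (2 * DIM(real ^ 'n) + 1) * unit_ball_vol (DIM(real ^ 'n)) * 2"
  have A: "0 \<le> A" unfolding A_def by simp
  have "norm (conv k j v x) \<le> max 1 (B * (1 + A)) * 2 powr (real_of_int j * (CARD('n) / q))"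
    if [measurable]: "v \<in> borel_measurable borel" and v: "(\<integral>\<^sup>+y. ennreal (norm (v y) powr q) \<partial>lborel) \<le> 1" for v j x
  proof -
    define w where "w y = (2 powi j) ^ CARD('n) / (1 + 2 powi j * norm (y - x)) ^ (CARD('n) + 1)" for y
    have w0: "0 \<le> w y" for y unfolding w_def by simp
    have wle: "w y \<le> (2 powi j) ^ CARD('n)" for y
    proof -
      have "1 \<le> (1 + 2 powi j * norm (y - x)) ^ (CARD('n) + 1)" by (intro one_le_power) auto
      then have "(2 powi j) ^ CARD('n) / (1 + 2 powi j * norm (y - x)) ^ (CARD('n) + 1) \<le> (2 powi j) ^ CARD('n) / 1"
        by (intro divide_left_mono) auto
      then show ?thesis unfolding w_def by simp
    qed
    have [measurable]: "w \<in> borel_measurable borel" unfolding w_def by measurable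
    \<comment> \<open>D^q is the bound 2^(jn) of the weight; this cancels the growth of the first
      term and leaves D times a constant.\<close>
    define D where "D = 2 powr (real_of_int j * (CARD('n) / q))"
    have D: "0 < D" unfolding D_def by simp
    have Dq: "D powr q = (2 powi j) ^ CARD('n)"
      unfolding D_def powr_powr using q
      by (simp add: powr_mult powr_real_of_int' powr_realpow[symmetric] powr_powr)
        (simp add: powr_powr powr_real_of_int'[symmetric])
    have Iw: "(\<integral>\<^sup>+y. ennreal (w y) \<partial>lborel) \<le> ennreal A"
    proof -
      have "maximal (\<lambda>_. 1) x = 1" unfolding maximal_def ball_mean_const by simp
      then show ?thesis using nn_integral_decay_le_maximal[of "\<lambda>_. 1" j x] unfolding w_def A_def by simp
    qed
    have "ennreal (norm (conv k j v x)) \<le> ennreal B * (\<integral>\<^sup>+y. ennreal (w y) * ennreal (norm (v y)) \<partial>lborel)"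
      unfolding w_def by (rule norm_conv_le[OF _ _ B]) measurable
    also have "\<dots> \<le> ennreal B * (\<integral>\<^sup>+y. ennreal D * (ennreal (norm (v y) powr q) + ennreal (w y)) \<partial>lborel)"
    proof (intro mult_left_mono nn_integral_mono)
      fix y
      have "norm (v y) / D \<le> (norm (v y) / D) powr q + 1"
        using powr_le_powr_add_1[of "norm (v y) / D" 1 q] q D by simp
      then have "norm (v y) \<le> D * ((norm (v y) / D) powr q + 1)"
        using D by (simp add: field_simps)
      then have "w y * norm (v y) \<le> w y * (D * ((norm (v y) / D) powr q + 1))"
        using w0 by (intro mult_left_mono) auto
      also have "\<dots> = D * (w y * (norm (v y) / D) powr q + w y)" by (simp add: algebra_simps)
      also have "\<dots> \<le> D * ((2 powi j) ^ CARD('n) * (norm (v y) / D) powr q + w y)"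
        using D wle[of y] by (intro mult_left_mono add_right_mono mult_right_mono) auto
      also have "(norm (v y) / D) powr q = norm (v y) powr q / (2 powi j) ^ CARD('n)"
        using D by (simp add: powr_divide Dq)
      also have "D * ((2 powi j) ^ CARD('n) * (norm (v y) powr q / (2 powi j) ^ CARD('n)) + w y) = D * (norm (v y) powr q + w y)"
        by simp
      finally show "ennreal (w y) * ennreal (norm (v y)) \<le> ennreal D * (ennreal (norm (v y) powr q) + ennreal (w y))"
        using w0[of y] D by (subst ennreal_mult_add) (auto simp: ennreal_mult'[symmetric] intro!: ennreal_leI)
    qed auto
    also have "\<dots> = ennreal B * (ennreal D * ((\<integral>\<^sup>+y. ennreal (norm (v y) powr q) \<partial>lborel) + (\<integral>\<^sup>+y. ennreal (w y) \<partial>lborel)))"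
      by (simp add: nn_integral_cmult nn_integral_add)
    also have "\<dots> \<le> ennreal B * (ennreal D * (ennreal 1 + ennreal A))"
      using v Iw by (intro mult_left_mono add_mono) auto
    also have "\<dots> = ennreal (B * (1 + A) * D)"
      using B A D by (subst ennreal_mult_add) (auto simp: ennreal_mult'[symmetric] mult_ac)
    finally have "norm (conv k j v x) \<le> B * (1 + A) * D"
      using B A D by (subst (asm) ennreal_le_iff) auto
    also have "\<dots> \<le> max 1 (B * (1 + A)) * D" using D by (intro mult_right_mono) auto
    finally show ?thesis unfolding D_def .
  qed
  then show thesis using that[of "max 1 (B * (1 + A))"] by auto
qed

section \<open>Summation over the scales\<close>

lemma sum_geometric_int_le:
  fixes a :: real
  assumes "0 < a" "finite J" "\<And>j. j \<in> J \<Longrightarrow> i \<le> j"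
  shows "(\<Sum>j\<in>J. 2 powr (- real_of_int j * a)) \<le> 2 powr (- real_of_int i * a) / (1 - 2 powr (- a))"
proof -
  define r where "r = 2 powr (- a)"
  have r: "0 < r" "r < 1" unfolding r_def using assms(1) by (auto simp: powr_less_one)
  let ?f = "\<lambda>j. nat (j - i)"
  have eq: "2 powr (- real_of_int j * a) = 2 powr (- real_of_int i * a) * r ^ ?f j" if "j \<in> J" for j
  proof -
    have "real (?f j) = real_of_int j - real_of_int i" using assms(3)[OF that] by simp
    then have "r ^ ?f j = 2 powr (- a * (real_of_int j - real_of_int i))"
      using r unfolding r_def by (simp add: powr_realpow[symmetric] powr_powr)
    then show ?thesis by (simp flip: powr_add) (simp add: algebra_simps)
  qed
  have inj: "inj_on ?f J"
  proof (rule inj_onI)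
    fix x y assume "x \<in> J" "y \<in> J" "?f x = ?f y"
    with assms(3)[of x] assms(3)[of y] show "x = y" by simp
  qed
  have "(\<Sum>j\<in>J. 2 powr (- real_of_int j * a)) = 2 powr (- real_of_int i * a) * (\<Sum>j\<in>J. r ^ ?f j)"
    unfolding sum_distrib_left by (intro sum.cong refl eq)
  also have "(\<Sum>j\<in>J. r ^ ?f j) = (\<Sum>m\<in>?f ` J. r ^ m)"
    using inj by (simp add: sum.reindex)
  also have "\<dots> \<le> (\<Sum>m. r ^ m)"
    using r assms(2) by (intro sum_le_suminf summable_geometric) auto
  also have "\<dots> = 1 / (1 - r)" using r by (intro suminf_geometric) auto
  finally show ?thesis unfolding r_def by (simp add: mult_left_mono)
qed

text \<open>Balance the bound by \<open>X\<close> against the bound by \<open>2\<^sup>j\<^sup>d\<close> at the scale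
  where they agree.\<close>

lemma hedberg_sum:
  fixes s d :: real
  assumes s: "0 < s" "s < d"
  obtains C where "1 \<le> C" "\<And>X J. 0 \<le> X \<Longrightarrow> finite J \<Longrightarrow>
    (\<Sum>j\<in>J. 2 powr (- real_of_int j * s) * min X (2 powr (real_of_int j * d))) \<le> C * X powr (1 - s / d)"
proof -
  define A where "A = 1 / (1 - 2 powr (- s))"
  define B where "B = 1 / (1 - 2 powr (- (d - s)))"
  have A: "0 \<le> A" and B: "0 \<le> B"
    unfolding A_def B_def using s by (auto simp: powr_less_one intro!: less_imp_le)
  have "(\<Sum>j\<in>J. 2 powr (- real_of_int j * s) * min X (2 powr (real_of_int j * d))) \<le> (max 1 (A + B)) * X powr (1 - s / d)"
    if X: "0 \<le> X" and J: "finite J" for X J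
  proof (cases "X = 0")
    case True
    then show ?thesis by simp
  next
    case False
    with X have X: "0 < X" by simp
    \<comment> \<open>The last scale with 2^(id) \<le> X. Above it the bound X is summed against
      2^(-js), at or below it the terms are at most 2^(j(d-s)); both are geometric since 0 < s <
      d.\<close>
    define i where "i = \<lfloor>log 2 X / d\<rfloor>"
    have d: "0 < d" using s by simp
    have lo: "2 powr (real_of_int i * d) \<le> X"
    proof -
      have "real_of_int i \<le> log 2 X / d" unfolding i_def by simp
      then have "real_of_int i * d \<le> log 2 X" using d by (simp add: field_simps)
      then have "2 powr (real_of_int i * d) \<le> 2 powr (log 2 X)" by (intro powr_mono) auto
      then show ?thesis using X by simp
    qed
    have hi: "X \<le> 2 powr (real_of_int (i + 1) * d)"
    proof -
      have "log 2 X / d \<le> real_of_int (i + 1)" unfolding i_def by linarith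
      then have "log 2 X \<le> real_of_int (i + 1) * d" using d by (simp add: field_simps)
      then have "2 powr (log 2 X) \<le> 2 powr (real_of_int (i + 1) * d)" by (intro powr_mono) auto
      then show ?thesis using X by simp
    qed
    let ?t = "\<lambda>j. 2 powr (- real_of_int j * s) * min X (2 powr (real_of_int j * d))"
    have "(\<Sum>j\<in>J. ?t j) = (\<Sum>j\<in>{j\<in>J. i + 1 \<le> j}. ?t j) + (\<Sum>j\<in>{j\<in>J. \<not> i + 1 \<le> j}. ?t j)"
      using J by (subst sum.union_disjoint[symmetric]) (auto intro!: sum.cong)
    also have "(\<Sum>j\<in>{j\<in>J. i + 1 \<le> j}. ?t j) \<le> A * X powr (1 - s / d)"
    proof -
      have "(\<Sum>j\<in>{j\<in>J. i + 1 \<le> j}. ?t j) \<le> (\<Sum>j\<in>{j\<in>J. i + 1 \<le> j}. 2 powr (- real_of_int j * s) * X)"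
        by (intro sum_mono mult_left_mono) auto
      also have "\<dots> = (\<Sum>j\<in>{j\<in>J. i + 1 \<le> j}. 2 powr (- real_of_int j * s)) * X" by (simp add: sum_distrib_right)
      also have "\<dots> \<le> (2 powr (- real_of_int (i + 1) * s) / (1 - 2 powr (- s))) * X"
        using X J s by (intro mult_right_mono sum_geometric_int_le) auto
      also have "\<dots> \<le> (X powr (- s / d) / (1 - 2 powr (- s))) * X"
      proof (intro mult_right_mono divide_right_mono)
        have "(2 powr (real_of_int (i + 1) * d)) powr (- s / d) \<le> X powr (- s / d)"
          using X hi s by (intro powr_mono2') (auto simp: divide_nonpos_nonneg)
        moreover have "real_of_int (i + 1) * d * (- s / d) = - real_of_int (i + 1) * s" using d by (simp add: algebra_simps)
        ultimately show "2 powr (- real_of_int (i + 1) * s) \<le> X powr (- s / d)"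
          by (simp only: powr_powr)
      qed (use X s in \<open>auto simp: powr_less_one intro: less_imp_le\<close>)
      also have "\<dots> = A * (X powr (- s / d) * X powr 1)" unfolding A_def using X by simp
      also have "X powr (- s / d) * X powr 1 = X powr (1 - s / d)"
        unfolding powr_add[symmetric] by simp
      finally show ?thesis .
    qed
    also have "(\<Sum>j\<in>{j\<in>J. \<not> i + 1 \<le> j}. ?t j) \<le> B * X powr (1 - s / d)"
    proof -
      have "(\<Sum>j\<in>{j\<in>J. \<not> i + 1 \<le> j}. ?t j) \<le> (\<Sum>j\<in>{j\<in>J. \<not> i + 1 \<le> j}. 2 powr (- real_of_int (- j) * (d - s)))"
      proof (intro sum_mono)
        fix j
        have "?t j \<le> 2 powr (- real_of_int j * s) * 2 powr (real_of_int j * d)" by (intro mult_left_mono) auto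
        also have "\<dots> = 2 powr (- real_of_int (- j) * (d - s))" by (simp flip: powr_add) (simp add: algebra_simps)
        finally show "?t j \<le> 2 powr (- real_of_int (- j) * (d - s))" .
      qed
      \<comment> \<open>Reflecting j turns the sum over coarse scales into one over indices bounded
        below, so the same geometric estimate applies.\<close>
      also have "\<dots> = (\<Sum>j\<in>uminus ` {j\<in>J. \<not> i + 1 \<le> j}. 2 powr (- real_of_int j * (d - s)))"
        by (subst sum.reindex) auto
      also have "\<dots> \<le> 2 powr (- real_of_int (- i) * (d - s)) / (1 - 2 powr (- (d - s)))"
        using J s by (intro sum_geometric_int_le) auto
      also have "\<dots> \<le> X powr (1 - s / d) / (1 - 2 powr (- (d - s)))"
      proof (intro divide_right_mono)
        have "(2 powr (real_of_int i * d)) powr (1 - s / d) \<le> X powr (1 - s / d)"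
          using X lo s by (intro powr_mono2) auto
        moreover have "real_of_int i * d * (1 - s / d) = - real_of_int (- i) * (d - s)"
          using d by (simp add: field_simps)
        ultimately show "2 powr (- real_of_int (- i) * (d - s)) \<le> X powr (1 - s / d)"
          by (simp add: powr_powr)
      qed (use s in \<open>auto simp: powr_less_one intro: less_imp_le\<close>)
      finally show ?thesis unfolding B_def by simp
    qed
    finally have "(\<Sum>j\<in>J. ?t j) \<le> (A + B) * X powr (1 - s / d)" by (simp add: distrib_right)
    also have "\<dots> \<le> max 1 (A + B) * X powr (1 - s / d)" by (intro mult_right_mono) auto
    finally show ?thesis .
  qed
  then show thesis using that[of "max 1 (A + B)"] by auto
qed

section \<open>The dyadic potential\<close>

definition potential_sum ::
    "(real ^ 'n \<Rightarrow> complex) \<Rightarrow> real \<Rightarrow> (real ^ 'n \<Rightarrow> complex) \<Rightarrow> nat \<Rightarrow> real ^ 'n \<Rightarrow> complex" where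
  "potential_sum k s v N x = (\<Sum>j\<in>{- int N..int N}. complex_of_real (2 powr (- real_of_int j * s)) * conv k j v x)"

text \<open>\<open>lim\<close> is unspecified where the partial sums diverge; this keeps the
  function Borel measurable, and convergence is established almost everywhere where it is
  needed.\<close>

definition potential ::
    "(real ^ 'n \<Rightarrow> complex) \<Rightarrow> real \<Rightarrow> (real ^ 'n \<Rightarrow> complex) \<Rightarrow> real ^ 'n \<Rightarrow> complex" where
  "potential k s v x = lim (\<lambda>N. potential_sum k s v N x)"

lemma measurable_potential [measurable]:
  assumes [measurable]: "k \<in> borel_measurable borel" "v \<in> borel_measurable borel"
  shows "potential k s v \<in> borel_measurable borel"
  unfolding potential_def[abs_def] potential_sum_def[abs_def] by measurable

text \<open>Lets unconditional summability over the integers yield convergence of the symmetric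
  partial sums, which are the ones that telescope.\<close>

lemma filterlim_symmetric_interval: "filterlim (\<lambda>N. {- int N..int N}) (finite_subsets_at_top UNIV) sequentially"
  unfolding filterlim_finite_subsets_at_top
proof (intro allI impI)
  fix X :: "int set" assume "finite X \<and> X \<subseteq> UNIV"
  then have X: "finite X" by simp
  define m where "m = (\<Sum>i\<in>X. nat \<bar>i\<bar>)"
  have "X \<subseteq> {- int N..int N}" if "m \<le> N" for N
  proof
    fix i assume "i \<in> X"
    then have "nat \<bar>i\<bar> \<le> m" unfolding m_def using X by (intro member_le_sum) auto
    with that show "i \<in> {- int N..int N}" by auto
  qed
  then show "\<forall>\<^sub>F N in sequentially. finite {- int N..int N} \<and> X \<subseteq> {- int N..int N} \<and> {- int N..int N} \<subseteq> UNIV"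
    by (auto intro!: eventually_sequentiallyI)
qed

text \<open>The j-th term is at most C1 2^(-js) min(X, 2^(jd)) with d = n / q, so the series
  converges absolutely, and s / d = s q / n is what the exponent of X loses. Normalising v to
  modular at most 1 removes its norm from the estimate.\<close>

lemma potential_bound:
  fixes k :: "real ^ 'n \<Rightarrow> complex" and q s :: real
  assumes k: "decays k" "k \<in> borel_measurable borel" and q: "1 < q" and s: "0 < s" "s < CARD('n) / q"
  obtains C where "1 \<le> C" "\<And>v x X. v \<in> borel_measurable borel \<Longrightarrow>
    (\<integral>\<^sup>+y. ennreal (norm (v y) powr q) \<partial>lborel) \<le> 1 \<Longrightarrow> 0 \<le> X \<Longrightarrow> (\<And>j. norm (conv k j v x) \<le> X) \<Longrightarrow>
    (\<lambda>N. potential_sum k s v N x) \<longlonglongrightarrow> potential k s v x \<and>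
    norm (potential k s v x) \<le> C * X powr (1 - s * q / CARD('n))"
proof -
  define d where "d = CARD('n) / q"
  obtain C1 where C1: "1 \<le> C1" "\<And>v j x. v \<in> borel_measurable borel \<Longrightarrow>
    (\<integral>\<^sup>+y. ennreal (norm (v y) powr q) \<partial>lborel) \<le> 1 \<Longrightarrow>
    norm (conv k j v x) \<le> C1 * 2 powr (real_of_int j * d)"
    unfolding d_def using conv_le_Lp[OF k q] by blast
  obtain C2 where C2: "1 \<le> C2" "\<And>X J. 0 \<le> X \<Longrightarrow> finite J \<Longrightarrow>
    (\<Sum>j\<in>J. 2 powr (- real_of_int j * s) * min X (2 powr (real_of_int j * d))) \<le> C2 * X powr (1 - s / d)"
    using hedberg_sum[of s d] s unfolding d_def by blast
  have "(\<lambda>N. potential_sum k s v N x) \<longlonglongrightarrow> potential k s v x \<and>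
    norm (potential k s v x) \<le> C1 * C2 * X powr (1 - s * q / CARD('n))"
    if v: "v \<in> borel_measurable borel" "(\<integral>\<^sup>+y. ennreal (norm (v y) powr q) \<partial>lborel) \<le> 1"
      and X: "0 \<le> X" "\<And>j. norm (conv k j v x) \<le> X" for v x X
  proof -
    define a where "a j = complex_of_real (2 powr (- real_of_int j * s)) * conv k j v x" for j
    have na: "norm (a j) \<le> C1 * (2 powr (- real_of_int j * s) * min X (2 powr (real_of_int j * d)))" for j
    proof -
      have "norm (conv k j v x) \<le> C1 * min X (2 powr (real_of_int j * d))"
        using C1(1) C1(2)[OF v, of j x] X(2)[of j] mult_right_mono[OF C1(1) X(1)]
        by (auto simp: min_def)
      then have "2 powr (- real_of_int j * s) * norm (conv k j v x) \<le> 2 powr (- real_of_int j * s) * (C1 * min X (2 powr (real_of_int j * d)))"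
        by (intro mult_left_mono) auto
      then show ?thesis unfolding a_def norm_mult by (simp add: mult_ac)
    qed
    have sum_le: "(\<Sum>j\<in>J. norm (a j)) \<le> C1 * C2 * X powr (1 - s / d)" if "finite J" for J
    proof -
      have "(\<Sum>j\<in>J. norm (a j)) \<le> (\<Sum>j\<in>J. C1 * (2 powr (- real_of_int j * s) * min X (2 powr (real_of_int j * d))))"
        by (intro sum_mono na)
      also have "\<dots> = C1 * (\<Sum>j\<in>J. 2 powr (- real_of_int j * s) * min X (2 powr (real_of_int j * d)))"
        by (simp add: sum_distrib_left)
      also have "\<dots> \<le> C1 * (C2 * X powr (1 - s / d))"
        using C1(1) C2(2)[OF X(1) that] by (intro mult_left_mono) auto
      finally show ?thesis by simp
    qed
    have "(\<lambda>j. norm (a j)) summable_on UNIV"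
      using sum_le by (intro nonneg_bdd_above_summable_on bdd_aboveI) auto
    then have "a summable_on UNIV" by (rule abs_summable_summable)
    then have "(a has_sum infsum a UNIV) UNIV" by simp
    then have "(\<lambda>N. sum a {- int N..int N}) \<longlonglongrightarrow> infsum a UNIV"
      unfolding has_sum_def by (rule filterlim_compose[OF _ filterlim_symmetric_interval])
    then have "(\<lambda>N. potential_sum k s v N x) \<longlonglongrightarrow> infsum a UNIV"
      unfolding potential_sum_def a_def .
    then have lim': "(\<lambda>N. potential_sum k s v N x) \<longlonglongrightarrow> potential k s v x"
      unfolding potential_def by (simp add: limI)
    have "norm (potential k s v x) \<le> C1 * C2 * X powr (1 - s / d)"
    proof (rule Lim_bounded[OF tendsto_norm[OF lim']])
      show "\<forall>N\<ge>0. norm (potential_sum k s v N x) \<le> C1 * C2 * X powr (1 - s / d)"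
        unfolding potential_sum_def a_def[symmetric] by (auto intro!: order_trans[OF norm_sum sum_le])
    qed
    then show ?thesis using lim' unfolding d_def by simp
  qed
  moreover have "1 \<le> C1 * C2" using C1(1) C2(1) mult_mono[of 1 C1 1 C2] by simp
  ultimately show thesis using that[of "C1 * C2"] by blast
qed

text \<open>v and w have the same convolutions: v supplies X through its maximal function, w the
  bound in L^q. The exponent P / (1 - \<theta>) undoes the power 1 - \<theta>. Boundedness of the
  maximal operator is a hypothesis, so that the variable exponent and the constant one are both
  instances.\<close>

lemma potential_modular:
  fixes k :: "real ^ 'n \<Rightarrow> complex" and q s b Cm :: real and P :: "real ^ 'n \<Rightarrow> real"
  assumes k: "decays k" "k \<in> borel_measurable borel" and q: "1 < q" and s: "0 < s" "s < CARD('n) / q"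
    and P: "P \<in> borel_measurable borel" "\<And>x. 1 \<le> P x" "\<And>x. P x \<le> b"
    and M: "\<And>f. f \<in> borel_measurable borel \<Longrightarrow> (\<And>x. 0 \<le> f x) \<Longrightarrow>
      (\<integral>\<^sup>+x. ennreal (f x powr P x) \<partial>lborel) \<le> 1 \<Longrightarrow>
      (AE x in lborel. maximal (\<lambda>y. ennreal (f y)) x < \<top>) \<and>
      (\<integral>\<^sup>+x. ennreal (enn2real (maximal (\<lambda>y. ennreal (f y)) x) powr P x) \<partial>lborel) \<le> ennreal Cm"
    and Cm: "0 \<le> Cm"
  obtains C where "0 \<le> C" "\<And>v w. v \<in> borel_measurable borel \<Longrightarrow> w \<in> borel_measurable borel \<Longrightarrow>
    (\<integral>\<^sup>+y. ennreal (norm (v y) powr P y) \<partial>lborel) \<le> 1 \<Longrightarrow>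
    (\<integral>\<^sup>+y. ennreal (norm (w y) powr q) \<partial>lborel) \<le> 1 \<Longrightarrow>
    (\<And>j x. conv k j v x = conv k j w x) \<Longrightarrow>
    (AE x in lborel. (\<lambda>N. potential_sum k s w N x) \<longlonglongrightarrow> potential k s w x) \<and>
    (\<integral>\<^sup>+x. ennreal (norm (potential k s w x) powr (P x / (1 - s * q / CARD('n)))) \<partial>lborel) \<le> ennreal C"
proof -
  define \<theta> where "\<theta> = s * q / CARD('n)"
  have \<theta>: "0 < 1 - \<theta>" using s q unfolding \<theta>_def by (simp add: field_simps)
  obtain C1 where C1: "1 \<le> C1" "\<And>v j x. v \<in> borel_measurable borel \<Longrightarrow>
    ennreal (norm (conv k j v x)) \<le> ennreal C1 * maximal (\<lambda>y. ennreal (norm (v y))) x"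
    using conv_le_maximal[OF k] by blast
  obtain C2 where C2: "1 \<le> C2" "\<And>v x X. v \<in> borel_measurable borel \<Longrightarrow>
    (\<integral>\<^sup>+y. ennreal (norm (v y) powr q) \<partial>lborel) \<le> 1 \<Longrightarrow> 0 \<le> X \<Longrightarrow> (\<And>j. norm (conv k j v x) \<le> X) \<Longrightarrow>
    (\<lambda>N. potential_sum k s v N x) \<longlonglongrightarrow> potential k s v x \<and>
    norm (potential k s v x) \<le> C2 * X powr (1 - \<theta>)"
    unfolding \<theta>_def using potential_bound[OF k q s] by blast
  define C where "C = C2 powr (b / (1 - \<theta>)) * C1 powr b"
  have C0: "0 \<le> C" unfolding C_def by simp
  have "(AE x in lborel. (\<lambda>N. potential_sum k s w N x) \<longlonglongrightarrow> potential k s w x) \<and>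
    (\<integral>\<^sup>+x. ennreal (norm (potential k s w x) powr (P x / (1 - \<theta>))) \<partial>lborel) \<le> ennreal (C * Cm)"
    if v: "v \<in> borel_measurable borel" and w: "w \<in> borel_measurable borel"
      and v1: "(\<integral>\<^sup>+y. ennreal (norm (v y) powr P y) \<partial>lborel) \<le> 1"
      and w1: "(\<integral>\<^sup>+y. ennreal (norm (w y) powr q) \<partial>lborel) \<le> 1"
      and eq: "\<And>j x. conv k j v x = conv k j w x" for v w
  proof -
    note [measurable] = v w k(2) P(1)
    define m where "m x = enn2real (maximal (\<lambda>y. ennreal (norm (v y))) x)" for x
    have [measurable]: "m \<in> borel_measurable borel" unfolding m_def by measurable
    have m0: "0 \<le> m x" for x unfolding m_def by simp
    have fin: "AE x in lborel. maximal (\<lambda>y. ennreal (norm (v y))) x < \<top>"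
      and mod: "(\<integral>\<^sup>+x. ennreal (m x powr P x) \<partial>lborel) \<le> ennreal Cm"
      unfolding m_def using M[of "\<lambda>y. norm (v y)"] v1 by auto
    have *: "(\<lambda>N. potential_sum k s w N x) \<longlonglongrightarrow> potential k s w x \<and>
        norm (potential k s w x) powr (P x / (1 - \<theta>)) \<le> C * m x powr P x"
      if x: "maximal (\<lambda>y. ennreal (norm (v y))) x < \<top>" for x
    proof -
      have cw: "norm (conv k j w x) \<le> C1 * m x" for j
      proof -
        have "ennreal (norm (conv k j w x)) \<le> ennreal C1 * maximal (\<lambda>y. ennreal (norm (v y))) x"
          unfolding eq[symmetric] by (rule C1(2)[OF v])
        also have "maximal (\<lambda>y. ennreal (norm (v y))) x = ennreal (m x)" using x unfolding m_def by simp
        also have "ennreal C1 * ennreal (m x) = ennreal (C1 * m x)" using C1(1) by (simp add: ennreal_mult')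
        finally show ?thesis using C1(1) m0[of x] by (subst (asm) ennreal_le_iff) auto
      qed
      have X: "0 \<le> C1 * m x" using C1(1) m0[of x] by simp
      note pb = C2(2)[OF w w1 X cw]
      have "norm (potential k s w x) powr (P x / (1 - \<theta>)) \<le> (C2 * (C1 * m x) powr (1 - \<theta>)) powr (P x / (1 - \<theta>))"
        using pb P(2)[of x] \<theta> by (intro powr_mono2) auto
      also have "\<dots> = C2 powr (P x / (1 - \<theta>)) * (C1 powr P x * m x powr P x)"
        using C2(1) C1(1) m0[of x] \<theta> by (simp add: powr_mult powr_powr)
      also have "\<dots> \<le> C2 powr (b / (1 - \<theta>)) * (C1 powr b * m x powr P x)"
        using C2(1) C1(1) P(3)[of x] \<theta> by (intro mult_mono powr_mono divide_right_mono mult_right_mono) auto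
      also have "\<dots> = C * m x powr P x" unfolding C_def by simp
      finally show ?thesis using pb by simp
    qed
    have "AE x in lborel. (\<lambda>N. potential_sum k s w N x) \<longlonglongrightarrow> potential k s w x"
      using fin by eventually_elim (use * in blast)
    moreover have "(\<integral>\<^sup>+x. ennreal (norm (potential k s w x) powr (P x / (1 - \<theta>))) \<partial>lborel)
        \<le> (\<integral>\<^sup>+x. ennreal C * ennreal (m x powr P x) \<partial>lborel)"
    proof (rule nn_integral_mono_AE)
      show "AE x in lborel. ennreal (norm (potential k s w x) powr (P x / (1 - \<theta>))) \<le> ennreal C * ennreal (m x powr P x)"
        using fin
      proof eventually_elim
        case (elim x)
        then show ?case using *[OF elim] C0 by (simp add: ennreal_mult'[symmetric] ennreal_leI)
      qed
    qed
    moreover have "(\<integral>\<^sup>+x. ennreal C * ennreal (m x powr P x) \<partial>lborel) = ennreal C * (\<integral>\<^sup>+x. ennreal (m x powr P x) \<partial>lborel)"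
      by (intro nn_integral_cmult) measurable
    moreover have "\<dots> \<le> ennreal C * ennreal Cm" by (intro mult_left_mono mod) auto
    moreover have "ennreal C * ennreal Cm = ennreal (C * Cm)" using C0 by (simp add: ennreal_mult')
    ultimately show ?thesis by auto
  qed
  then show thesis using that[of "C * Cm"] C0 Cm unfolding \<theta>_def by auto
qed

section \<open>Exponents and representing functions\<close>

text \<open>The log-Hoelder bound makes 1/p continuous, so the essential bounds hold everywhere and
  p is real valued. Passing from 1/p to p costs the factor b^2, since |1/u - 1/w| = |u - w| / (u
  w).\<close>

lemma finite_exponent_representation:
  fixes p :: "real ^ 'n \<Rightarrow> ereal"
  assumes "p \<in> log_exponents" "1 < exponent_inf p" "exponent_sup p < \<infinity>"
  obtains P q b L Pinf where "p = (\<lambda>x. ereal (P x))" "continuous_on UNIV P" "1 < q"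
    "\<And>x. q \<le> P x" "\<And>x. P x \<le> b" "0 \<le> L"
    "\<And>x y. \<bar>P x - P y\<bar> \<le> L / ln (exp 1 + 1 / norm (x - y))"
    "\<And>x. \<bar>P x - Pinf\<bar> \<le> L / ln (exp 1 + norm x)"
proof -
  have p1: "\<And>x. 1 \<le> p x"
    using assms(1) unfolding log_exponents_def exponents_def by auto
  define r where "r x = real_of_ereal (1 / p x)" for x
  obtain C q0 where C: "\<And>x y. \<bar>r x - r y\<bar> \<le> C / ln (exp 1 + 1 / norm (x - y))"
    and lim: "(r \<longlongrightarrow> q0) at_infinity" and Cinf: "\<And>x. \<bar>r x - q0\<bar> \<le> C / ln (exp 1 + norm x)"
    using assms(1) unfolding log_exponents_def r_def by blast
  have C0: "0 \<le> C" using Cinf[of 0] by simp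
  have "continuous_on UNIV r"
  proof -
    have "isCont r x" for x
      unfolding isCont_def
    proof (rule Lim_null[THEN iffD2], rule Lim_null_comparison)
      show "\<forall>\<^sub>F y in at x. norm (r y - r x) \<le> C / ln (exp 1 + 1 / norm (y - x))"
        using C by (intro always_eventually) auto
      have "filterlim (\<lambda>y. norm (y - x)) (at_right 0) (at x)"
        unfolding filterlim_at
        by (auto intro!: tendsto_eq_intros simp: eventually_at_filter)
      then have "filterlim (\<lambda>y. inverse (norm (y - x))) at_top (at x)"
        by (rule filterlim_compose[OF filterlim_inverse_at_top_right])
      then have "filterlim (\<lambda>y. exp 1 + inverse (norm (y - x))) at_top (at x)"
        by (rule filterlim_tendsto_add_at_top[OF tendsto_const])
      then have "filterlim (\<lambda>y. ln (exp 1 + inverse (norm (y - x)))) at_top (at x)"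
        by (rule filterlim_compose[OF ln_at_top])
      then show "((\<lambda>y. C / ln (exp 1 + 1 / norm (y - x))) \<longlongrightarrow> 0) (at x)"
        unfolding inverse_eq_divide by (intro tendsto_divide_0[OF tendsto_const] filterlim_at_top_imp_at_infinity)
    qed
    then show ?thesis by (simp add: continuous_on_eq_continuous_at)
  qed
  have rep: "p x = ereal (1 / r x) \<and> r x > 0" if "p x < \<infinity>" for x
    using that p1[of x] unfolding r_def by (cases "p x") (auto simp: one_ereal_def divide_ereal_def divide_inverse)
  obtain b where b: "exponent_sup p \<le> ereal b" "1 \<le> b"
  proof -
    have "\<exists>b. exponent_sup p \<le> ereal b \<and> 1 \<le> b"
    proof (cases "exponent_sup p")
      case (real b)
      then show ?thesis by (intro exI[of _ "max 1 b"]) auto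
    qed (use assms(3) in \<open>auto intro: exI[of _ 1]\<close>)
    then show thesis using that by blast
  qed
  \<comment> \<open>A number strictly between 1 and the essential infimum, taken by density so that
    it is finite.\<close>
  obtain q where q: "1 < q" "ereal q \<le> exponent_inf p"
  proof -
    obtain z where "1 < z" "z < exponent_inf p" using dense[OF assms(2)] by blast
    then show thesis using that[of "real_of_ereal z"] by (cases z) (auto simp: one_ereal_def)
  qed
  have AEb: "AE x in lebesgue. p x \<le> ereal b"
    using esssup_AE[where M = lebesgue and f = p] b(1) unfolding exponent_sup_def by (auto elim!: eventually_mono)
  have AEq: "AE x in lebesgue. ereal q \<le> p x"
    using esssup_AE[where M = lebesgue and f = "\<lambda>x. - p x"]
  proof eventually_elim
    case (elim x)
    have "ereal q \<le> - esssup lebesgue (\<lambda>x. - p x)" using q(2) unfolding exponent_inf_def .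
    also have "\<dots> \<le> p x" using elim by (simp add: ereal_uminus_le_reorder)
    finally show ?case .
  qed
  have AEr: "AE x in lebesgue. r x \<in> {1 / b..1 / q}"
    using AEb AEq
  proof eventually_elim
    case (elim x)
    then have "p x < \<infinity>" by auto
    with rep[OF this] elim b(2) q(1) show ?case by (auto simp: field_simps)
  qed
  have closed: "closed (r -` {1 / b..1 / q})"
    using \<open>continuous_on UNIV r\<close> by (intro continuous_closed_vimage) (auto simp: continuous_on_eq_continuous_at)
  \<comment> \<open>A closed set of full measure is the whole space, which removes the exceptional
    null set.\<close>
  have rbq: "r x \<in> {1 / b..1 / q}" for x
  proof -
    have "AE x in lebesgue. x \<in> r -` {1 / b..1 / q}" using AEr by (simp only: vimage_eq)
    from mem_closed_if_AE_lebesgue[OF closed this] show ?thesis by (simp only: vimage_eq)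
  qed
  have r0: "0 < r x" for x
  proof -
    have "0 < 1 / b" using b(2) by simp
    also have "1 / b \<le> r x" using rbq[of x] by simp
    finally show ?thesis .
  qed
  define P where "P x = 1 / r x" for x
  have pP: "p x = ereal (P x)" for x
  proof -
    have "p x \<noteq> \<infinity>"
    proof
      assume "p x = \<infinity>"
      then have "r x = 0" unfolding r_def by simp
      with r0[of x] show False by simp
    qed
    then show ?thesis using rep[of x] unfolding P_def by (auto simp: less_top)
  qed
  have Pq: "q \<le> P x" and Pb: "P x \<le> b" for x
  proof -
    have "r x * q \<le> 1" "1 \<le> r x * b"
      using rbq[of x] q(1) b(2) by (simp_all add: pos_le_divide_eq pos_divide_le_eq)
    then show "q \<le> P x" "P x \<le> b"
      using r0[of x] unfolding P_def by (simp_all add: pos_le_divide_eq pos_divide_le_eq mult.commute)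
  qed
  \<comment> \<open>The lower bound passes to the limit, so the exponent at infinity is finite as
    well.\<close>
  have q0: "1 / b \<le> q0"
    by (rule tendsto_lowerbound[OF lim]) (use rbq in \<open>auto simp: trivial_limit_at_infinity intro!: always_eventually\<close>)
  have "0 < 1 / b" using b(2) by simp
  also note q0
  finally have q00: "0 < q0" .
  define Pinf where "Pinf = 1 / q0"
  have Pinf: "Pinf \<le> b" "0 < Pinf" 
    unfolding Pinf_def using q0 q00 b(2) by (simp_all add: pos_divide_le_eq mult.commute)
  have inv: "\<bar>1 / u - 1 / w\<bar> \<le> b * b * \<bar>u - w\<bar>" if "0 < u" "0 < w" "1 / u \<le> b" "1 / w \<le> b" for u w :: real
  proof -
    have "\<bar>1 / u - 1 / w\<bar> = 1 / u * (1 / w) * \<bar>u - w\<bar>"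
      using that by (simp add: diff_frac_eq abs_divide abs_mult abs_minus_commute)
    also have "\<dots> \<le> b * b * \<bar>u - w\<bar>" using that b(2) by (intro mult_right_mono mult_mono) auto
    finally show ?thesis .
  qed
  show thesis
  proof (rule that[of P q b "b * b * C" Pinf])
    show "p = (\<lambda>x. ereal (P x))" using pP by auto
    show "continuous_on UNIV P"
      unfolding P_def[abs_def] using r0 \<open>continuous_on UNIV r\<close> by (intro continuous_intros) (auto simp: less_imp_neq[symmetric])
    show "\<bar>P x - P y\<bar> \<le> b * b * C / ln (exp 1 + 1 / norm (x - y))" for x y
    proof -
      have "\<bar>P x - P y\<bar> \<le> b * b * \<bar>r x - r y\<bar>"
        unfolding P_def using r0 Pb[unfolded P_def] by (intro inv) auto
      also have "\<dots> \<le> b * b * (C / ln (exp 1 + 1 / norm (x - y)))" using C by (intro mult_left_mono) auto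
      finally show ?thesis by simp
    qed
    show "\<bar>P x - Pinf\<bar> \<le> b * b * C / ln (exp 1 + norm x)" for x
    proof -
      have "\<bar>P x - Pinf\<bar> \<le> b * b * \<bar>r x - q0\<bar>"
        unfolding P_def Pinf_def using r0 Pb[unfolded P_def] q00 Pinf[unfolded Pinf_def] by (intro inv) auto
      also have "\<dots> \<le> b * b * (C / ln (exp 1 + norm x))" using Cinf by (intro mult_left_mono) auto
      finally show ?thesis by simp
    qed
  qed (use q Pq Pb C0 in auto)
qed

section \<open>Borel versions and witnesses for the norms\<close>

lemma lebesgue_borel_version:
  fixes f :: "real ^ 'n \<Rightarrow> complex"
  assumes "f \<in> borel_measurable lebesgue"
  obtains g where "g \<in> borel_measurable borel" "AE x in lborel. f x = g x"
proof -
  have m: "(\<lambda>x. Re (f x)) \<in> borel_measurable lebesgue" "(\<lambda>x. Im (f x)) \<in> borel_measurable lebesgue"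
    using assms by measurable
  obtain a where a: "a \<in> borel_measurable lborel" "AE x in lborel. Re (f x) = a x"
    using completion_ex_borel_measurable_real[OF m(1)] by blast
  obtain c where c: "c \<in> borel_measurable lborel" "AE x in lborel. Im (f x) = c x"
    using completion_ex_borel_measurable_real[OF m(2)] by blast
  show thesis
  proof (rule that[of "\<lambda>x. Complex (a x) (c x)"])
    have [measurable]: "a \<in> borel_measurable borel" "c \<in> borel_measurable borel" using a(1) c(1) by simp_all
    show "(\<lambda>x. Complex (a x) (c x)) \<in> borel_measurable borel"
      unfolding Complex_eq by measurable
    show "AE x in lborel. f x = Complex (a x) (c x)"
      using a(2) c(2) by eventually_elim (simp add: complex_eq_iff)
  qed
qed

text \<open>Distributions are represented over \<open>lebesgue\<close>, whereas maximal functions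
  and convolutions are set up over \<open>lborel\<close>; an almost everywhere equal Borel function
  carries all pairings over.\<close>

lemma represents_borel:
  fixes u :: "(real ^ 'n::finite \<Rightarrow> complex) \<Rightarrow> complex"
  assumes "represents f u"
  obtains g where "g \<in> borel_measurable borel" "AE x in lborel. f x = g x"
    "\<And>\<phi>. \<phi> \<in> schwartz \<Longrightarrow> u \<phi> = (LINT x|lborel. g x * \<phi> x)"
proof -
  have f: "f \<in> borel_measurable lebesgue" using assms unfolding represents_def by blast
  obtain g where g: "g \<in> borel_measurable borel" "AE x in lborel. f x = g x"
    using lebesgue_borel_version[OF f] by blast
  note [measurable] = g(1)
  show thesis
  proof (rule that[OF g])
    fix \<phi> :: "real ^ 'n \<Rightarrow> complex" assume \<phi>: "\<phi> \<in> schwartz"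
    note [measurable] = schwartz_measurable[OF \<phi>]
    have "u \<phi> = (LINT x|lebesgue. f x * \<phi> x)"
      using assms \<phi> unfolding represents_def regular_dist_def by blast
    also have "\<dots> = (LINT x|lebesgue. g x * \<phi> x)"
    proof (rule integral_cong_AE)
      show "(\<lambda>x. f x * \<phi> x) \<in> borel_measurable lebesgue"
        using f measurable_completion[of \<phi> lborel borel] by (intro borel_measurable_times) auto
      show "(\<lambda>x. g x * \<phi> x) \<in> borel_measurable lebesgue"
        by (intro measurable_completion) simp
      show "AE x in lebesgue. f x * \<phi> x = g x * \<phi> x"
        using AE_completion[OF g(2)] by eventually_elim simp
    qed
    also have "\<dots> = (LINT x|lborel. g x * \<phi> x)" by (rule integral_completion) simp
    finally show "u \<phi> = (LINT x|lborel. g x * \<phi> x)" .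
  qed
qed

lemma regular_dist_lborel:
  "\<phi> \<in> schwartz \<Longrightarrow> \<psi> \<in> schwartz \<Longrightarrow> regular_dist \<phi> \<psi> = (LINT x|lborel. \<phi> x * \<psi> x)"
  unfolding regular_dist_def using schwartz_measurable[of \<phi>] schwartz_measurable[of \<psi>]
  by (intro integral_completion borel_measurable_times) auto

text \<open>A strict inequality supplies witnesses in all three nested infima: the version v, its
  function, and an admissible c < a. Dividing by a instead of c can only decrease the modular, since
  the exponents are nonnegative.\<close>

lemma W_norm_less:
  fixes u :: "(real ^ 'n::finite \<Rightarrow> complex) \<Rightarrow> complex" and P :: "real ^ 'n \<Rightarrow> real"
  assumes "W_norm s p u < ennreal a" and p: "p = (\<lambda>x. ereal (P x))" and P: "\<And>x. 0 \<le> P x"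
  obtains v g where "frac_laplacian s u v" "g \<in> borel_measurable borel"
    "\<And>\<phi>. \<phi> \<in> schwartz \<Longrightarrow> v \<phi> = (LINT x|lborel. g x * \<phi> x)"
    "(\<integral>\<^sup>+x. ennreal (norm (complex_of_real (1 / a) * g x) powr P x) \<partial>lborel) \<le> 1"
proof -
  obtain v where v: "frac_laplacian s u v" "Lp_norm p v < ennreal a"
    using assms(1) unfolding W_norm_def by (auto simp: Inf_less_iff)
  obtain f where f: "represents f v" "lux_norm p f < ennreal a"
    using v(2) unfolding Lp_norm_def by (auto simp: Inf_less_iff)
  obtain c where c: "0 < c" "c < a"
    "(\<integral>\<^sup>+x. ennreal (norm (f x / complex_of_real c) powr P x) \<partial>lebesgue) \<le> 1"
    using f(2) unfolding lux_norm_def p by (auto simp: Inf_less_iff ennreal_less_iff)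
  obtain g where g: "g \<in> borel_measurable borel" "AE x in lborel. f x = g x"
    "\<And>\<phi>. \<phi> \<in> schwartz \<Longrightarrow> v \<phi> = (LINT x|lborel. g x * \<phi> x)"
    using represents_borel[OF f(1)] by blast
  have "(\<integral>\<^sup>+x. ennreal (norm (complex_of_real (1 / a) * g x) powr P x) \<partial>lborel)
      \<le> (\<integral>\<^sup>+x. ennreal (norm (f x / complex_of_real c) powr P x) \<partial>lborel)"
  proof (rule nn_integral_mono_AE)
    show "AE x in lborel. ennreal (norm (complex_of_real (1 / a) * g x) powr P x) \<le> ennreal (norm (f x / complex_of_real c) powr P x)"
      using g(2)
    proof eventually_elim
      case (elim x)
      have "norm (g x) / a \<le> norm (f x) / c" unfolding elim using c by (intro divide_left_mono) auto
      then show ?case using c P by (intro ennreal_leI powr_mono2) (auto simp: norm_mult norm_divide)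
    qed
  qed
  also have "\<dots> \<le> 1" using c(3) by (simp only: nn_integral_completion)
  finally show thesis using that v(1) g by blast
qed

section \<open>The dyadic representation\<close>

text \<open>The symbols of the telescoping decomposition: \<open>\<chi>(2\<^sup>-\<^sup>j\<xi>) - \<chi>(2\<^sup>1\<^sup>-\<^sup>j\<xi>) = |\<xi>|\<^sup>s \<kappa>\<^sub>j(\<xi>)\<close>, where
  \<open>\<kappa>\<^sub>j(\<xi>) = 2\<^sup>-\<^sup>j\<^sup>s \<kappa>(2\<^sup>-\<^sup>j\<xi>)\<close> vanishes near the origin.\<close>

definition low_pass :: "real ^ 'n \<Rightarrow> complex" where
  "low_pass \<xi> = complex_of_real (cutoff ((norm \<xi>)\<^sup>2))"

definition band_pass :: "real \<Rightarrow> real ^ 'n \<Rightarrow> complex" where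
  "band_pass s \<xi> = complex_of_real (band (- s / 2) ((norm \<xi>)\<^sup>2))"

lemma low_pass_radial_span: "low_pass \<in> radial_span"
  unfolding low_pass_def[abs_def] by (rule radial_span.radial[OF rapid_cutoff])

lemma band_pass_radial_span: "band_pass s \<in> radial_span"
  unfolding band_pass_def[abs_def] by (rule radial_span.radial[OF rapid_band])

lemma low_pass_0: "low_pass 0 = 1"
  by (simp add: low_pass_def cutoff_def)

section \<open>Symbols and their kernels\<close>

lemma radial_scale_radial_span:
  "rapid B \<Longrightarrow> (\<lambda>\<xi>::real ^ 'n::finite. complex_of_real (B ((norm (c *\<^sub>R \<xi>))\<^sup>2))) \<in> radial_span" if "0 < c"
  using radial_span.radial[OF rapid_scale[of B "c\<^sup>2" 1]] that by (simp add: power_mult_distrib)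

text \<open>The power -s/2 of |xi|^2 cancels |xi|^s away from 0; at 0 both sides vanish.\<close>

lemma norm_powr_band_pass:
  "complex_of_real (norm \<xi> powr s) * band_pass s \<xi> = low_pass \<xi> - low_pass (2 *\<^sub>R \<xi>)"
proof (cases "\<xi> = 0")
  case False
  then have "norm \<xi> powr s * ((norm \<xi>)\<^sup>2) powr (- s / 2) = 1"
    by (simp add: powr_powr powr_minus flip: powr_numeral)
  then have "norm \<xi> powr s * band (- s / 2) ((norm \<xi>)\<^sup>2) = cutoff ((norm \<xi>)\<^sup>2) - cutoff (4 * (norm \<xi>)\<^sup>2)"
    unfolding band_def mult.left_commute[of "norm \<xi> powr s"] by simp
  then show ?thesis
    unfolding band_pass_def low_pass_def of_real_mult[symmetric] of_real_diff[symmetric]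
    by (simp add: power_mult_distrib)
qed (simp add: band_pass_def low_pass_def band_def)

lemma fourier_modulate:
  fixes f :: "real ^ 'n \<Rightarrow> complex"
  assumes [measurable]: "f \<in> borel_measurable borel"
  shows "fourier (\<lambda>\<xi>. cis (x \<bullet> \<xi>) * f \<xi>) y = fourier f (y - x)"
proof -
  have "fourier (\<lambda>\<xi>. cis (x \<bullet> \<xi>) * f \<xi>) y = (LINT \<xi>|lborel. cis (- (\<xi> \<bullet> y)) * (cis (x \<bullet> \<xi>) * f \<xi>))"
    by (rule fourier_lborel) measurable
  also have "\<dots> = (LINT \<xi>|lborel. cis (- (\<xi> \<bullet> (y - x))) * f \<xi>)"
  proof (intro Bochner_Integration.integral_cong refl)
    fix \<xi>
    have "cis (- (\<xi> \<bullet> (y - x))) = cis (- (\<xi> \<bullet> y)) * cis (x \<bullet> \<xi>)"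
      by (simp add: cis_mult inner_diff_right inner_commute)
    then show "cis (- (\<xi> \<bullet> y)) * (cis (x \<bullet> \<xi>) * f \<xi>) = cis (- (\<xi> \<bullet> (y - x))) * f \<xi>" by (simp add: mult.assoc)
  qed
  also have "\<dots> = fourier f (y - x)" by (rule fourier_lborel[symmetric]) measurable
  finally show ?thesis .
qed

lemma fourier_diff:
  fixes f g :: "real ^ 'n \<Rightarrow> complex"
  assumes "integrable lborel f" "integrable lborel g"
  shows "fourier (\<lambda>\<xi>. f \<xi> - g \<xi>) y = fourier f y - fourier g y"
proof -
  have [measurable]: "f \<in> borel_measurable borel" "g \<in> borel_measurable borel"
    using assms[THEN borel_measurable_integrable] by simp_all
  have "fourier (\<lambda>\<xi>. f \<xi> - g \<xi>) y = (LINT \<xi>|lborel. cis (- (\<xi> \<bullet> y)) * (f \<xi> - g \<xi>))"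
    by (rule fourier_lborel) measurable
  also have "\<dots> = fourier f y - fourier g y"
    using assms[THEN integrable_character_mult, of y] by (simp add: fourier_lborel right_diff_distrib)
  finally show ?thesis .
qed

lemma low_pass_scale_radial_span: "(\<lambda>\<xi>::real ^ 'n::finite. low_pass (2 powi j *\<^sub>R \<xi>)) \<in> radial_span"
  unfolding low_pass_def by (rule radial_scale_radial_span[OF _ rapid_cutoff]) simp

lemma band_pass_scale_radial_span: "(\<lambda>\<xi>::real ^ 'n::finite. band_pass s (2 powi j *\<^sub>R \<xi>)) \<in> radial_span"
  unfolding band_pass_def by (rule radial_scale_radial_span[OF _ rapid_band]) simp

lemma fourier_low_pass_modulate:
  fixes x :: "real ^ 'n::finite"
  shows "fourier (\<lambda>\<xi>. cis (x \<bullet> \<xi>) * low_pass (2 powi (- j) *\<^sub>R \<xi>)) = (\<lambda>y. dilate (fourier low_pass) j (y - x))"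
proof
  fix y
  note [measurable] = radial_span_measurable[OF low_pass_scale_radial_span] radial_span_measurable[OF low_pass_radial_span]
  have "fourier (\<lambda>\<xi>. cis (x \<bullet> \<xi>) * low_pass (2 powi (- j) *\<^sub>R \<xi>)) y = fourier (\<lambda>\<xi>. low_pass (2 powi (- j) *\<^sub>R \<xi>)) (y - x)"
    by (rule fourier_modulate) measurable
  then show "fourier (\<lambda>\<xi>. cis (x \<bullet> \<xi>) * low_pass (2 powi (- j) *\<^sub>R \<xi>)) y = dilate (fourier low_pass) j (y - x)"
    by (subst (asm) fourier_dilate[OF radial_span_measurable[OF low_pass_radial_span]])
qed

lemma low_pass_kernel_schwartz:
  fixes x :: "real ^ 'n::finite"
  shows "(\<lambda>y. dilate (fourier low_pass) j (y - x)) \<in> schwartz"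
  unfolding fourier_low_pass_modulate[symmetric]
  by (intro fourier_schwartz radial_span.character low_pass_scale_radial_span)

text \<open>The right-hand side does not mention \<open>v\<close>: all versions of the fractional Laplacian of \<open>u\<close> have
  the same convolutions.\<close>

lemma frac_laplacian_conv:
  fixes u v :: "(real ^ 'n::finite \<Rightarrow> complex) \<Rightarrow> complex" and x :: "real ^ 'n"
  assumes uv: "frac_laplacian s u v" and v: "\<And>\<phi>. \<phi> \<in> schwartz \<Longrightarrow> v \<phi> = (LINT x|lborel. g x * \<phi> x)"
  shows "complex_of_real (2 powr (- real_of_int j * s)) * conv (fourier (band_pass s)) j g x
    = u (\<lambda>y. dilate (fourier low_pass) j (y - x) - dilate (fourier low_pass) (j - 1) (y - x))"
proof -
  let ?c = "complex_of_real (2 powr (- real_of_int j * s))"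
  \<comment> \<open>Its transform is 2^(-js) times the dilated kernel centred at x, and it vanishes
    for |\<xi>| < 2^j / 2, so it is an admissible test function in
    \<open>frac_laplacian\<close>.\<close>
  define \<psi> where "\<psi> \<xi> = ?c * (cis (x \<bullet> \<xi>) * band_pass s (2 powi (- j) *\<^sub>R \<xi>))" for \<xi>
  have \<psi>: "\<psi> \<in> radial_span"
    unfolding \<psi>_def[abs_def] by (intro radial_span.cmult radial_span.character band_pass_scale_radial_span)
  have vanish: "\<psi> \<xi> = 0" if "norm \<xi> < 2 powi j / 2" for \<xi>
  proof -
    have "norm (2 powi (- j) *\<^sub>R \<xi>) < 1 / 2"
      using that by (simp add: power_int_minus field_simps)
    then have "(norm (2 powi (- j) *\<^sub>R \<xi>))\<^sup>2 \<le> (1 / 2)\<^sup>2" by (intro power_mono) auto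
    then have "band (- s / 2) ((norm (2 powi (- j) *\<^sub>R \<xi>))\<^sup>2) = 0"
      by (intro band_eq_0) (simp add: power2_eq_square)
    then show ?thesis unfolding \<psi>_def band_pass_def by simp
  qed
  have "fourier_dist v \<psi> = fourier_dist u (\<lambda>\<xi>. complex_of_real (norm \<xi> powr s) * \<psi> \<xi>)"
  proof -
    have "\<exists>r>0. \<forall>\<xi>. norm \<xi> < r \<longrightarrow> \<psi> \<xi> = 0"
      using vanish by (intro exI[of _ "2 powi j / 2"]) auto
    then show ?thesis using uv radial_span_schwartz[OF \<psi>] unfolding frac_laplacian_def by blast
  qed
  moreover have "fourier_dist v \<psi> = ?c * conv (fourier (band_pass s)) j g x"
  proof -
    note [measurable] = radial_span_measurable[OF band_pass_scale_radial_span] radial_span_measurable[OF band_pass_radial_span]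
    have F: "fourier \<psi> y = ?c * dilate (fourier (band_pass s)) j (y - x)" for y
    proof -
      have "fourier \<psi> y = ?c * fourier (\<lambda>\<xi>. cis (x \<bullet> \<xi>) * band_pass s (2 powi (- j) *\<^sub>R \<xi>)) y"
        unfolding \<psi>_def[abs_def] by (rule fourier_cmult)
      also have "fourier (\<lambda>\<xi>. cis (x \<bullet> \<xi>) * band_pass s (2 powi (- j) *\<^sub>R \<xi>)) y = fourier (\<lambda>\<xi>. band_pass s (2 powi (- j) *\<^sub>R \<xi>)) (y - x)"
        by (rule fourier_modulate) measurable
      finally show ?thesis
        by (subst (asm) fourier_dilate[OF radial_span_measurable[OF band_pass_radial_span]])
    qed
    have "fourier_dist v \<psi> = (LINT y|lborel. g y * fourier \<psi> y)"
      unfolding fourier_dist_def by (rule v[OF fourier_schwartz[OF \<psi>]])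
    also have "\<dots> = (LINT y|lborel. ?c * (g y * dilate (fourier (band_pass s)) j (y - x)))"
      unfolding F by (simp only: mult.left_commute)
    finally show ?thesis unfolding conv_def by simp
  qed
  moreover have "fourier_dist u (\<lambda>\<xi>. complex_of_real (norm \<xi> powr s) * \<psi> \<xi>)
    = u (\<lambda>y. dilate (fourier low_pass) j (y - x) - dilate (fourier low_pass) (j - 1) (y - x))"
  proof -
    let ?A = "\<lambda>j \<xi>. cis (x \<bullet> \<xi>) * low_pass (2 powi (- j) *\<^sub>R \<xi>)"
    have A: "?A j \<in> radial_span" for j by (intro radial_span.character low_pass_scale_radial_span)
    have "(\<lambda>\<xi>. complex_of_real (norm \<xi> powr s) * \<psi> \<xi>) = (\<lambda>\<xi>. ?A j \<xi> - ?A (j - 1) \<xi>)"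
    proof
      fix \<xi> :: "real ^ 'n"
      let ?z = "2 powi (- j) *\<^sub>R \<xi>"
      \<comment> \<open>The weight 2^(-js) converts |\<xi>|^s into the power of |2^(-j) \<xi>| that
        the band symbol at scale j divides out.\<close>
      have "norm ?z powr s = 2 powr (- real_of_int j * s) * norm \<xi> powr s"
        by (simp add: powr_mult powr_real_of_int'[symmetric] powr_powr del: power_int_minus)
      then have "complex_of_real (norm \<xi> powr s) * \<psi> \<xi> = cis (x \<bullet> \<xi>) * (complex_of_real (norm ?z powr s) * band_pass s ?z)"
        unfolding \<psi>_def by (simp only: of_real_mult mult_ac)
      also have "\<dots> = cis (x \<bullet> \<xi>) * (low_pass ?z - low_pass (2 *\<^sub>R ?z))"
        by (simp only: norm_powr_band_pass)
      also have "2 *\<^sub>R ?z = 2 powi (- (j - 1)) *\<^sub>R \<xi>"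
        by (simp add: power_int_diff power_int_minus divide_inverse)
      finally show "complex_of_real (norm \<xi> powr s) * \<psi> \<xi> = ?A j \<xi> - ?A (j - 1) \<xi>"
        by (simp only: right_diff_distrib)
    qed
    moreover have "fourier (\<lambda>\<xi>. ?A j \<xi> - ?A (j - 1) \<xi>) = (\<lambda>y. fourier (?A j) y - fourier (?A (j - 1)) y)"
      by (rule ext, rule fourier_diff) (intro radial_span_integrable A)+
    ultimately show ?thesis
      unfolding fourier_dist_def fourier_low_pass_modulate by simp
  qed
  ultimately show ?thesis by simp
qed

section \<open>Telescoping on Schwartz functions\<close>

text \<open>Against the bounded function \<phi> each of the two kernels is integrable separately, so
  the pairing splits into terms that telescope in j.\<close>

lemma regular_dist_low_pass_diff:
  fixes \<phi> :: "real ^ 'n::finite \<Rightarrow> complex"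
  assumes \<phi>: "\<phi> \<in> schwartz"
  shows "regular_dist \<phi> (\<lambda>y. dilate (fourier low_pass) j (y - x) - dilate (fourier low_pass) i (y - x))
    = conv (fourier low_pass) j \<phi> x - conv (fourier low_pass) i \<phi> x"
proof -
  note [measurable] = schwartz_measurable[OF \<phi>] schwartz_measurable[OF low_pass_kernel_schwartz]
  obtain M where M: "\<And>x. norm (\<phi> x) \<le> M" using decays_bounded[OF schwartz_decays[OF \<phi>]] by blast
  have I: "integrable lborel (\<lambda>y. \<phi> y * dilate (fourier low_pass) j (y - x))" for j
  proof (rule Bochner_Integration.integrable_bound)
    show "integrable lborel (\<lambda>y. M * norm (dilate (fourier low_pass) j (y - x)))"
      by (intro integrable_mult_right integrable_norm decays_integrable schwartz_decays low_pass_kernel_schwartz) measurable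
    show "AE y in lborel. norm (\<phi> y * dilate (fourier low_pass) j (y - x)) \<le> norm (M * norm (dilate (fourier low_pass) j (y - x)))"
    proof (intro AE_I2)
      fix y
      have "norm (\<phi> y * dilate (fourier low_pass) j (y - x)) \<le> M * norm (dilate (fourier low_pass) j (y - x))"
        unfolding norm_mult by (intro mult_right_mono M) auto
      then show "norm (\<phi> y * dilate (fourier low_pass) j (y - x)) \<le> norm (M * norm (dilate (fourier low_pass) j (y - x)))"
        by simp
    qed
  qed measurable
  have "regular_dist \<phi> (\<lambda>y. dilate (fourier low_pass) j (y - x) - dilate (fourier low_pass) i (y - x))
    = (LINT y|lborel. \<phi> y * (dilate (fourier low_pass) j (y - x) - dilate (fourier low_pass) i (y - x)))"
    unfolding regular_dist_def by (rule integral_completion) measurable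
  then show ?thesis unfolding conv_def by (simp add: right_diff_distrib I)
qed

lemma sum_telescope_int:
  fixes a :: "int \<Rightarrow> 'a::ab_group_add"
  shows "(\<Sum>j\<in>{- int N..int N}. a j - a (j - 1)) = a (int N) - a (- int N - 1)"
proof (induction N)
  case (Suc N)
  have "{- int (Suc N)..int (Suc N)} = insert (- int (Suc N)) (insert (int (Suc N)) {- int N..int N})" by auto
  then have "(\<Sum>j\<in>{- int (Suc N)..int (Suc N)}. a j - a (j - 1)) = (a (- int (Suc N)) - a (- int (Suc N) - 1))
      + ((a (int (Suc N)) - a (int (Suc N) - 1)) + (\<Sum>j\<in>{- int N..int N}. a j - a (j - 1)))"
    by (simp del: of_nat_Suc)
  moreover have "int (Suc N) - 1 = int N" "- int N - 1 = - int (Suc N)" by simp_all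
  ultimately show ?case unfolding Suc by (simp del: of_nat_Suc)
qed simp

lemma potential_sum_cmult:
  "potential_sum k s (\<lambda>y. c * v y) N x = c * potential_sum k s v N x"
  unfolding potential_sum_def conv_cmult by (simp add: sum_distrib_left mult.left_commute)

text \<open>Each term is u, respectively u minus the pairing with \<phi>, at the same low-pass
  difference. So u cancels, and what remains concerns the Schwartz function alone and
  telescopes.\<close>

lemma potential_sum_diff:
  fixes u :: "(real ^ 'n::finite \<Rightarrow> complex) \<Rightarrow> complex"
  assumes u: "frac_laplacian s u v" "\<And>\<phi>. \<phi> \<in> schwartz \<Longrightarrow> v \<phi> = (LINT x|lborel. g x * \<phi> x)"
    and w: "frac_laplacian s (\<lambda>\<psi>. u \<psi> - regular_dist \<phi> \<psi>) v'" "\<And>\<phi>. \<phi> \<in> schwartz \<Longrightarrow> v' \<phi> = (LINT x|lborel. g' x * \<phi> x)"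
    and \<phi>: "\<phi> \<in> schwartz"
  shows "potential_sum (fourier (band_pass s)) s g N x - potential_sum (fourier (band_pass s)) s g' N x
    = conv (fourier low_pass) (int N) \<phi> x - conv (fourier low_pass) (- int N - 1) \<phi> x"
proof -
  define D where "D j = (\<lambda>y. dilate (fourier low_pass) j (y - x) - dilate (fourier low_pass) (j - 1) (y - x))" for j
  have "complex_of_real (2 powr (- real_of_int j * s)) * conv (fourier (band_pass s)) j g x = u (D j)" for j
    unfolding D_def by (rule frac_laplacian_conv[OF u(1) u(2)])
  moreover have "complex_of_real (2 powr (- real_of_int j * s)) * conv (fourier (band_pass s)) j g' x
      = u (D j) - (conv (fourier low_pass) j \<phi> x - conv (fourier low_pass) (j - 1) \<phi> x)" for j
    unfolding D_def regular_dist_low_pass_diff[OF \<phi>, symmetric] by (rule frac_laplacian_conv[OF w(1) w(2)])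
  ultimately have "potential_sum (fourier (band_pass s)) s g N x - potential_sum (fourier (band_pass s)) s g' N x
      = (\<Sum>j\<in>{- int N..int N}. conv (fourier low_pass) j \<phi> x - conv (fourier low_pass) (j - 1) \<phi> x)"
    unfolding potential_sum_def by (simp only: sum_subtractf[symmetric]) simp
  also have "\<dots> = conv (fourier low_pass) (int N) \<phi> x - conv (fourier low_pass) (- int N - 1) \<phi> x"
    by (rule sum_telescope_int)
  finally show ?thesis .
qed

text \<open>|F| |\<psi>| \<le> M |F|^t + |\<psi>|, because |F| \<le> |F|^t + 1. The bound depends on
  F only through its modular, hence is uniform over all F with the same K.\<close>

lemma pairing_bound:
  fixes F \<psi> :: "'a::euclidean_space \<Rightarrow> complex"
  assumes [measurable]: "F \<in> borel_measurable borel" and \<psi>: "integrable lborel \<psi>" and M: "\<And>x. norm (\<psi> x) \<le> M"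
    and F: "(\<integral>\<^sup>+x. ennreal (norm (F x) powr t) \<partial>lborel) \<le> ennreal K" and t: "1 \<le> t" and K: "0 \<le> K"
  shows "integrable lborel (\<lambda>x. F x * \<psi> x)"
    and "norm (LINT x|lborel. F x * \<psi> x) \<le> M * K + (LINT x|lborel. norm (\<psi> x))"
proof -
  have [measurable]: "\<psi> \<in> borel_measurable borel" using borel_measurable_integrable[OF \<psi>] by simp
  have M0: "0 \<le> M" using M[of 0] norm_ge_zero[of "\<psi> 0"] by linarith
  define J where "J = (LINT x|lborel. norm (\<psi> x))"
  have J: "0 \<le> J" "(\<integral>\<^sup>+x. ennreal (norm (\<psi> x)) \<partial>lborel) = ennreal J"
    unfolding J_def using \<psi> by (auto intro!: nn_integral_eq_integral)
  have "(\<integral>\<^sup>+x. ennreal (norm (F x * \<psi> x)) \<partial>lborel) \<le> (\<integral>\<^sup>+x. (ennreal M * ennreal (norm (F x) powr t) + ennreal (norm (\<psi> x))) \<partial>lborel)"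
  proof (rule nn_integral_mono)
    fix x
    have "norm (F x) \<le> norm (F x) powr t + 1" using powr_le_powr_add_1[of "norm (F x)" 1 t] t by simp
    then have "norm (F x) * norm (\<psi> x) \<le> (norm (F x) powr t + 1) * norm (\<psi> x)" by (intro mult_right_mono) auto
    also have "\<dots> \<le> M * norm (F x) powr t + norm (\<psi> x)"
      using mult_left_mono[OF M[of x], of "norm (F x) powr t"] by (simp add: algebra_simps)
    finally have "ennreal (norm (F x * \<psi> x)) \<le> ennreal (M * norm (F x) powr t + norm (\<psi> x))"
      by (intro ennreal_leI) (simp add: norm_mult)
    then show "ennreal (norm (F x * \<psi> x)) \<le> ennreal M * ennreal (norm (F x) powr t) + ennreal (norm (\<psi> x))"
      using M0 by (simp add: ennreal_mult')
  qed
  also have "\<dots> = ennreal M * (\<integral>\<^sup>+x. ennreal (norm (F x) powr t) \<partial>lborel) + ennreal J"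
    by (simp add: nn_integral_add nn_integral_cmult J)
  also have "\<dots> \<le> ennreal M * ennreal K + ennreal J" using F by (intro add_right_mono mult_left_mono) auto
  also have "\<dots> = ennreal (M * K + J)" using M0 K J by (simp add: ennreal_mult')
  finally have bd: "(\<integral>\<^sup>+x. ennreal (norm (F x * \<psi> x)) \<partial>lborel) \<le> ennreal (M * K + J)" .
  show I: "integrable lborel (\<lambda>x. F x * \<psi> x)"
    by (rule integrableI_bounded) (use bd in \<open>auto intro: order_le_less_trans\<close>)
  have "ennreal (norm (LINT x|lborel. F x * \<psi> x)) \<le> ennreal (M * K + J)"
    using integral_norm_bound_ennreal[OF I] bd by (rule order_trans)
  then show "norm (LINT x|lborel. F x * \<psi> x) \<le> M * K + (LINT x|lborel. norm (\<psi> x))"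
    using M0 K J unfolding J_def by (subst (asm) ennreal_le_iff) auto
qed

section \<open>The embedding inequality\<close>

theorem theorem3:
  fixes p \<sigma> :: "real ^ 'n::finite \<Rightarrow> ereal" and \<pp> s \<theta> :: real
  assumes "1 < \<pp>"
    and "p \<in> log_exponents"
    and "1 < exponent_inf p" and "exponent_inf p \<le> exponent_sup p" and "exponent_sup p < \<infinity>"
    and "0 < s"
    and "ereal s < min (ereal (real CARD('n)) / exponent_sup p) (ereal (real CARD('n) / \<pp>))"
    and "\<theta> = s * \<pp> / real CARD('n)"
    and "\<sigma> = (\<lambda>x. p x / ereal (1 - \<theta>))"
  shows "\<exists>C::real. C > 0 \<and>
           (\<forall>f \<in> mixed_space s p \<pp>. Lp_norm \<sigma> f \<le> ennreal C * mixed_norm s p \<pp> f)"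
proof -
  define k :: "real ^ 'n \<Rightarrow> complex" where "k = fourier (band_pass s)"
  have k: "decays k" "k \<in> borel_measurable borel"
    unfolding k_def by (intro schwartz_decays schwartz_measurable fourier_schwartz band_pass_radial_span)+
  \<comment> \<open>The integral of the low-pass kernel, by inversion at the origin with
    \<open>low_pass_0\<close>; it is the factor in front of u in the dyadic series.\<close>
  define c where "c = (fourier (gauss :: real ^ 'n \<Rightarrow> complex) 0)\<^sup>2"
  have c0: "c \<noteq> 0" unfolding c_def using fourier_gauss_0_neq by simp
  have c: "(LINT x::real ^ 'n|lborel. fourier low_pass x) = c"
    unfolding c_def by (simp add: integral_fourier low_pass_radial_span low_pass_0)
  have s: "0 < s" "s < CARD('n) / \<pp>" using assms(6,7) by auto
  have \<pp>0: "0 \<le> \<pp>" using assms(1) by simp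
  have \<theta>: "0 < \<theta>" "\<theta> < 1" unfolding assms(8) using s assms(1) by (auto simp: field_simps)
  obtain P q b L Pinf where p: "p = (\<lambda>x. ereal (P x))" and contP: "continuous_on UNIV P" and q: "1 < q"
    and Pq: "\<And>x. q \<le> P x" and Pb: "\<And>x. P x \<le> b" and L: "0 \<le> L"
    and loc: "\<And>x y. \<bar>P x - P y\<bar> \<le> L / ln (exp 1 + 1 / norm (x - y))"
    and inf: "\<And>x. \<bar>P x - Pinf\<bar> \<le> L / ln (exp 1 + norm x)"
    by (rule finite_exponent_representation[OF assms(2,3,5)]) (rule that)
  have Pm: "P \<in> borel_measurable borel" using contP by (rule borel_measurable_continuous_onI)
  have P1: "1 \<le> P x" for x using Pq[of x] q by linarith
  obtain Cp where Cp: "0 < Cp" "\<And>f. f \<in> borel_measurable borel \<Longrightarrow> (\<And>x. 0 \<le> f x) \<Longrightarrow>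
      (\<integral>\<^sup>+x. ennreal (f x powr P x) \<partial>lborel) \<le> 1 \<Longrightarrow>
      (AE x in lborel. maximal (\<lambda>y. ennreal (f y)) x < \<top>) \<and>
      (\<integral>\<^sup>+x. ennreal (enn2real (maximal (\<lambda>y. ennreal (f y)) x) powr P x) \<partial>lborel) \<le> ennreal Cp"
    using maximal_variable_exponent[OF Pm q Pq Pb L loc inf] by blast
  \<comment> \<open>A constant exponent satisfies the log-Hoelder conditions with L = 0.\<close>
  obtain Cq where Cq: "0 < Cq" "\<And>f :: real ^ 'n \<Rightarrow> real. f \<in> borel_measurable borel \<Longrightarrow> (\<And>x. 0 \<le> f x) \<Longrightarrow>
      (\<integral>\<^sup>+x. ennreal (f x powr \<pp>) \<partial>lborel) \<le> 1 \<Longrightarrow>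
      (AE x in lborel. maximal (\<lambda>y. ennreal (f y)) x < \<top>) \<and>
      (\<integral>\<^sup>+x. ennreal (enn2real (maximal (\<lambda>y. ennreal (f y)) x) powr \<pp>) \<partial>lborel) \<le> ennreal Cq"
    using maximal_variable_exponent[of "\<lambda>_::real ^ 'n. \<pp>" \<pp> \<pp> 0 \<pp>] assms(1) by auto
  obtain Kp where Kp: "0 \<le> Kp" "\<And>v w. v \<in> borel_measurable borel \<Longrightarrow> w \<in> borel_measurable borel \<Longrightarrow>
    (\<integral>\<^sup>+y. ennreal (norm (v y) powr P y) \<partial>lborel) \<le> 1 \<Longrightarrow>
    (\<integral>\<^sup>+y. ennreal (norm (w y) powr \<pp>) \<partial>lborel) \<le> 1 \<Longrightarrow>
    (\<And>j x. conv k j v x = conv k j w x) \<Longrightarrow>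
    (AE x in lborel. (\<lambda>N. potential_sum k s w N x) \<longlonglongrightarrow> potential k s w x) \<and>
    (\<integral>\<^sup>+x. ennreal (norm (potential k s w x) powr (P x / (1 - \<theta>))) \<partial>lborel) \<le> ennreal Kp"
  proof (rule potential_modular[OF k assms(1) s Pm P1 Pb, where Cm = Cp, folded assms(8)], goal_cases)
    case (1 f)
    show ?case by (rule Cp(2)[OF 1(2,3,4)])
  next
    case 2
    show ?case using Cp(1) by simp
  next
    case (3 C)
    show ?case by (rule that[OF 3(2)]) (rule 3(3))
  qed
  \<comment> \<open>The instance with v = w at the constant exponent. It governs the remainders u -
    \<phi> i of the approximation, and makes F0 locally well behaved enough to be paired with
    Schwartz functions.\<close>
  obtain Kq where Kq: "0 \<le> Kq" "\<And>w. w \<in> borel_measurable borel \<Longrightarrow>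
    (\<integral>\<^sup>+y. ennreal (norm (w y) powr \<pp>) \<partial>lborel) \<le> 1 \<Longrightarrow>
    (AE x in lborel. (\<lambda>N. potential_sum k s w N x) \<longlonglongrightarrow> potential k s w x) \<and>
    (\<integral>\<^sup>+x. ennreal (norm (potential k s w x) powr (\<pp> / (1 - \<theta>))) \<partial>lborel) \<le> ennreal Kq"
  proof -
    have pc: "(\<lambda>_. \<pp>) \<in> borel_measurable borel" "1 \<le> \<pp>" "\<pp> \<le> \<pp>" using assms(1) by auto
    show thesis
    proof (rule potential_modular[OF k assms(1) s pc, where Cm = Cq, folded assms(8)], goal_cases)
      case (1 f)
      then show ?case by (rule Cq(2))
    next
      case 2
      show ?case using Cq(1) by simp
    next
      case (3 C)
      show ?case by (rule that[OF 3(1)]) (rule 3(2), auto)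
    qed
  qed
  \<comment> \<open>At least 1, so that K to an exponent \<ge> 1 is at least K; this turns the
    modular bound into a bound of the Luxemburg norm.\<close>
  define K where "K = max 1 Kp"
  have K: "1 \<le> K" "Kp \<le> K" unfolding K_def by auto
  define C where "C = K / norm c"
  have C: "0 < C" unfolding C_def using K c0 by simp
  \<comment> \<open>A number a strictly above the norm permits versions whose modular is at most 1
    after division by a; at the end a is lowered to the norm.\<close>
  have main: "Lp_norm \<sigma> u \<le> ennreal (C * a)" if u: "u \<in> mixed_space s p \<pp>" and a: "mixed_norm s p \<pp> u < ennreal a" for u a
  proof -
    have a0: "0 < a"
    proof (rule ccontr)
      assume "\<not> 0 < a"
      then have "ennreal a = 0" by (simp add: ennreal_neg)
      with a show False by simp
    qed
    have a1: "W_norm s p u < ennreal a" and a2: "W_norm s (\<lambda>_. ereal \<pp>) u < ennreal a"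
      using a unfolding mixed_norm_def by auto
    obtain v1 g1 where v1: "frac_laplacian s u v1" "g1 \<in> borel_measurable borel"
      "\<And>\<phi>. \<phi> \<in> schwartz \<Longrightarrow> v1 \<phi> = (LINT x|lborel. g1 x * \<phi> x)"
      "(\<integral>\<^sup>+x. ennreal (norm (complex_of_real (1 / a) * g1 x) powr P x) \<partial>lborel) \<le> 1"
      using W_norm_less[OF a1 p order_trans[OF zero_le_one P1]] by blast
    obtain v2 g2 where v2: "frac_laplacian s u v2" "g2 \<in> borel_measurable borel"
      "\<And>\<phi>. \<phi> \<in> schwartz \<Longrightarrow> v2 \<phi> = (LINT x|lborel. g2 x * \<phi> x)"
      "(\<integral>\<^sup>+x. ennreal (norm (complex_of_real (1 / a) * g2 x) powr \<pp>) \<partial>lborel) \<le> 1"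
      using W_norm_less[OF a2 refl \<pp>0] by blast
    define h1 where "h1 y = complex_of_real (1 / a) * g1 y" for y
    define h2 where "h2 y = complex_of_real (1 / a) * g2 y" for y
    note [measurable] = Pm
    have [measurable]: "h1 \<in> borel_measurable borel" "h2 \<in> borel_measurable borel" "k \<in> borel_measurable borel"
      using v1(2) v2(2) k(2) unfolding h1_def[abs_def] h2_def[abs_def] by measurable
    have conv_eq: "conv k j h1 x = conv k j h2 x" for j x
    proof -
      have "complex_of_real (2 powr (- real_of_int j * s)) * conv k j g1 x = complex_of_real (2 powr (- real_of_int j * s)) * conv k j g2 x"
        unfolding k_def
        by (rule trans[OF frac_laplacian_conv[OF v1(1,3)] frac_laplacian_conv[OF v2(1,3), symmetric]])
      then have "conv k j g1 x = conv k j g2 x" by simp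
      then show ?thesis unfolding h1_def[abs_def] h2_def[abs_def] conv_cmult by simp
    qed
    define F0 where "F0 = potential k s h2"
    have [measurable]: "F0 \<in> borel_measurable borel" unfolding F0_def by measurable
    have lim0: "AE x in lborel. (\<lambda>N. potential_sum k s h2 N x) \<longlonglongrightarrow> F0 x"
      and modp: "(\<integral>\<^sup>+x. ennreal (norm (F0 x) powr (P x / (1 - \<theta>))) \<partial>lborel) \<le> ennreal Kp"
      unfolding F0_def using Kp(2)[of h1 h2] v1(4) v2(4) conv_eq by (auto simp: h1_def h2_def)
    have modq: "(\<integral>\<^sup>+x. ennreal (norm (F0 x) powr (\<pp> / (1 - \<theta>))) \<partial>lborel) \<le> ennreal Kq"
      unfolding F0_def using Kq(2)[of h2] v2(4) by (auto simp: h2_def)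
    have t: "1 \<le> \<pp> / (1 - \<theta>)" using assms(1) \<theta> by (simp add: field_simps)
    \<comment> \<open>The sequence furnished by the constant exponent space, in whose norm the
      remainders are measured.\<close>
    obtain \<phi> where \<phi>: "\<And>i. \<phi> i \<in> schwartz"
      "\<And>\<psi>. \<psi> \<in> schwartz \<Longrightarrow> (\<lambda>i. regular_dist (\<phi> i) \<psi>) \<longlonglongrightarrow> u \<psi>"
      "(\<lambda>i. W_norm s (\<lambda>_. ereal \<pp>) (\<lambda>\<psi>. u \<psi> - regular_dist (\<phi> i) \<psi>)) \<longlonglongrightarrow> 0"
      using u unfolding mixed_space_def W_space_def by blast
    have pair: "integrable lborel (\<lambda>x. F0 x * \<psi> x)" "c * u \<psi> = a * (LINT x|lborel. F0 x * \<psi> x)"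
      if \<psi>: "\<psi> \<in> schwartz" for \<psi>
    proof -
      note [measurable] = schwartz_measurable[OF \<psi>]
      obtain M where M: "\<And>x. norm (\<psi> x) \<le> M" using decays_bounded[OF schwartz_decays[OF \<psi>]] by blast
      have I\<psi>: "integrable lborel \<psi>" by (intro decays_integrable schwartz_decays \<psi>) measurable
      define D where "D = M * Kq + (LINT x|lborel. norm (\<psi> x))"
      have M0: "0 \<le> M" using M[of 0] norm_ge_zero[of "\<psi> 0"] by linarith
      have D: "0 \<le> D" unfolding D_def using M0 Kq(1) by simp
      show I0: "integrable lborel (\<lambda>x. F0 x * \<psi> x)"
        by (rule pairing_bound(1)[OF _ I\<psi> M modq t Kq(1)]) measurable
      \<comment> \<open>For a version g' of the remainder u - \<phi> i, the partial sums of g2 and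
        g' differ by low-pass averages of \<phi> i, whence a F0 - \<epsilon> F' = c \<phi> i almost
        everywhere. The pairing of F' with \<psi> is bounded by D independently of i.\<close>
      have close: "norm (c * regular_dist (\<phi> i) \<psi> - a * (LINT x|lborel. F0 x * \<psi> x)) \<le> \<epsilon> * D"
        if \<epsilon>: "0 < \<epsilon>" and W: "W_norm s (\<lambda>_. ereal \<pp>) (\<lambda>\<psi>. u \<psi> - regular_dist (\<phi> i) \<psi>) < ennreal \<epsilon>" for i \<epsilon>
      proof -
        obtain v' g' where v': "frac_laplacian s (\<lambda>\<psi>. u \<psi> - regular_dist (\<phi> i) \<psi>) v'" "g' \<in> borel_measurable borel"
          "\<And>\<phi>. \<phi> \<in> schwartz \<Longrightarrow> v' \<phi> = (LINT x|lborel. g' x * \<phi> x)"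
          "(\<integral>\<^sup>+x. ennreal (norm (complex_of_real (1 / \<epsilon>) * g' x) powr \<pp>) \<partial>lborel) \<le> 1"
          using W_norm_less[OF W refl \<pp>0] by blast
        define h' where "h' y = complex_of_real (1 / \<epsilon>) * g' y" for y
        have [measurable]: "h' \<in> borel_measurable borel"
          using v'(2) unfolding h'_def[abs_def] by measurable
        define F' where "F' = potential k s h'"
        have [measurable]: "F' \<in> borel_measurable borel" unfolding F'_def by measurable
        have lim': "AE x in lborel. (\<lambda>N. potential_sum k s h' N x) \<longlonglongrightarrow> F' x"
          and mod': "(\<integral>\<^sup>+x. ennreal (norm (F' x) powr (\<pp> / (1 - \<theta>))) \<partial>lborel) \<le> ennreal Kq"
          unfolding F'_def using Kq(2)[of h'] v'(4) by (auto simp: h'_def)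
        have I': "integrable lborel (\<lambda>x. F' x * \<psi> x)"
          by (rule pairing_bound(1)[OF _ I\<psi> M mod' t Kq(1)]) measurable
        have D': "norm (LINT x|lborel. F' x * \<psi> x) \<le> D"
          unfolding D_def by (rule pairing_bound(2)[OF _ I\<psi> M mod' t Kq(1)]) measurable
        have "AE x in lborel. a * F0 x - \<epsilon> * F' x = c * \<phi> i x"
          using lim0 lim'
        proof eventually_elim
          case (elim x)
          obtain M' where M': "\<And>x. norm (\<phi> i x) \<le> M'" using decays_bounded[OF schwartz_decays[OF \<phi>(1)]] by blast
          obtain B where B: "\<And>x. norm (fourier low_pass (x :: real ^ 'n)) \<le> B"
            using decays_bounded[OF fourier_decays[OF low_pass_radial_span]] by blast
          have Il: "integrable lborel (fourier low_pass :: real ^ 'n \<Rightarrow> complex)"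
            by (intro decays_integrable schwartz_decays schwartz_measurable fourier_schwartz low_pass_radial_span)
          have I\<phi>: "integrable lborel (\<phi> i)"
            by (intro decays_integrable schwartz_decays schwartz_measurable \<phi>)
          have l1: "(\<lambda>N. conv (fourier low_pass) (int N) (\<phi> i) x) \<longlonglongrightarrow> c * \<phi> i x"
            unfolding conv_def c[symmetric]
            by (rule dilate_tendsto[OF schwartz_continuous[OF \<phi>(1)] M' Il])
          have l2: "(\<lambda>N. conv (fourier low_pass) (- int N - 1) (\<phi> i) x) \<longlonglongrightarrow> 0"
            unfolding conv_def
            by (rule dilate_vanish[OF I\<phi> schwartz_measurable[OF fourier_schwartz[OF low_pass_radial_span]] B])
          have "(\<lambda>N. conv (fourier low_pass) (int N) (\<phi> i) x - conv (fourier low_pass) (- int N - 1) (\<phi> i) x) \<longlonglongrightarrow> c * \<phi> i x - 0"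
            by (intro tendsto_diff l1 l2)
          moreover have diff: "potential_sum k s g2 N x - potential_sum k s g' N x
              = conv (fourier low_pass) (int N) (\<phi> i) x - conv (fourier low_pass) (- int N - 1) (\<phi> i) x" for N
            unfolding k_def by (rule potential_sum_diff[OF v2(1,3) v'(1,3) \<phi>(1)])
          have "conv (fourier low_pass) (int N) (\<phi> i) x - conv (fourier low_pass) (- int N - 1) (\<phi> i) x
              = a * potential_sum k s h2 N x - \<epsilon> * potential_sum k s h' N x" for N
            unfolding diff[symmetric] h2_def[abs_def] h'_def[abs_def] potential_sum_cmult using a0 \<epsilon> by simp
          moreover have "(\<lambda>N. a * potential_sum k s h2 N x - \<epsilon> * potential_sum k s h' N x) \<longlonglongrightarrow> a * F0 x - \<epsilon> * F' x"
            by (intro tendsto_diff tendsto_mult tendsto_const elim)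
          ultimately show ?case by (simp add: LIMSEQ_unique)
        qed
        then have "AE x in lborel. c * (\<phi> i x * \<psi> x) = a * (F0 x * \<psi> x) - \<epsilon> * (F' x * \<psi> x)"
          by eventually_elim (metis left_diff_distrib mult.assoc)
        then have "(LINT x|lborel. c * (\<phi> i x * \<psi> x)) = (LINT x|lborel. a * (F0 x * \<psi> x) - \<epsilon> * (F' x * \<psi> x))"
          using schwartz_measurable[OF \<phi>(1)[of i]] by (intro integral_cong_AE) auto
        then have "c * regular_dist (\<phi> i) \<psi> = a * (LINT x|lborel. F0 x * \<psi> x) - \<epsilon> * (LINT x|lborel. F' x * \<psi> x)"
          using I0 I' by (simp add: regular_dist_lborel[OF \<phi>(1) \<psi>])
        then have "norm (c * regular_dist (\<phi> i) \<psi> - a * (LINT x|lborel. F0 x * \<psi> x)) = \<epsilon> * norm (LINT x|lborel. F' x * \<psi> x)"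
          using \<epsilon> by (simp add: norm_mult)
        also have "\<dots> \<le> \<epsilon> * D" using \<epsilon> D' by (intro mult_left_mono) auto
        finally show ?thesis .
      qed
      have "(\<lambda>i. c * regular_dist (\<phi> i) \<psi>) \<longlonglongrightarrow> a * (LINT x|lborel. F0 x * \<psi> x)"
      proof (rule LIMSEQ_I)
        fix e :: real assume e: "0 < e"
        \<comment> \<open>D + 1 instead of D, as D may be 0.\<close>
        define \<epsilon> where "\<epsilon> = e / (D + 1)"
        have \<epsilon>: "0 < \<epsilon>" "\<epsilon> * D < e" unfolding \<epsilon>_def using e D by (auto simp: field_simps)
        have "\<forall>\<^sub>F i in sequentially. W_norm s (\<lambda>_. ereal \<pp>) (\<lambda>\<psi>. u \<psi> - regular_dist (\<phi> i) \<psi>) < ennreal \<epsilon>"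
          using \<phi>(3) \<epsilon>(1) by (intro order_tendstoD(2)) auto
        then obtain n0 where "\<And>i. n0 \<le> i \<Longrightarrow> W_norm s (\<lambda>_. ereal \<pp>) (\<lambda>\<psi>. u \<psi> - regular_dist (\<phi> i) \<psi>) < ennreal \<epsilon>"
          unfolding eventually_sequentially by blast
        with close[OF \<epsilon>(1)] \<epsilon>(2)
        show "\<exists>n0. \<forall>i\<ge>n0. norm (c * regular_dist (\<phi> i) \<psi> - a * (LINT x|lborel. F0 x * \<psi> x)) < e"
          by (meson order_le_less_trans)
      qed
      moreover have "(\<lambda>i. c * regular_dist (\<phi> i) \<psi>) \<longlonglongrightarrow> c * u \<psi>"
        by (intro tendsto_mult tendsto_const \<phi>(2) \<psi>)
      ultimately show "c * u \<psi> = a * (LINT x|lborel. F0 x * \<psi> x)" by (rule LIMSEQ_unique[rotated])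
    qed
    \<comment> \<open>The pairing identity says that a F0 represents c u, so this is the function
      representing u.\<close>
    define F where "F x = (complex_of_real a / c) * F0 x" for x
    have [measurable]: "F \<in> borel_measurable borel" unfolding F_def[abs_def] by measurable
    have "represents F u"
      unfolding represents_def
    proof (intro conjI ballI)
      show "F \<in> borel_measurable lebesgue" by (rule measurable_completion) simp
      fix \<psi> :: "real ^ 'n \<Rightarrow> complex" assume \<psi>: "\<psi> \<in> schwartz"
      note [measurable] = schwartz_measurable[OF \<psi>]
      have "integrable lborel (\<lambda>x. (complex_of_real a / c) * (F0 x * \<psi> x))"
        by (intro integrable_mult_right pair(1) \<psi>)
      then have "integrable lborel (\<lambda>x. F x * \<psi> x)" unfolding F_def by (simp only: mult.assoc)
      then show "integrable lebesgue (\<lambda>x. F x * \<psi> x)"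
        by (subst integrable_completion) auto
      have "regular_dist F \<psi> = (LINT x|lborel. F x * \<psi> x)"
        unfolding regular_dist_def by (rule integral_completion) measurable
      also have "\<dots> = complex_of_real a / c * (LINT x|lborel. F0 x * \<psi> x)"
        unfolding F_def mult.assoc by simp
      also have "\<dots> = u \<psi>" using pair(2)[OF \<psi>] c0 by (simp add: field_simps)
      finally show "u \<psi> = regular_dist F \<psi>" by simp
    qed
    moreover have "lux_norm \<sigma> F \<le> ennreal (C * a)"
    proof -
      have Ca: "0 < C * a" using C a0 by simp
      have e1: "1 \<le> P x / (1 - \<theta>)" for x using P1[of x] \<theta> by (simp add: field_simps)
      have "(\<integral>\<^sup>+x. ennreal (norm (F x / complex_of_real (C * a)) powr real_of_ereal (\<sigma> x)) \<partial>lebesgue)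
        = (\<integral>\<^sup>+x. ennreal ((norm (F0 x) / K) powr (P x / (1 - \<theta>))) \<partial>lborel)"
        unfolding nn_integral_completion
      proof (rule nn_integral_cong)
        fix x
        have "norm (F x / complex_of_real (C * a)) = norm (F0 x) / K"
          unfolding F_def C_def using a0 c0 K by (simp add: norm_mult norm_divide)
        moreover have "real_of_ereal (\<sigma> x) = P x / (1 - \<theta>)"
          unfolding assms(9) p using \<theta> by simp
        ultimately show "ennreal (norm (F x / complex_of_real (C * a)) powr real_of_ereal (\<sigma> x)) = ennreal ((norm (F0 x) / K) powr (P x / (1 - \<theta>)))"
          by simp
      qed
      also have "\<dots> \<le> (\<integral>\<^sup>+x. ennreal (1 / K) * ennreal (norm (F0 x) powr (P x / (1 - \<theta>))) \<partial>lborel)"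
      proof (rule nn_integral_mono)
        fix x
        have "K powr 1 \<le> K powr (P x / (1 - \<theta>))" using K e1[of x] by (intro powr_mono) auto
        then have "norm (F0 x) powr (P x / (1 - \<theta>)) / K powr (P x / (1 - \<theta>)) \<le> norm (F0 x) powr (P x / (1 - \<theta>)) / K"
          using K by (intro divide_left_mono) auto
        then have "(norm (F0 x) / K) powr (P x / (1 - \<theta>)) \<le> 1 / K * norm (F0 x) powr (P x / (1 - \<theta>))"
          using K by (simp add: powr_divide)
        then show "ennreal ((norm (F0 x) / K) powr (P x / (1 - \<theta>))) \<le> ennreal (1 / K) * ennreal (norm (F0 x) powr (P x / (1 - \<theta>)))"
          using K by (simp only: ennreal_mult''[symmetric] powr_ge_zero ennreal_leI)
      qed
      also have "\<dots> = ennreal (1 / K) * (\<integral>\<^sup>+x. ennreal (norm (F0 x) powr (P x / (1 - \<theta>))) \<partial>lborel)"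
        by (intro nn_integral_cmult) measurable
      also have "\<dots> \<le> ennreal (1 / K) * ennreal K"
        using modp K by (intro mult_left_mono order_trans[OF modp] ennreal_leI) auto
      also have "\<dots> = 1" using K by (simp add: ennreal_mult'[symmetric])
      finally show ?thesis
        unfolding lux_norm_def using Ca by (intro Inf_lower) blast
    qed
    ultimately show ?thesis unfolding Lp_norm_def by (blast intro: Inf_lower2)
  qed
  show ?thesis
  proof (intro exI[of _ C] conjI ballI)
    show "0 < C" by (rule C)
    fix u assume u: "u \<in> mixed_space s p \<pp>"
    show "Lp_norm \<sigma> u \<le> ennreal C * mixed_norm s p \<pp> u"
    proof (cases "mixed_norm s p \<pp> u")
      case top
      then show ?thesis using C by (simp add: ennreal_mult_top)
    next
      case (real m)
      have le: "Lp_norm \<sigma> u \<le> ennreal (C * a)" if "m < a" for a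
        using main[OF u, of a] that real by (simp add: ennreal_less_iff)
      have "Lp_norm \<sigma> u < \<top>" using le[of "m + 1"] by (simp add: order_le_less_trans)
      then obtain l where l: "Lp_norm \<sigma> u = ennreal l" "0 \<le> l" by (cases "Lp_norm \<sigma> u") auto
      have "l / C \<le> a" if "m < a" for a
        using le[OF that] l C real that by (simp add: ennreal_le_iff field_simps)
      \<comment> \<open>The passage from all a > m to m itself; the case m = 0 is included.\<close>
      then have "l / C \<le> m" by (rule dense_ge)
      then have "l \<le> C * m" using C by (simp add: field_simps)
      then show ?thesis using l C real by (simp add: ennreal_mult'[symmetric] ennreal_leI)
    qed
  qed
qed

end
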